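(* Consider ALPC-SVRG for the general convex case (defined in the context), with each $f_i$ convex, $h$ convex, and $x^*$ a minimizer of $P$. Let $d_\lambda\ge0$ be such that almost surely, at every iteration and for every worker $i$, the number of coordinates of $u_{k+1}^i$ lying outside $[-2^{b-1}\delta_{k+1}^i,(2^{b-1}-1)\delta_{k+1}^i]$ is at most $d_\lambda$, let $\zeta=\frac{d\lambda^2}{4(2^{b-1}-1)^2}+d_\lambda(1-\lambda)^2+\frac{1}{NB}$, and suppose $\tau_2=\frac{5\zeta}{3}+\frac1{2B}\le\frac12$. Then there is an absolute constant $C>0$ such that $$\mathbf{E}\big[P(\tilde x^S)-P(x^* )\big]\le\frac{C}{mS^2}\Big[m\big(P(x_0)-P(x^* )\big)+L\|x_0-x^*\|^2\Big].$$
   Context: Problem setting: $f_1,\dots,f_n:\mathbb{R}^d\to\mathbb{R}$ are differentiable with $\|\nabla f_i(x)-\nabla f_i(y)\|\le L\|x-y\|$; $f=\frac1n\sum_if_i$; $h:\mathbb{R}^d\to\mathbb{R}\cup\{+\infty\}$ proper, convex, lower semicontinuous; $P=f+h$. Quantization: for an integer $b\ge2$ and $\delta>0$, $\mathrm{dom}(\delta,b)=\{k\delta:k\in\mathbb{Z},-2^{b-1}\le k\le 2^{b-1}-1\}$; the scalar quantizer $Q_{(\delta,b)}(y)$, for $y\in[-2^{b-1}\delta,(2^{b-1}-1)\delta]$ with $z$ the largest grid point $\le y$, equals $z$ with probability $\frac{z+\delta-y}{\delta}$ and $z+\delta$ otherwise; for $y$ outside this interval it equals the nearest grid point; on vectors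 it acts coordinatewise with independent randomness; if $\delta=0$ the output is $0$. ALPC-SVRG (general convex case) with $N$ workers, parameters $S,m,B\in\mathbb{N}$, $\lambda\in(0,1]$, $b\ge2$, $\tau_2\in[0,\frac12]$, and $x_0=y_0=z_0=\tilde x^0$: for $s=0,\dots,S-1$, set $\tau_{1,s}=\frac{2}{s+4}$, $\alpha_s=\frac{1}{6L\tau_{1,s}}$, and compute $\nabla f(\tilde x^s)$ exactly; for $t=0,\dots,m-1$, with $k=sm+t$: set $x_{k+1}=\tau_{1,s}z_k+\tau_2\tilde x^s+(1-\tau_{1,s}-\tau_2)y_k$; each worker $i$ draws $B$ indices independently and uniformly from $\{1,\dots,n\}$ (independently across workers and iterations), forming $I^i_{k+1}$, computes $u_{k+1}^i=\frac1B\sum_{a\in I^i_{k+1}}[\nabla f_a(x_{k+1})-\nabla f_a(\tilde x^s)]$ and $\delta_{k+1}^i=\frac{\lambda\|u_{k+1}^i\|_\infty}{2^{b-1}-1}$; set $v_{k+1}=\frac1N\sum_iQ_{(\delta^i_{k+1},b)}(u^i_{k+1})+\nabla f(\tilde x^s)$; draw an additional multiset $J_{k+1}$ of $B$ indices uniformly and independently from $\{1,\dots,n\}$, independent of everything else (the same for all workers), and set $\hat v_{k+1}=\frac1B\sum_{j\in J_{k+1}}[\nabla f_j(x_{k+1})-\nabla f_j(\tilde x^s)]+\nabla f(\tilde x^s)$; then $y_{k+1}=\arg\min_y\{2L\|y-x_{k+1}\|^2+\langle v_{k+1},y\rangle+h(y)\}$ and $z_{k+1}=\arg\min_z\{\frac1{2\alpha_s}\|z-z_k\|^2+\langle\hat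 v_{k+1},z\rangle+h(z)\}$. After the inner loop, $\tilde x^{s+1}=\frac1m\sum_{t=1}^m y_{sm+t}$. Output $\tilde x^S$. *)

theory Defs
  imports "HOL-Probability.Probability"
begin

text \<open>Vectors of R^d are represented as functions nat => real vanishing at coordinates >= d,
  so that the dimension d can be quantified inside the statement (needed because the
  constant C is absolute, i.e. independent of d).\<close>

type_synonym rvec = "nat \<Rightarrow> real"

definition Vd :: "nat \<Rightarrow> rvec set" where
  "Vd d = {x. \<forall>j\<ge>d. x j = 0}"

definition ip :: "nat \<Rightarrow> rvec \<Rightarrow> rvec \<Rightarrow> real" where
  "ip d x y = (\<Sum>j<d. x j * y j)"

definition nrm :: "nat \<Rightarrow> rvec \<Rightarrow> real" where
  "nrm d x = sqrt (ip d x x)"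

definition nrm_inf :: "nat \<Rightarrow> rvec \<Rightarrow> real" where
  "nrm_inf d x = Max ((\<lambda>j. \<bar>x j\<bar>) ` {..<d})"

definition has_grad :: "nat \<Rightarrow> (rvec \<Rightarrow> real) \<Rightarrow> (rvec \<Rightarrow> rvec) \<Rightarrow> bool" where
  "has_grad d f g \<longleftrightarrow> (\<forall>x\<in>Vd d. g x \<in> Vd d \<and>
     (\<forall>e>0. \<exists>r>0. \<forall>k\<in>Vd d. nrm d k < r \<longrightarrow>
        \<bar>f (\<lambda>j. x j + k j) - f x - ip d (g x) k\<bar> \<le> e * nrm d k))"

definition lipschitz_grad :: "nat \<Rightarrow> real \<Rightarrow> (rvec \<Rightarrow> rvec) \<Rightarrow> bool" where
  "lipschitz_grad d L g \<longleftrightarrow> (\<forall>x\<in>Vd d. \<forall>y\<in>Vd d.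
     nrm d (\<lambda>j. g x j - g y j) \<le> L * nrm d (\<lambda>j. x j - y j))"

definition convex_Vd :: "nat \<Rightarrow> (rvec \<Rightarrow> real) \<Rightarrow> bool" where
  "convex_Vd d f \<longleftrightarrow> (\<forall>x\<in>Vd d. \<forall>y\<in>Vd d. \<forall>t. 0 \<le> t \<and> t \<le> 1 \<longrightarrow>
     f (\<lambda>j. (1 - t) * x j + t * y j) \<le> (1 - t) * f x + t * f y)"

definition proper_convex_lsc :: "nat \<Rightarrow> (rvec \<Rightarrow> ereal) \<Rightarrow> bool" where
  "proper_convex_lsc d h \<longleftrightarrow>
     (\<forall>x. h x \<noteq> -\<infinity>) \<and> (\<exists>x\<in>Vd d. h x \<noteq> \<infinity>) \<and>
     (\<forall>x\<in>Vd d. \<forall>y\<in>Vd d. \<forall>t. 0 \<le> t \<and> t \<le> 1 \<longrightarrow>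
        h (\<lambda>j. (1 - t) * x j + t * y j) \<le> ereal (1 - t) * h x + ereal t * h y) \<and>
     (\<forall>x\<in>Vd d. \<forall>c. c < h x \<longrightarrow>
        (\<exists>r>0. \<forall>y\<in>Vd d. nrm d (\<lambda>j. y j - x j) < r \<longrightarrow> c < h y))"

definition fbar :: "nat \<Rightarrow> (nat \<Rightarrow> rvec \<Rightarrow> real) \<Rightarrow> rvec \<Rightarrow> real" where
  "fbar n f x = (1 / real n) * (\<Sum>i=1..n. f i x)"

definition PP :: "nat \<Rightarrow> (nat \<Rightarrow> rvec \<Rightarrow> real) \<Rightarrow> (rvec \<Rightarrow> ereal) \<Rightarrow> rvec \<Rightarrow> ereal" where
  "PP n f h x = ereal (fbar n f x) + h x"

definition is_minimizer :: "nat \<Rightarrow> (rvec \<Rightarrow> ereal) \<Rightarrow> rvec \<Rightarrow> bool" where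
  "is_minimizer d F xs \<longleftrightarrow> xs \<in> Vd d \<and> (\<forall>y\<in>Vd d. F xs \<le> F y)"

definition argminV :: "nat \<Rightarrow> (rvec \<Rightarrow> ereal) \<Rightarrow> rvec" where
  "argminV d F = (SOME y. y \<in> Vd d \<and> (\<forall>w\<in>Vd d. F y \<le> F w))"

definition Qs :: "real \<Rightarrow> nat \<Rightarrow> real \<Rightarrow> real pmf" where
  "Qs \<delta> b y =
    (if \<delta> = 0 then return_pmf 0
     else if y < - ((2::real) ^ (b - 1)) * \<delta> then return_pmf (- ((2::real) ^ (b - 1)) * \<delta>)
     else if y > ((2::real) ^ (b - 1) - 1) * \<delta> then return_pmf (((2::real) ^ (b - 1) - 1) * \<delta>)
     else (let z = \<delta> * of_int \<lfloor>y / \<delta>\<rfloor> in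
           map_pmf (\<lambda>c. if c then z else z + \<delta>) (bernoulli_pmf ((z + \<delta> - y) / \<delta>))))"

fun Qv :: "real \<Rightarrow> nat \<Rightarrow> nat \<Rightarrow> rvec \<Rightarrow> rvec pmf" where
  "Qv \<delta> b 0 u = return_pmf (\<lambda>_. 0)"
| "Qv \<delta> b (Suc j) u =
     bind_pmf (Qv \<delta> b j u) (\<lambda>q. map_pmf (\<lambda>c. q(j := c)) (Qs \<delta> b (u j)))"

fun samples :: "nat \<Rightarrow> nat \<Rightarrow> nat list pmf" where
  "samples n 0 = return_pmf []"
| "samples n (Suc k) =
     bind_pmf (pmf_of_set {1..n}) (\<lambda>a. map_pmf (\<lambda>l. a # l) (samples n k))"

definition delta_q :: "nat \<Rightarrow> real \<Rightarrow> nat \<Rightarrow> rvec \<Rightarrow> real" where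
  "delta_q d lam b u = lam * nrm_inf d u / ((2::real) ^ (b - 1) - 1)"

fun workers :: "nat \<Rightarrow> (nat \<Rightarrow> rvec \<Rightarrow> rvec) \<Rightarrow> nat \<Rightarrow> nat \<Rightarrow> real \<Rightarrow> nat \<Rightarrow>
     rvec \<Rightarrow> rvec \<Rightarrow> nat \<Rightarrow> (rvec \<times> rvec) list pmf" where
  "workers n gr d B lam b x xt 0 = return_pmf []"
| "workers n gr d B lam b x xt (Suc i) =
     bind_pmf (workers n gr d B lam b x xt i) (\<lambda>W.
     bind_pmf (samples n B) (\<lambda>I.
       let u = (\<lambda>j. (1 / real B) * (\<Sum>a\<leftarrow>I. gr a x j - gr a xt j)) in
       map_pmf (\<lambda>q. W @ [(u, q)]) (Qv (delta_q d lam b u) b d u)))"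

text \<open>Inner-loop state: (y_k, z_k, running sum of y's in the epoch, list of all u^i seen).\<close>
type_synonym istate = "rvec \<times> rvec \<times> rvec \<times> rvec list"

definition inner_step :: "nat \<Rightarrow> (nat \<Rightarrow> rvec \<Rightarrow> rvec) \<Rightarrow> (rvec \<Rightarrow> ereal) \<Rightarrow> real \<Rightarrow> nat \<Rightarrow>
     nat \<Rightarrow> nat \<Rightarrow> real \<Rightarrow> nat \<Rightarrow> real \<Rightarrow> nat \<Rightarrow> rvec \<Rightarrow> rvec \<Rightarrow> istate \<Rightarrow> istate pmf" where
  "inner_step n gr h L d N B lam b tau2 s xt mu st =
    (case st of (y, z, ysum, us) \<Rightarrow>
      (let tau1 = 2 / (real s + 4);
           alpha = 1 / (6 * L * tau1);
           x = (\<lambda>j. tau1 * z j + tau2 * xt j + (1 - tau1 - tau2) * y j)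
       in bind_pmf (workers n gr d B lam b x xt N) (\<lambda>W.
          map_pmf (\<lambda>J.
            let v = (\<lambda>j. (1 / real N) * (\<Sum>p\<leftarrow>W. snd p j) + mu j);
                vh = (\<lambda>j. (1 / real B) * (\<Sum>a\<leftarrow>J. gr a x j - gr a xt j) + mu j);
                y' = argminV d (\<lambda>w. ereal (2 * L * (nrm d (\<lambda>j. w j - x j))\<^sup>2 + ip d v w) + h w);
                z' = argminV d (\<lambda>w. ereal (1 / (2 * alpha) * (nrm d (\<lambda>j. w j - z j))\<^sup>2 + ip d vh w) + h w)
            in (y', z', (\<lambda>j. ysum j + y' j), us @ map fst W))
          (samples n B))))"

fun inner_loop :: "nat \<Rightarrow> (nat \<Rightarrow> rvec \<Rightarrow> rvec) \<Rightarrow> (rvec \<Rightarrow> ereal) \<Rightarrow> real \<Rightarrow> nat \<Rightarrow>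
     nat \<Rightarrow> nat \<Rightarrow> real \<Rightarrow> nat \<Rightarrow> real \<Rightarrow> nat \<Rightarrow> rvec \<Rightarrow> rvec \<Rightarrow> nat \<Rightarrow> istate \<Rightarrow> istate pmf" where
  "inner_loop n gr h L d N B lam b tau2 s xt mu 0 st = return_pmf st"
| "inner_loop n gr h L d N B lam b tau2 s xt mu (Suc t) st =
     bind_pmf (inner_loop n gr h L d N B lam b tau2 s xt mu t st)
              (inner_step n gr h L d N B lam b tau2 s xt mu)"

text \<open>Outer state: (x~^s, y_{sm}, z_{sm}, list of all u^i seen).\<close>
type_synonym ostate = "rvec \<times> rvec \<times> rvec \<times> rvec list"

definition epoch :: "nat \<Rightarrow> (nat \<Rightarrow> rvec \<Rightarrow> rvec) \<Rightarrow> (rvec \<Rightarrow> ereal) \<Rightarrow> real \<Rightarrow> nat \<Rightarrow>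
     nat \<Rightarrow> nat \<Rightarrow> nat \<Rightarrow> real \<Rightarrow> nat \<Rightarrow> real \<Rightarrow> nat \<Rightarrow> ostate \<Rightarrow> ostate pmf" where
  "epoch n gr h L d N m B lam b tau2 s ost =
    (case ost of (xt, y, z, us) \<Rightarrow>
      (let mu = (\<lambda>j. (1 / real n) * (\<Sum>i=1..n. gr i xt j)) in
       map_pmf (\<lambda>(y', z', ysum, us'). ((\<lambda>j. ysum j / real m), y', z', us'))
         (inner_loop n gr h L d N B lam b tau2 s xt mu m (y, z, (\<lambda>_. 0), us))))"

fun alpc_run :: "nat \<Rightarrow> (nat \<Rightarrow> rvec \<Rightarrow> rvec) \<Rightarrow> (rvec \<Rightarrow> ereal) \<Rightarrow> real \<Rightarrow> nat \<Rightarrow>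
     nat \<Rightarrow> nat \<Rightarrow> nat \<Rightarrow> real \<Rightarrow> nat \<Rightarrow> real \<Rightarrow> rvec \<Rightarrow> nat \<Rightarrow> ostate pmf" where
  "alpc_run n gr h L d N m B lam b tau2 x0 0 = return_pmf (x0, x0, x0, [])"
| "alpc_run n gr h L d N m B lam b tau2 x0 (Suc s) =
     bind_pmf (alpc_run n gr h L d N m B lam b tau2 x0 s) (epoch n gr h L d N m B lam b tau2 s)"

definition outside_count :: "nat \<Rightarrow> real \<Rightarrow> nat \<Rightarrow> rvec \<Rightarrow> nat" where
  "outside_count d lam b u =
     card {j. j < d \<and> (u j < - ((2::real) ^ (b - 1)) * delta_q d lam b u
                     \<or> u j > ((2::real) ^ (b - 1) - 1) * delta_q d lam b u)}"

end

theory Submission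
  imports Defs
begin

text \<open>
  Let \<open>p\<^sub>k\<close> be the expected objective gap of \<open>y\<^sub>k\<close>, \<open>\<tau>\<close> the current \<open>\<tau>\<^sub>1\<close> and \<open>M p\<close> the average of the gaps over the
  previous epoch, which by convexity dominates the gap of the snapshot. One iteration satisfies, for every comparison
  point \<open>u\<close> that depends only on the past,
    \<open>E P(y') + (7/5) L E |y' - yb|\<^sup>2 + 3 L \<tau>\<^sup>2 E |u - z'|\<^sup>2 \<le> (1-\<tau>-\<tau>\<^sub>2) P(y) + \<tau> P(u) + \<tau>\<^sub>2 P(xt) + 3 L \<tau>\<^sup>2 |u - z|\<^sup>2\<close>,
  where \<open>yb = \<tau> z' + \<tau>\<^sub>2 xt + (1-\<tau>-\<tau>\<^sub>2) y\<close>: compare the two proximal steps with \<open>yb\<close> and \<open>u\<close>, and absorb the variances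
  of \<open>v\<close> and of the second estimator in \<open>\<tau>\<^sub>2\<close> times the Bregman distance of the snapshot.

  With \<open>u = x*\<close> the inequalities telescope after division by \<open>\<tau>\<^sup>2\<close>. This gives the rate for the last epoch only if
  \<open>\<tau>\<^sub>2\<close> is bounded below; for small \<open>\<tau>\<^sub>2\<close> it bounds merely a weighted average of the gaps over all epochs. To reach the last
  epoch one takes \<open>u = y\<^sub>j\<close> for earlier iterates, as in last-iterate proofs for subgradient methods. The price is the kinetic
  term \<open>3 L \<tau>\<^sup>2 E |y\<^sub>j - z\<^sub>j|\<^sup>2\<close>. It is dissipated: since \<open>y'\<close> is close to \<open>yb\<close>, mixing the comparison points \<open>y\<^sub>k\<close> and the
  snapshot yields an energy inequality whose contributions from the snapshot telescope across epochs.
\<close>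

section \<open>Real sequences\<close>

text \<open>The obstacle is a circle: the last-iterate argument bounds gaps by kinetic terms, while
  the energy inequality bounds kinetic terms by gaps, enlarged by the factor \<open>Gam\<close>,
  which is one plus the mass \<open>m * (t + t2)\<close> of an epoch. The circle is broken by the
  weights \<open>w k = 1 / (That k)\<^sup>2\<close>, where \<open>That k\<close> is the step mass
  left after \<open>k\<close> plus an offset \<open>c0 * Gam\<close>. The offset makes the weights
  nearly constant on an epoch, so that moving them past a telescoping sum costs a relative error of
  order \<open>1 / c0\<close>. It also makes the weighted sum of the gaps at most
  \<open>2 / (c0 * Gam)\<close> times the largest suffix average. With \<open>c0 = 100000\<close>
  the feedback factor is about 1/4 and can be absorbed. The factor \<open>Gam\<close> that is left
  in the bound for the last epoch cancels, because that bound holds both for every single gap and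
  for \<open>(t + t2)\<close> times their sum.\<close>

definition prv :: "nat \<Rightarrow> nat \<Rightarrow> (nat \<Rightarrow> real) \<Rightarrow> real" where
  "prv m s f = (if s = 0 then f 0 else (\<Sum>i<m. f ((s - 1) * m + i + 1)) / real m)"

definition step_tau :: "nat \<Rightarrow> real" where
  "step_tau s = 2 / (real s + 4)"

lemma step_tau_pos: "step_tau s > 0"
  by (simp add: step_tau_def)

lemma step_tau_le_half: "step_tau s \<le> 1 / 2"
  by (simp add: step_tau_def divide_simps)

lemma step_tau_antimono: "s \<le> s' \<Longrightarrow> step_tau s' \<le> step_tau s"
  by (simp add: step_tau_def frac_le)

lemma prv_Suc: "prv m (Suc s) f = (\<Sum>i<m. f (s * m + i + 1)) / real m"
  by (simp add: prv_def)

lemma prv_mono: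
  assumes "\<And>j. j \<le> s * m \<Longrightarrow> f j \<le> g j"
  shows "prv m s f \<le> prv m s g"
proof (cases s)
  case 0
  then show ?thesis using assms[of 0] by (simp add: prv_def)
next
  case (Suc r)
  have "f (r * m + i + 1) \<le> g (r * m + i + 1)" if "i < m" for i
    using that Suc by (intro assms) auto
  then show ?thesis
    unfolding Suc prv_Suc by (intro divide_right_mono sum_mono) auto
qed

lemma prv_const: "m \<ge> 1 \<Longrightarrow> prv m s (\<lambda>_. c) = c"
  by (simp add: prv_def)

lemma prv_nonneg: "(\<And>j. f j \<ge> 0) \<Longrightarrow> prv m s f \<ge> 0"
  by (auto simp: prv_def intro!: divide_nonneg_nonneg sum_nonneg)

lemma prv_cmult: "prv m s (\<lambda>j. c * f j) = c * prv m s f"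
  by (simp add: prv_def sum_distrib_left)

lemma prv_add: "prv m s (\<lambda>j. f j + g j) = prv m s f + prv m s g"
  by (simp add: prv_def sum.distrib add_divide_distrib)

text \<open>In the application \<open>p k\<close> is the expected gap of y_k; \<open>R k\<close>,
  \<open>Y k\<close> and \<open>G j k\<close> are 3L times the expected squared distances of z_k to
  x*, of y_k to x* and of y_j to z_k; \<open>e k\<close> is L times that of y_k to the point yb of
  the step producing it. Hence the 3 in \<open>3 * e\<close>. \<open>prv m s\<close> averages over
  the iterates that form the snapshot of epoch \<open>s\<close>; for \<open>s = 0\<close> the
  snapshot is the initial point. The parameter \<open>\<beta>\<close> is that of Young's inequality
  for y' = yb + (y' - yb). In \<open>G_birth\<close> the z'-part of yb has distance 0 to z' and
  leaves no term.\<close>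

locale rate_sequences =
  fixes m S :: nat and t2 :: real and p R Y e :: "nat \<Rightarrow> real" and G :: "nat \<Rightarrow> nat \<Rightarrow> real"
  assumes m: "m \<ge> 1" and S: "S \<ge> 1" and t2_nonneg: "0 \<le> t2" and t2_le: "t2 \<le> 1 / 2"
    and p_nonneg: "p k \<ge> 0" and R_nonneg: "R k \<ge> 0" and Y_nonneg: "Y k \<ge> 0"
    and e_nonneg: "e k \<ge> 0" and G_nonneg: "G j k \<ge> 0"
    and opt_step: "k < m * S \<Longrightarrow> p (Suc k) + 7 / 5 * e (Suc k) + (step_tau (k div m))\<^sup>2 * R (Suc k)
        \<le> (1 - step_tau (k div m) - t2) * p k + t2 * prv m (k div m) p + (step_tau (k div m))\<^sup>2 * R k"
    and past_step: "k < m * S \<Longrightarrow> j \<le> k \<Longrightarrow>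
        p (Suc k) + 7 / 5 * e (Suc k) + (step_tau (k div m))\<^sup>2 * G j (Suc k)
        \<le> (1 - step_tau (k div m) - t2) * p k + step_tau (k div m) * p j
          + t2 * prv m (k div m) p + (step_tau (k div m))\<^sup>2 * G j k"
    and G_birth: "k < m * S \<Longrightarrow> \<beta> > 0 \<Longrightarrow> G (Suc k) (Suc k)
        \<le> (1 + \<beta>) * ((1 - step_tau (k div m) - t2) * G k (Suc k) + t2 * prv m (k div m) (\<lambda>j. G j (Suc k)))
          + (1 + 1 / \<beta>) * (3 * e (Suc k))"
    and Y_step: "k < m * S \<Longrightarrow> \<beta> > 0 \<Longrightarrow> Y (Suc k)
        \<le> (1 + \<beta>) * (step_tau (k div m) * R (Suc k) + t2 * prv m (k div m) Y
                        + (1 - step_tau (k div m) - t2) * Y k)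
          + (1 + 1 / \<beta>) * (3 * e (Suc k))"
    and G_diag: "G k k \<le> 2 * Y k + 2 * R k"
    and Y_init: "Y 0 = R 0"
begin

section \<open>Comparison with the minimizer: a potential for each epoch\<close>

definition bp :: "nat \<Rightarrow> real" where "bp s = real m * prv m s p"

definition scl :: real where "scl = real m * p 0 + R 0"

lemma m_pos: "real m > 0" using m by simp

lemma scl_nonneg: "scl \<ge> 0"
  unfolding scl_def using p_nonneg[of 0] R_nonneg[of 0] by simp

lemma bp_0: "bp 0 = real m * p 0"
  by (simp add: bp_def prv_def)

lemma bp_Suc: "bp (Suc s) = (\<Sum>i<m. p (s * m + i + 1))"
  using m_pos by (simp add: bp_def prv_Suc)

lemma bp_nonneg: "bp s \<ge> 0"
  unfolding bp_def by (intro mult_nonneg_nonneg prv_nonneg p_nonneg) simp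

lemma prv_p: "prv m s p = bp s / real m"
  using m_pos by (simp add: bp_def)

text \<open>The snapshot averages over the indices 1 to \<open>m\<close> of an epoch, whereas the
  step inequalities start from the indices 0 to \<open>m - 1\<close>.\<close>

lemma sum_shift: "(\<Sum>i<m. f (s * m + i + 1)) = (\<Sum>i<m. f (s * m + i)) - f (s * m) + (f (Suc s * m) :: real)"
proof -
  have "(\<Sum>i<m. f (s * m + i + 1)) + f (s * m) = (\<Sum>i<Suc m. f (s * m + i))"
    by (subst sum.lessThan_Suc_shift) simp
  also have "\<dots> = (\<Sum>i<m. f (s * m + i)) + f (Suc s * m)"
    by (simp add: algebra_simps)
  finally show ?thesis by simp
qed

lemma p_last_le_bp: "p (Suc s * m) \<le> bp (Suc s)"
proof -
  have "p (s * m + (m - 1) + 1) \<le> bp (Suc s)"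
    unfolding bp_Suc by (rule member_le_sum[where f = "\<lambda>i. p (s * m + i + 1)"]) (use m p_nonneg in auto)
  moreover have "s * m + (m - 1) + 1 = Suc s * m" using m by simp
  ultimately show ?thesis by metis
qed

abbreviation t :: "nat \<Rightarrow> real" where "t \<equiv> step_tau"

lemma idx_less: "s < S \<Longrightarrow> i < m \<Longrightarrow> s * m + i < m * S"
proof -
  assume "s < S" "i < m"
  then have "s * m + i < Suc s * m" by simp
  also have "\<dots> \<le> S * m" using \<open>s < S\<close> by (intro mult_right_mono) auto
  finally show ?thesis by (simp add: mult.commute)
qed

lemma partial_epoch:
  assumes "s < S" "n \<le> m"
  shows "p (s * m + n) + (t s)\<^sup>2 * R (s * m + n) + (t s + t2) * (\<Sum>i<n. p (s * m + i))
    \<le> p (s * m) + t2 * (real n / real m) * bp s + (t s)\<^sup>2 * R (s * m)"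
  using assms(2)
proof (induction n)
  case 0
  then show ?case by simp
next
  case (Suc n)
  have k: "s * m + n < m * S" "(s * m + n) div m = s"
    using idx_less[OF assms(1), of n] Suc.prems by auto
  have "p (s * m + Suc n) + (t s)\<^sup>2 * R (s * m + Suc n)
      \<le> (1 - t s - t2) * p (s * m + n) + t2 * (bp s / real m) + (t s)\<^sup>2 * R (s * m + n)"
    using opt_step[OF k(1)] e_nonneg[of "Suc (s * m + n)"] unfolding k(2) prv_p by simp
  moreover have "t2 * (real (Suc n) / real m) * bp s = t2 * (real n / real m) * bp s + t2 * (bp s / real m)"
    by (simp add: add_divide_distrib algebra_simps)
  ultimately show ?case using Suc by (simp add: algebra_simps)
qed

text \<open>What is still to be paid at the start of epoch \<open>s\<close>: the first step sees
  \<open>(1 - t s - t2) * p (s * m)\<close>, and the whole epoch spends \<open>t2 * bp s\<close> on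
  its snapshot. Dividing by the squared step gives \<open>R\<close> the coefficient 1 in every
  epoch, so potentials of successive epochs are comparable.\<close>

definition Phi :: "nat \<Rightarrow> real" where
  "Phi s = ((1 - t s - t2) * p (s * m) + t2 * bp s) / (t s)\<^sup>2 + R (s * m)"

lemma gam_le_1: "t s + t2 \<le> 1"
  using step_tau_le_half[of s] t2_le by simp

lemma tau_sq_Phi: "(t s)\<^sup>2 * Phi s = (1 - t s - t2) * p (s * m) + t2 * bp s + (t s)\<^sup>2 * R (s * m)"
  using step_tau_pos[of s] by (simp add: Phi_def field_simps)

text \<open>For \<open>n \<ge> 1\<close> the telescoped sum of \<open>partial_epoch\<close> contains
  \<open>p (s * m)\<close>, which lowers the coefficient of this gap to the one in
  \<open>Phi\<close>.\<close>

lemma epoch_pointwise: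
  assumes "s < S" "n \<le> m" "n \<ge> 1"
  shows "p (s * m + n) + (t s)\<^sup>2 * R (s * m + n) \<le> (t s)\<^sup>2 * Phi s"
proof -
  have "p (s * m + 0) \<le> (\<Sum>i<n. p (s * m + i))"
    by (rule member_le_sum[where f = "\<lambda>i. p (s * m + i)"]) (use assms p_nonneg in auto)
  then have "(t s + t2) * p (s * m) \<le> (t s + t2) * (\<Sum>i<n. p (s * m + i))"
    using step_tau_pos[of s] t2_nonneg by (intro mult_left_mono) auto
  moreover have "t2 * (real n / real m) * bp s \<le> t2 * 1 * bp s"
    using assms m t2_nonneg bp_nonneg by (intro mult_right_mono mult_left_mono) auto
  ultimately show ?thesis
    using partial_epoch[OF assms(1,2)] unfolding tau_sq_Phi by (simp add: algebra_simps)
qed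

lemma epoch_whole:
  assumes "s < S"
  shows "(1 - t s - t2) * p (Suc s * m) + (t s + t2) * bp (Suc s) + (t s)\<^sup>2 * R (Suc s * m) \<le> (t s)\<^sup>2 * Phi s"
proof -
  have "(\<Sum>i<m. p (s * m + i)) = bp (Suc s) + p (s * m) - p (Suc s * m)"
    unfolding bp_Suc sum_shift by simp
  moreover have "s * m + m = Suc s * m" by simp
  ultimately have *: "p (Suc s * m) + (t s)\<^sup>2 * R (Suc s * m) + (t s + t2) * (bp (Suc s) + p (s * m) - p (Suc s * m))
      \<le> p (s * m) + t2 * (real m / real m) * bp s + (t s)\<^sup>2 * R (s * m)"
    using partial_epoch[OF assms, of m] by (simp only: order_refl)
  have "real m / real m = 1" using m_pos by simp
  with * show ?thesis unfolding tau_sq_Phi by (simp add: algebra_simps)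
qed

text \<open>With \<open>t s = 2 / q\<close>, the coefficients of \<open>u = p (Suc s * m)\<close>
  and \<open>b = bp (Suc s)\<close> change by amounts that add up to 1/4, so the surplus is a
  multiple of \<open>b - u\<close> plus \<open>b / 4\<close>. A sum dominates its last entry, so
  \<open>b - u \<ge> 0\<close>, and \<open>t2 \<le> 1 / 2\<close> keeps the multiple above
  \<open>q / 8\<close>. The surplus is kept because it controls the gaps inside all epochs, see
  \<open>epoch_sum_bound\<close>.\<close>

lemma Phi_decrease:
  assumes "s < S"
  shows "Phi (Suc s) + (real s + 4) / 8 * (bp (Suc s) - p (Suc s * m)) \<le> Phi s"
proof -
  define q where "q = real s + 4"
  have q: "q \<ge> 4" by (simp add: q_def)
  have ts: "t s = 2 / q" and ts1: "t (Suc s) = 2 / (q + 1)"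
    by (simp_all add: q_def step_tau_def add_ac)
  define b where "b = bp (Suc s)"
  define u where "u = p (Suc s * m)"
  have bu: "b \<ge> u" "u \<ge> 0" "b \<ge> 0"
    using p_last_le_bp p_nonneg bp_nonneg by (auto simp: b_def u_def)
  have "(1 - t s - t2) * u + (t s + t2) * b + (t s)\<^sup>2 * R (Suc s * m) \<le> (t s)\<^sup>2 * Phi s"
    using epoch_whole[OF assms] by (simp add: b_def u_def)
  then have "((1 - t s - t2) * u + (t s + t2) * b) / (t s)\<^sup>2 + R (Suc s * m) \<le> Phi s"
    using step_tau_pos[of s] by (simp add: field_simps)
  moreover have "((1 - t s - t2) * u + (t s + t2) * b) / (t s)\<^sup>2
      = (q\<^sup>2 / 4 * (1 - t2) - q / 2) * u + (q / 2 + t2 * q\<^sup>2 / 4) * b"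
    using q unfolding ts by (simp add: field_simps power2_eq_square)
  moreover have "Phi (Suc s) = ((q + 1)\<^sup>2 / 4 * (1 - t2) - (q + 1) / 2) * u + (t2 * (q + 1)\<^sup>2 / 4) * b + R (Suc s * m)"
    using q unfolding Phi_def ts1 b_def[symmetric] u_def[symmetric] by (simp add: field_simps power2_eq_square)
  moreover have "(q\<^sup>2 / 4 * (1 - t2) - q / 2) * u + (q / 2 + t2 * q\<^sup>2 / 4) * b
      - ((q + 1)\<^sup>2 / 4 * (1 - t2) - (q + 1) / 2) * u - (t2 * (q + 1)\<^sup>2 / 4) * b
      = (((1 - t2) * (2 * q + 1) - 2) / 4) * (b - u) + b / 4"
    by (simp add: field_simps power2_eq_square)
  moreover have "q / 8 * (b - u) \<le> (((1 - t2) * (2 * q + 1) - 2) / 4) * (b - u)"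
  proof (rule mult_right_mono)
    have "(1 / 2) * (2 * q + 1) \<le> (1 - t2) * (2 * q + 1)"
      using t2_le q by (intro mult_right_mono) auto
    then have "q + 1 / 2 \<le> (1 - t2) * (2 * q + 1)" by simp
    then show "q / 8 \<le> ((1 - t2) * (2 * q + 1) - 2) / 4" using q by (simp only: le_divide_eq_numeral1 divide_le_eq_numeral1)
  qed (use bu in simp)
  ultimately show ?thesis
    using bu unfolding q_def[symmetric] b_def[symmetric] u_def[symmetric] by linarith
qed

lemma Phi_sum:
  assumes "s \<le> S"
  shows "Phi s + (\<Sum>r<s. (real r + 4) / 8 * (bp (Suc r) - p (Suc r * m))) \<le> Phi 0"
  using assms
proof (induction s)
  case (Suc s)
  then show ?case using Phi_decrease[of s] by simp
qed simp

lemma Phi_0: "Phi 0 \<le> 4 * scl"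
proof -
  have "Phi 0 = (2 - 4 * t2) * p 0 + 4 * t2 * (real m * p 0) + R 0"
    by (simp add: Phi_def bp_0 step_tau_def field_simps power2_eq_square)
  moreover have "(2 - 4 * t2) * p 0 \<le> 2 * (real m * p 0)"
  proof -
    have "(2 - 4 * t2) * p 0 \<le> 2 * p 0"
      using t2_nonneg p_nonneg by (intro mult_right_mono) auto
    also have "\<dots> \<le> 2 * (real m * p 0)"
      using m p_nonneg[of 0] mult_right_mono[of 1 "real m" "p 0"] by simp
    finally show ?thesis .
  qed
  moreover have "4 * t2 * (real m * p 0) \<le> 2 * (real m * p 0)"
    using t2_le p_nonneg by (intro mult_right_mono) auto
  ultimately show ?thesis
    using R_nonneg[of 0] unfolding scl_def by simp
qed

lemma Phi_le: "s \<le> S \<Longrightarrow> Phi s \<le> 4 * scl"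
proof -
  assume "s \<le> S"
  have "0 \<le> (\<Sum>r<s. (real r + 4) / 8 * (bp (Suc r) - p (Suc r * m)))"
    by (intro sum_nonneg mult_nonneg_nonneg) (use p_last_le_bp in \<open>auto simp: algebra_simps\<close>)
  then show ?thesis using Phi_sum[OF \<open>s \<le> S\<close>] Phi_0 by linarith
qed

lemma tau_sq_Phi_le: "s < S \<Longrightarrow> (t s)\<^sup>2 * Phi s \<le> 4 * (t s)\<^sup>2 * scl"
  using Phi_le[of s] mult_left_mono[of "Phi s" "4 * scl" "(t s)\<^sup>2"] by simp

lemma p_le: "s < S \<Longrightarrow> n \<le> m \<Longrightarrow> n \<ge> 1 \<Longrightarrow> p (s * m + n) \<le> 4 * (t s)\<^sup>2 * scl"
  using epoch_pointwise[of s n] tau_sq_Phi_le[of s] mult_nonneg_nonneg[OF zero_le_power2 R_nonneg, of "t s" "s * m + n"] by linarith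

lemma R_le: "s < S \<Longrightarrow> n \<le> m \<Longrightarrow> n \<ge> 1 \<Longrightarrow> R (s * m + n) \<le> 4 * scl"
proof -
  assume *: "s < S" "n \<le> m" "n \<ge> 1"
  have "(t s)\<^sup>2 * R (s * m + n) \<le> (t s)\<^sup>2 * (4 * scl)"
    using epoch_pointwise[OF *] tau_sq_Phi_le[OF *(1)] p_nonneg[of "s * m + n"] by simp
  then show ?thesis using step_tau_pos[of s] by simp
qed

lemma gam_bp_le: "s < S \<Longrightarrow> (t s + t2) * bp (Suc s) \<le> 4 * (t s)\<^sup>2 * scl"
proof -
  assume s: "s < S"
  have "(1 - t s - t2) * p (Suc s * m) \<ge> 0" "(t s)\<^sup>2 * R (Suc s * m) \<ge> 0"
    using gam_le_1[of s] p_nonneg R_nonneg by auto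
  then show ?thesis using epoch_whole[OF s] tau_sq_Phi_le[OF s] by linarith
qed

text \<open>The error of a step is at most the right side of its own inequality, which is bounded by
  \<open>4 * (t s)\<^sup>2 * scl\<close>. The first step of an epoch has no earlier sum to draw on,
  but there the right side is directly comparable with \<open>Phi\<close>.\<close>

lemma e_le: "s < S \<Longrightarrow> i < m \<Longrightarrow> e (s * m + i + 1) \<le> 3 * (t s)\<^sup>2 * scl"
proof -
  assume *: "s < S" "i < m"
  have k: "s * m + i < m * S" "(s * m + i) div m = s"
    using idx_less[OF *] *(2) by auto
  have "7 / 5 * e (s * m + i + 1) \<le> (1 - t s - t2) * p (s * m + i) + t2 * (bp s / real m) + (t s)\<^sup>2 * R (s * m + i)"
    using opt_step[OF k(1)] p_nonneg[of "Suc (s * m + i)"]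
      mult_nonneg_nonneg[OF zero_le_power2 R_nonneg, of "t s" "Suc (s * m + i)"]
    unfolding k(2) prv_p Suc_eq_plus1 by linarith
  also have "\<dots> \<le> 4 * (t s)\<^sup>2 * scl"
  proof (cases "i = 0")
    case True
    have "t2 * (bp s / real m) \<le> t2 * bp s"
      using t2_nonneg bp_nonneg[of s] m by (intro mult_left_mono) (auto simp: divide_simps mult_le_cancel_left1)
    then show ?thesis
      using tau_sq_Phi[of s] tau_sq_Phi_le[OF *(1)] True by simp
  next
    case False
    have "(\<Sum>j<1. p (s * m + j)) \<le> (\<Sum>j<i. p (s * m + j))"
      by (rule sum_mono2) (use False p_nonneg in auto)
    then have "(t s + t2) * p (s * m) \<le> (t s + t2) * (\<Sum>j<i. p (s * m + j))"
      using step_tau_pos[of s] t2_nonneg by (intro mult_left_mono) auto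
    moreover have "t2 * (real (Suc i) / real m) * bp s \<le> t2 * 1 * bp s"
      using * m t2_nonneg bp_nonneg by (intro mult_right_mono mult_left_mono) auto
    moreover have "t2 * (real (Suc i) / real m) * bp s = t2 * (real i / real m) * bp s + t2 * (bp s / real m)"
      by (simp add: add_divide_distrib algebra_simps)
    moreover have "(1 - t s - t2) * p (s * m + i) \<le> p (s * m + i)"
      using step_tau_pos[of s] t2_nonneg p_nonneg[of "s * m + i"] by (intro mult_left_le_one_le) (use gam_le_1[of s] in auto)
    ultimately show ?thesis
      using partial_epoch[OF *(1), of i] *(2) tau_sq_Phi[of s] tau_sq_Phi_le[OF *(1)] by (simp add: algebra_simps)
  qed
  finally have "7 / 5 * e (s * m + i + 1) \<le> 4 * (t s)\<^sup>2 * scl" .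
  moreover have "0 \<le> (t s)\<^sup>2 * scl" using scl_nonneg by simp
  ultimately show ?thesis by linarith
qed

lemma idx_cases: "k \<ge> 1 \<Longrightarrow> k \<le> m * S \<Longrightarrow> \<exists>s i. s < S \<and> i < m \<and> k = s * m + i + 1"
proof -
  assume k: "k \<ge> 1" "k \<le> m * S"
  have "k - 1 < S * m" using k by (simp add: mult.commute)
  then have "(k - 1) div m < S" using m by (simp add: less_mult_imp_div_less)
  moreover have "(k - 1) mod m < m" using m by simp
  moreover have "k = (k - 1) div m * m + (k - 1) mod m + 1" using k by simp
  ultimately show ?thesis by blast
qed

lemma R_le': "k \<le> m * S \<Longrightarrow> R k \<le> 4 * scl"
proof (cases "k = 0")
  case True
  then show ?thesis using p_nonneg[of 0] R_nonneg[of 0] by (simp add: scl_def)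
next
  case False
  assume "k \<le> m * S"
  with False obtain s i where "s < S" "i < m" "k = s * m + (i + 1)"
    using idx_cases[of k] by auto
  then show ?thesis using R_le[of s "i + 1"] by simp
qed

text \<open>The choice \<beta> = t/2 makes the bound reproduce itself. To first order in t, the pull
  towards \<open>R \<le> 4 * scl\<close> lowers 60 by 56 t, Young's factor returns 30 t and the
  error adds 18 t; the terms in t^2 are negative in total.\<close>

lemma Y_le: "k \<le> m * S \<Longrightarrow> Y k \<le> 60 * scl"
proof (induction k rule: less_induct)
  case (less k)
  show ?case
  proof (cases "k = 0")
    case True
    then show ?thesis using p_nonneg[of 0] R_nonneg[of 0] by (simp add: Y_init scl_def add_increasing)
  next
    case False
    with less.prems obtain s i where si: "s < S" "i < m" "k = s * m + i + 1"
      using idx_cases[of k] by auto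
    have k: "s * m + i < m * S" "(s * m + i) div m = s"
      using idx_less[OF si(1,2)] si(2) by auto
    have prv: "prv m s Y \<le> 60 * scl"
    proof -
      have "prv m s Y \<le> prv m s (\<lambda>_. 60 * scl)"
        by (rule prv_mono, rule less.IH) (use si less.prems in auto)
      then show ?thesis using m by (simp add: prv_const)
    qed
    have Yk: "Y (s * m + i) \<le> 60 * scl" using less si by simp
    have tp: "t s > 0" "t s \<le> 1 / 2" by (rule step_tau_pos step_tau_le_half)+
    have "Y k \<le> (1 + t s / 2) * (t s * R k + t2 * prv m s Y + (1 - t s - t2) * Y (s * m + i))
        + (1 + 1 / (t s / 2)) * (3 * e k)"
      using Y_step[OF k(1), of "t s / 2"] tp unfolding k(2) si(3) by simp
    also have "\<dots> \<le> (1 + t s / 2) * (t s * (4 * scl) + t2 * (60 * scl) + (1 - t s - t2) * (60 * scl))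
        + (1 + 1 / (t s / 2)) * (3 * (3 * (t s)\<^sup>2 * scl))"
      using R_le'[OF less.prems] prv Yk e_le[OF si(1,2)] tp t2_nonneg gam_le_1[of s] unfolding si(3)
      by (intro add_mono mult_left_mono) auto
    also have "\<dots> = scl * (60 - (8 * t s + 19 * (t s)\<^sup>2))"
      using tp by (simp add: field_simps power2_eq_square)
    also have "\<dots> \<le> scl * 60"
    proof (rule mult_left_mono)
      have "0 \<le> 8 * t s + 19 * (t s)\<^sup>2" using tp by (intro add_nonneg_nonneg) auto
      then show "60 - (8 * t s + 19 * (t s)\<^sup>2) \<le> 60" by linarith
    qed (rule scl_nonneg)
    finally show ?thesis by simp
  qed
qed

lemma G_diag_le: "k \<le> m * S \<Longrightarrow> G k k \<le> 128 * scl"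
  using G_diag[of k] Y_le[of k] R_le'[of k] by simp

text \<open>The bound on \<open>(t + t2) * bp S\<close> suffices here: either \<open>t2\<close> is
  bounded below, or \<open>S\<close> is bounded and the lost factor \<open>1 / S\<close> is a
  constant. The remaining range is the one in which \<open>energy_step\<close> works.\<close>

lemma standard_rate:
  assumes "t2 \<ge> 19 / 100 \<or> S < 40"
  shows "bp S \<le> 400 * scl / (real S)\<^sup>2"
proof -
  obtain s where s: "S = Suc s" using S by (cases S) auto
  have tS: "t s = 2 / (real S + 3)" by (simp add: step_tau_def s)
  have S1: "real S \<ge> 1" using S by simp
  have main: "(t s + t2) * bp S \<le> 4 * (t s)\<^sup>2 * scl"
    using gam_bp_le[of s] s by simp
  from assms show ?thesis
  proof
    assume a: "t2 \<ge> 19 / 100"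
    have "19 / 100 * bp S \<le> (t s + t2) * bp S"
      using a step_tau_pos[of s] bp_nonneg by (intro mult_right_mono) auto
    also note main
    also have "4 * (t s)\<^sup>2 * scl \<le> 4 * (4 / (real S)\<^sup>2) * scl"
    proof (intro mult_right_mono mult_left_mono scl_nonneg)
      have "t s \<le> 2 / real S" unfolding tS using S1 by (simp add: frac_le)
      then have "(t s)\<^sup>2 \<le> (2 / real S)\<^sup>2" using step_tau_pos[of s] by (intro power_mono) auto
      then show "(t s)\<^sup>2 \<le> 4 / (real S)\<^sup>2" by (simp add: power_divide)
    qed simp
    finally have "bp S \<le> 100 / 19 * (16 * scl / (real S)\<^sup>2)" by simp
    also have "\<dots> \<le> 400 * scl / (real S)\<^sup>2"
      using scl_nonneg S1 by (simp add: divide_simps)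
    finally show ?thesis .
  next
    assume a: "S < 40"
    have "t s * bp S \<le> (t s + t2) * bp S"
      using t2_nonneg bp_nonneg by (intro mult_right_mono) auto
    with main have "t s * bp S \<le> t s * (4 * t s * scl)" by (simp add: power2_eq_square)
    then have "bp S \<le> 4 * t s * scl" using step_tau_pos[of s] by simp
    also have "\<dots> \<le> 400 / (real S)\<^sup>2 * scl"
    proof (rule mult_right_mono[OF _ scl_nonneg])
      have "8 * real S * real S \<le> 8 * 40 * real S"
        using a by (intro mult_right_mono) auto
      also have "\<dots> \<le> 400 * (real S + 3)" by simp
      finally show "4 * t s \<le> 400 / (real S)\<^sup>2"
        unfolding tS using S1 by (simp add: field_simps power2_eq_square)
    qed
    finally show ?thesis by simp
  qed
qed

section \<open>Comparison with earlier iterates: kinetic terms and snapshot potential\<close>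

definition tk :: "nat \<Rightarrow> real" where "tk k = t (k div m)"

definition kk :: "nat \<Rightarrow> real" where "kk k = (tk k)\<^sup>2 * G k k"

text \<open>A discrete antiderivative along epoch \<open>s\<close>: each step removes the snapshot
  average \<open>bp s / m\<close> and adds the current gap. The constant \<open>- p (s * m)\<close>
  compensates the index shift between snapshot and step starts, so that the end of an epoch agrees
  with the start of the next one (\<open>pt_full\<close>).\<close>

definition pt :: "nat \<Rightarrow> nat \<Rightarrow> real" where
  "pt s l = (1 - real l / real m) * bp s + (\<Sum>i<l. p (s * m + i)) - p (s * m)"

definition pot :: "nat \<Rightarrow> real" where "pot k = pt (k div m) (k mod m)"

definition fs :: "(nat \<Rightarrow> real) \<Rightarrow> nat \<Rightarrow> real" where "fs f s = (\<Sum>i<m. f (s * m + i))"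

text \<open>Sum over the interior of an epoch. The shifted and the unshifted epoch sums are both
  \<open>fz\<close> plus one end point, so end points shared by neighbouring epochs can
  cancel.\<close>

definition fz :: "(nat \<Rightarrow> real) \<Rightarrow> nat \<Rightarrow> real" where "fz f s = fs f s - f (s * m)"

lemma tk_pos: "tk k > 0" by (simp add: tk_def step_tau_pos)

lemma tk_antimono: "k \<le> k' \<Longrightarrow> tk k' \<le> tk k"
  unfolding tk_def by (intro step_tau_antimono div_le_mono)

lemma tk_epoch: "i < m \<Longrightarrow> tk (s * m + i) = t s"
  by (simp add: tk_def)

lemma tk_epoch0: "tk (s * m) = t s"
  using tk_epoch[of 0 s] m by simp

lemma kk_nonneg: "kk k \<ge> 0"
  by (simp add: kk_def G_nonneg)

lemma sum_shift_fz: "(\<Sum>i<m. f (s * m + i + 1)) = fz f s + f (Suc s * m)"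
  using sum_shift[of f s] unfolding fz_def fs_def by linarith

lemma fz_nonneg: "(\<And>k. f k \<ge> 0) \<Longrightarrow> fz f s \<ge> 0"
proof -
  assume f: "\<And>k. f k \<ge> 0"
  have "f (s * m + 0) \<le> fs f s"
    unfolding fs_def by (rule member_le_sum[where f = "\<lambda>i. f (s * m + i)"]) (use m f in auto)
  then show ?thesis by (simp add: fz_def)
qed

lemma bp_Suc_fz: "bp (Suc s) = fz p s + p (Suc s * m)"
  unfolding bp_Suc sum_shift_fz ..

lemma pt_full: "pt s m = pt (Suc s) 0"
  using m_pos by (simp add: pt_def bp_Suc_fz fz_def fs_def)

lemma pot_eq: "l \<le> m \<Longrightarrow> pot (s * m + l) = pt s l"
proof (cases "l = m")
  case True
  then have "pot (s * m + l) = pot (Suc s * m + 0)" by (simp add: add.commute)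
  also have "\<dots> = pt (Suc s) 0" unfolding pot_def using m by (simp del: mult_Suc add_0_right)
  finally show ?thesis using True pt_full by simp
next
  case False
  assume "l \<le> m"
  with False show ?thesis by (simp add: pot_def)
qed

lemma pot_step: "prv m (k div m) p - p k = pot k - pot (Suc k)"
proof -
  define s l where "s = k div m" and "l = k mod m"
  have k: "k = s * m + l" and l: "l < m" using m by (simp_all add: s_def l_def)
  have "pot (Suc k) = pt s (Suc l)" using pot_eq[of "Suc l" s] l k by simp
  moreover have "pot k = pt s l" using pot_eq[of l s] l k by simp
  ultimately show ?thesis
    unfolding s_def[symmetric] prv_p by (simp add: k pt_def add_divide_distrib algebra_simps)
qed

lemma pot_nonneg: "pot k \<ge> 0"
proof -
  define s l where "s = k div m" and "l = k mod m"
  have l: "l < m" using m by (simp add: l_def)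
  show ?thesis
  proof (cases "l = 0")
    case True
    have "bp s - p (s * m) \<ge> 0"
    proof (cases s)
      case 0
      then show ?thesis using bp_0 m p_nonneg[of 0] mult_right_mono[of 1 "real m" "p 0"] by simp
    next
      case (Suc r)
      then show ?thesis using p_last_le_bp[of r] by simp
    qed
    with True show ?thesis by (simp add: pot_def pt_def s_def l_def)
  next
    case False
    have "p (s * m + 0) \<le> (\<Sum>i<l. p (s * m + i))"
      by (rule member_le_sum[where f = "\<lambda>i. p (s * m + i)"]) (use False p_nonneg in auto)
    moreover have "(1 - real l / real m) * bp s \<ge> 0"
      using l bp_nonneg by (intro mult_nonneg_nonneg) auto
    ultimately show ?thesis by (simp add: pot_def pt_def s_def[symmetric] l_def[symmetric])
  qed
qed

lemma pot_le: "l \<le> m \<Longrightarrow> pot (s * m + l) \<le> bp s + bp (Suc s)"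
proof -
  assume l: "l \<le> m"
  have "(1 - real l / real m) * bp s \<le> bp s"
    using l m_pos bp_nonneg[of s] by (intro mult_left_le_one_le) auto
  moreover have "(\<Sum>i<l. p (s * m + i)) \<le> (\<Sum>i<m. p (s * m + i))"
    by (rule sum_mono2) (use l p_nonneg in auto)
  moreover have "(\<Sum>i<m. p (s * m + i)) - p (s * m) \<le> bp (Suc s)"
    using p_nonneg[of "Suc s * m"] unfolding bp_Suc_fz fz_def fs_def by simp
  ultimately show ?thesis unfolding pot_eq[OF l] pt_def by linarith
qed

text \<open>Telescopes \<open>past_step\<close> with y_j fixed as comparison point. The contribution
  \<open>t2 * (prv - p)\<close> is a difference of \<open>pot\<close> and therefore passes from one
  epoch to the next; \<open>tk\<close> decreases, so the coefficient of \<open>G j\<close> only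
  drops. The kinetic term \<open>kk j\<close> is the price for z_j not being y_j.\<close>

lemma chain:
  assumes "j \<le> k" "k \<le> m * S"
  shows "(tk k)\<^sup>2 * G j k + p k + t2 * pot k + (\<Sum>i=j..<k. tk i * p i)
    \<le> kk j + (1 + (\<Sum>i=j..<k. tk i)) * p j + t2 * pot j"
  using assms
proof (induction k rule: dec_induct)
  case base
  then show ?case by (simp add: kk_def)
next
  case (step k)
  have k: "k < m * S" using step.prems by simp
  have "p (Suc k) + (tk k)\<^sup>2 * G j (Suc k) \<le> (1 - tk k - t2) * p k + tk k * p j + t2 * prv m (k div m) p + (tk k)\<^sup>2 * G j k"
    using past_step[OF k step.hyps(1)] e_nonneg[of "Suc k"] unfolding tk_def[symmetric] by linarith
  moreover have "t2 * prv m (k div m) p = t2 * p k + t2 * pot k - t2 * pot (Suc k)"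
  proof -
    have "prv m (k div m) p = p k + pot k - pot (Suc k)" using pot_step[of k] by linarith
    then show ?thesis by (simp only: distrib_left right_diff_distrib)
  qed
  moreover have "(tk (Suc k))\<^sup>2 * G j (Suc k) \<le> (tk k)\<^sup>2 * G j (Suc k)"
    using tk_antimono[of k "Suc k"] tk_pos[of "Suc k"] G_nonneg by (intro mult_right_mono power_mono) auto
  ultimately show ?case
    using step.IH step.prems step.hyps by (simp add: algebra_simps)
qed

lemma sum_epochs: "a \<le> b \<Longrightarrow> (\<Sum>k=a*m..<b*m. f k) = (\<Sum>s=a..<b. \<Sum>i<m. (f (s * m + i) :: real))"
proof (induction b rule: dec_induct)
  case (step b)
  have "(\<Sum>k=a*m..<Suc b * m. f k) = (\<Sum>k=a*m..<b * m. f k) + (\<Sum>k=b*m..<b*m+m. f k)"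
    using step.hyps by (subst sum.atLeastLessThan_concat) (auto simp: add.commute)
  also have "(\<Sum>k=b*m..<b*m+m. f k) = (\<Sum>i<m. f (b * m + i))"
    using sum.shift_bounds_nat_ivl[of f 0 "b * m" m] by (simp add: lessThan_atLeast0 add.commute)
  finally show ?case using step by simp
qed simp

end

section \<open>The regime of small \<open>t2\<close> and many epochs\<close>

locale small_tau_sequences = rate_sequences +
  assumes S40: "S \<ge> 40" and t2_small: "t2 \<le> 19 / 100"
begin

text \<open>The argument is run on the second half of the epochs only, where all steps are
  comparable to \<open>eta = 4 / S\<close> (\<open>t_le_eta\<close>,
  \<open>eta_le_t\<close>).\<close>

definition J :: nat where "J = S div 2"
definition eta :: real where "eta = 4 / real S"
text \<open>The share of the snapshot iterates among the comparison points in
  \<open>energy_step\<close>. It exceeds their share \<open>t2\<close> in yb just enough to survive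
  the factor \<open>(1 + \<tau> / 4)\<^sup>2\<close> there.\<close>

definition sg :: real where "sg = t2 * (1 + eta)"
text \<open>Dominates, up to constants, the snapshot mass \<open>m * t2\<close> and the step mass
  \<open>m * t s\<close> of an epoch in the second half, whether these are small or large compared
  with 1.\<close>

definition Gam :: real where "Gam = 1 + real m * (t2 + t (S - 1))"
definition c0 :: real where "c0 = 100000"
text \<open>In the suffix averages this replaces the factor \<open>1 + (remaining step mass)\<close>
  that \<open>chain\<close> produces. The enlarged offset dominates the mass of a whole epoch, which
  is what \<open>w_ratio\<close> needs.\<close>

definition That :: "nat \<Rightarrow> real" where "That k = c0 * Gam + (\<Sum>i=k..<m*S. tk i)"
definition w :: "nat \<Rightarrow> real" where "w k = 1 / (That k)\<^sup>2"
definition unit :: real where "unit = scl / (real S)\<^sup>2"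

lemma unit_nonneg: "unit \<ge> 0" by (simp add: unit_def scl_nonneg)

lemma eta_le: "eta \<le> 1 / 10" and eta_pos: "eta > 0"
  using S40 by (simp_all add: eta_def divide_simps)

lemma J_bounds: "J \<ge> 20" "J + 2 \<le> S - 1" "2 * J \<le> S" "S \<le> 2 * J + 1"
  using S40 by (auto simp: J_def)

lemma t_le_eta: "J \<le> s + 2 \<Longrightarrow> t s \<le> eta"
proof -
  assume "J \<le> s + 2"
  then have "S \<le> 2 * s + 8" using J_bounds(4) by linarith
  then have "2 * real s + 8 \<ge> real S" by linarith
  then show ?thesis using S40 by (simp add: step_tau_def eta_def field_simps)
qed

lemma eta_le_t: "s < S \<Longrightarrow> eta \<le> 11 / 5 * t s"
proof -
  assume "s < S"
  then have "real s + 1 \<le> real S" by linarith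
  then show ?thesis using S40 by (simp add: step_tau_def eta_def field_simps)
qed

lemma t_ratio: "J \<le> s + 2 \<Longrightarrow> s' < S \<Longrightarrow> t s \<le> 11 / 5 * t s'"
  by (rule order_trans[OF t_le_eta eta_le_t])

lemma Gam_ge_1: "Gam \<ge> 1"
  using t2_nonneg step_tau_pos[of "S - 1"] by (simp add: Gam_def)

lemma Gam_le: "Gam \<le> 2 * real m"
proof -
  have "t (S - 1) \<le> 1 / 10" using t_le_eta[of "S - 1"] J_bounds eta_le by linarith
  then have "real m * (t2 + t (S - 1)) \<le> real m * 1" using t2_small by (intro mult_left_mono) auto
  moreover have "1 \<le> real m" using m by simp
  ultimately show ?thesis unfolding Gam_def by linarith
qed

lemma mt2_le_Gam: "real m * t2 \<le> Gam"
  using m_pos step_tau_pos[of "S - 1"] mult_pos_pos[of "real m" "t (S - 1)"] by (simp add: Gam_def algebra_simps)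

lemma mt_le_Gam: "J \<le> s + 2 \<Longrightarrow> real m * t s \<le> 11 / 5 * Gam"
proof -
  assume "J \<le> s + 2"
  then have "real m * t s \<le> real m * (11 / 5 * t (S - 1))"
    using S by (intro mult_left_mono t_ratio) auto
  also have "\<dots> \<le> 11 / 5 * Gam"
    using m_pos t2_nonneg by (simp add: Gam_def algebra_simps add_increasing)
  finally show ?thesis .
qed

lemma sg_bounds: "sg \<ge> 0" "sg \<le> 11 / 10 * t2" "sg \<le> 21 / 100" "t2 \<le> sg"
proof -
  show "sg \<ge> 0" using t2_nonneg eta_pos by (simp add: sg_def)
  have "t2 * (1 + eta) \<le> t2 * (11 / 10)" using t2_nonneg eta_le by (intro mult_left_mono) auto
  then show "sg \<le> 11 / 10 * t2" by (simp add: sg_def)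
  then show "sg \<le> 21 / 100" using t2_small by simp
  show "t2 \<le> sg" using t2_nonneg eta_pos by (simp add: sg_def algebra_simps)
qed

lemma msg_le_Gam: "real m * sg \<le> 11 / 10 * Gam"
  using mult_left_mono[OF sg_bounds(2), of "real m"] mt2_le_Gam by simp

section \<open>Dissipation of the kinetic terms\<close>

text \<open>Uses y_k as comparison point with weight \<open>1 - sg\<close> and the snapshot iterates
  with weight \<open>sg\<close>, close to their weights in yb. By \<open>G_birth\<close> the
  resulting mixture of \<open>G k (Suc k)\<close> and \<open>G j (Suc k)\<close> dominates the new
  diagonal term. The z'-part of yb adds nothing to the new distance; this gain of order \<tau> pays
  for Young's inequality, for the excess of \<open>sg\<close> over \<open>t2\<close> and for the
  dissipation \<tau>/4.\<close>

lemma energy_step: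
  assumes s: "J \<le> s" "s < S" and i: "i < m"
  shows "p (s * m + i + 1) + (1 + t s / 4) * kk (s * m + i + 1)
    \<le> (1 - t2 - t s * sg) * p (s * m + i) + (t2 + t s * sg) * (bp s / real m)
      + (1 - sg) * kk (s * m + i) + sg * ((t s)\<^sup>2 * prv m s (\<lambda>j. G j (s * m + i)))"
proof -
  define k where "k = s * m + i"
  define \<tau> where "\<tau> = t s"
  have k: "k < m * S" "k div m = s" "s * m \<le> k"
    using idx_less[OF s(2) i] i by (auto simp: k_def)
  have \<tau>: "\<tau> > 0" "\<tau> \<le> 1 / 10" "\<tau> \<le> eta" "eta \<le> 11 / 5 * \<tau>"
    using step_tau_pos[of s] t_le_eta[of s] eta_le eta_le_t[OF s(2)] s by (auto simp: \<tau>_def)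
  define A where "A = (1 - \<tau> - t2) * p k + t2 * prv m s p"
  define B where "B = p (Suc k) + 7 / 5 * e (Suc k)"
  define g1 g2 where "g1 = \<tau>\<^sup>2 * G k (Suc k)" and "g2 = \<tau>\<^sup>2 * prv m s (\<lambda>j. G j (Suc k))"
  have X1: "B + g1 \<le> A + \<tau> * p k + \<tau>\<^sup>2 * G k k"
    using past_step[OF k(1), of k] unfolding k(2) \<tau>_def[symmetric] by (simp add: A_def B_def g1_def)
  have "prv m s (\<lambda>j. B + \<tau>\<^sup>2 * G j (Suc k)) \<le> prv m s (\<lambda>j. A + (\<tau> * p j + \<tau>\<^sup>2 * G j k))"
  proof (rule prv_mono)
    fix j assume "j \<le> s * m"
    then show "B + \<tau>\<^sup>2 * G j (Suc k) \<le> A + (\<tau> * p j + \<tau>\<^sup>2 * G j k)"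
      using past_step[OF k(1), of j] k(3) unfolding k(2) \<tau>_def[symmetric] by (simp add: A_def B_def)
  qed
  then have X2: "B + g2 \<le> A + \<tau> * prv m s p + \<tau>\<^sup>2 * prv m s (\<lambda>j. G j k)"
    unfolding prv_add prv_cmult prv_const[OF m] g2_def by simp
  have g: "g1 \<ge> 0" "g2 \<ge> 0" by (auto simp: g1_def g2_def intro!: mult_nonneg_nonneg prv_nonneg G_nonneg)
  have X: "B + ((1 - sg) * g1 + sg * g2) \<le> A + \<tau> * ((1 - sg) * p k + sg * prv m s p)
      + (1 - sg) * (\<tau>\<^sup>2 * G k k) + sg * (\<tau>\<^sup>2 * prv m s (\<lambda>j. G j k))"
    using add_mono[OF mult_left_mono[OF X1, of "1 - sg"] mult_left_mono[OF X2, of sg]] sg_bounds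
    by (simp add: algebra_simps)
  have sq: "(1 + \<tau> / 4)\<^sup>2 \<le> 1 + 51 / 100 * \<tau>"
  proof -
    have "\<tau> * \<tau> \<le> 1 / 10 * \<tau>" using \<tau> by (intro mult_right_mono) auto
    moreover have "(1 + \<tau> / 4)\<^sup>2 = 1 + \<tau> / 2 + \<tau> * \<tau> / 16" by (simp add: power2_eq_square algebra_simps)
    ultimately show ?thesis using \<tau> by linarith
  qed
  have co1: "(1 + \<tau> / 4)\<^sup>2 * (1 - \<tau> - t2) \<le> 1 - sg"
  proof -
    have "1 - \<tau> - t2 \<ge> 0" using \<tau> t2_small by simp
    then have "(1 + \<tau> / 4)\<^sup>2 * (1 - \<tau> - t2) \<le> (1 + 51 / 100 * \<tau>) * (1 - \<tau> - t2)"
      by (intro mult_right_mono sq)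
    also have "\<dots> = 1 - t2 - 49 / 100 * \<tau> - 51 / 100 * \<tau> * (\<tau> + t2)" by (simp add: field_simps)
    also have "\<dots> \<le> 1 - t2 - 49 / 100 * \<tau>"
    proof -
      have "0 \<le> 51 / 100 * \<tau> * (\<tau> + t2)"
        using \<tau>(1) t2_nonneg by (intro mult_nonneg_nonneg) auto
      then show ?thesis by linarith
    qed
    \<comment> \<open>The bound 19/100 on \<open>t2\<close> enters here: 19/100 * 11/5 = 0.418 stays
      below 49/100.\<close>
    also have "\<dots> \<le> 1 - t2 - t2 * eta"
    proof -
      have "t2 * eta \<le> 19 / 100 * (11 / 5 * \<tau>)"
        using t2_small t2_nonneg \<tau> eta_pos by (intro mult_mono) auto
      then show ?thesis using \<tau>(1) by linarith
    qed
    finally show ?thesis by (simp add: sg_def distrib_left)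
  qed
  have co2: "(1 + \<tau> / 4)\<^sup>2 * t2 \<le> sg"
  proof -
    have "(1 + \<tau> / 4)\<^sup>2 \<le> 1 + eta" using sq \<tau> by linarith
    then show ?thesis using t2_nonneg by (simp add: sg_def mult.commute mult_left_mono)
  qed
  \<comment> \<open>The coefficient 7/5 of \<open>e\<close> has to cover \<tau>^2 times the Young
    term \<open>3 * (1 + 4 / \<tau>)\<close>, which is about 12 \<tau>. This is ensured by \<tau>
    \<le> 1/10, hence by \<open>S \<ge> 40\<close>.\<close>
  have co3: "(1 + \<tau> / 4) * (\<tau>\<^sup>2 * ((1 + 1 / (\<tau> / 4)) * 3)) \<le> 7 / 5"
  proof -
    have "\<tau>\<^sup>2 * ((1 + 1 / (\<tau> / 4)) * 3) = 3 * \<tau>\<^sup>2 + 12 * \<tau>" using \<tau>(1) by (simp add: field_simps power2_eq_square)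
    moreover have "\<tau>\<^sup>2 \<le> (1 / 10)\<^sup>2" using \<tau> by (intro power_mono) auto
    ultimately have "\<tau>\<^sup>2 * ((1 + 1 / (\<tau> / 4)) * 3) \<le> 123 / 100" using \<tau>(2) by (simp add: power_divide)
    then have "(1 + \<tau> / 4) * (\<tau>\<^sup>2 * ((1 + 1 / (\<tau> / 4)) * 3)) \<le> (41 / 40) * (123 / 100)"
      using \<tau>(1,2) by (intro mult_mono) auto
    also have "(41 / 40) * (123 / 100) \<le> (7 / 5 :: real)" by simp
    finally show ?thesis .
  qed
  have gb: "G (Suc k) (Suc k) \<le> (1 + \<tau> / 4) * ((1 - \<tau> - t2) * G k (Suc k) + t2 * prv m s (\<lambda>j. G j (Suc k)))
      + (1 + 1 / (\<tau> / 4)) * (3 * e (Suc k))"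
    using G_birth[OF k(1), of "\<tau> / 4"] \<tau>(1) unfolding k(2) \<tau>_def[symmetric] by (simp only: divide_pos_pos zero_less_numeral)
  have "(1 + \<tau> / 4) * (\<tau>\<^sup>2 * G (Suc k) (Suc k)) \<le> (1 + \<tau> / 4) * (\<tau>\<^sup>2 *
     ((1 + \<tau> / 4) * ((1 - \<tau> - t2) * G k (Suc k) + t2 * prv m s (\<lambda>j. G j (Suc k))) + (1 + 1 / (\<tau> / 4)) * (3 * e (Suc k))))"
    using \<tau>(1) by (intro mult_left_mono gb) simp_all
  also have "\<dots> = ((1 + \<tau> / 4)\<^sup>2 * (1 - \<tau> - t2)) * g1 + ((1 + \<tau> / 4)\<^sup>2 * t2) * g2
      + ((1 + \<tau> / 4) * (\<tau>\<^sup>2 * ((1 + 1 / (\<tau> / 4)) * 3))) * e (Suc k)"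
  proof -
    have "c * (\<tau>\<^sup>2 * (c * (x * G1 + t2 * G2) + d * (3 * e1)))
        = (c\<^sup>2 * x) * (\<tau>\<^sup>2 * G1) + (c\<^sup>2 * t2) * (\<tau>\<^sup>2 * G2) + (c * (\<tau>\<^sup>2 * (d * 3))) * e1" for c d x G1 G2 e1 :: real
      by (simp add: algebra_simps power2_eq_square)
    then show ?thesis unfolding g1_def g2_def .
  qed
  also have "\<dots> \<le> (1 - sg) * g1 + sg * g2 + 7 / 5 * e (Suc k)"
    by (intro add_mono mult_right_mono co1 co2 co3 g e_nonneg)
  finally have birth: "(1 + \<tau> / 4) * (\<tau>\<^sup>2 * G (Suc k) (Suc k)) \<le> (1 - sg) * g1 + sg * g2 + 7 / 5 * e (Suc k)" .
  have "kk (Suc k) \<le> \<tau>\<^sup>2 * G (Suc k) (Suc k)"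
  proof -
    have "tk (Suc k) \<le> \<tau>" using tk_antimono[of k "Suc k"] by (simp add: tk_def k \<tau>_def)
    then show ?thesis unfolding kk_def using tk_pos[of "Suc k"] G_nonneg by (intro mult_right_mono power_mono) auto
  qed
  then have "(1 + \<tau> / 4) * kk (Suc k) \<le> (1 + \<tau> / 4) * (\<tau>\<^sup>2 * G (Suc k) (Suc k))"
    using \<tau>(1) by (intro mult_left_mono) simp_all
  moreover have "(1 - sg) * kk k = (1 - sg) * (\<tau>\<^sup>2 * G k k)" by (simp add: kk_def tk_def k \<tau>_def)
  moreover have "A + \<tau> * ((1 - sg) * p k + sg * prv m s p) = (1 - t2 - \<tau> * sg) * p k + (t2 + \<tau> * sg) * prv m s p"
    by (simp add: A_def algebra_simps)
  ultimately show ?thesis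
    using X birth unfolding k_def[symmetric] \<tau>_def[symmetric] prv_p[symmetric] B_def Suc_eq_plus1 by linarith
qed

text \<open>Applies \<open>chain\<close> from each iterate of the snapshot to each step of the next
  epoch and averages over the former. Fewer than \<open>2 * m\<close> steps lie between them, which
  gives the term \<open>2 * m * t r\<close>. For \<open>p\<close> and \<open>pot\<close> the
  contributions of the common end point \<open>Suc r * m\<close> cancel, and the remaining
  differences of \<open>fz\<close> telescope over the epochs.\<close>

lemma past_average:
  assumes s: "J \<le> Suc r" "Suc r < S"
  shows "(\<Sum>i<m. (t (Suc r))\<^sup>2 * prv m (Suc r) (\<lambda>j. G j (Suc r * m + i)))
    \<le> (fz kk r + kk (Suc r * m)) + (fz p r - fz p (Suc r)) + 2 * real m * t r * bp (Suc r)
      + t2 * (fz pot r - fz pot (Suc r))"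
proof -
  let ?j = "\<lambda>j'. r * m + j' + 1"
  let ?k = "\<lambda>i. Suc r * m + i"
  define H where "H j = kk j + p j + 2 * real m * t r * p j + t2 * pot j" for j
  have pw: "(t (Suc r))\<^sup>2 * G (?j j') (?k i) \<le> H (?j j') - p (?k i) - t2 * pot (?k i)"
    if i: "i < m" and j': "j' < m" for i j'
  proof -
    have jk: "?j j' \<le> ?k i" using j' by simp
    have kS: "?k i \<le> m * S" using idx_less[OF s(2) i] by simp
    have sm: "(\<Sum>l=?j j'..<?k i. tk l) \<le> 2 * real m * t r"
    proof -
      have "(\<Sum>l=?j j'..<?k i. tk l) \<le> (\<Sum>l=?j j'..<?k i. t r)"
      proof (rule sum_mono)
        fix l assume "l \<in> {?j j'..<?k i}"
        then have "r * m \<le> l" by simp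
        then show "tk l \<le> t r" using tk_antimono[of "r * m" l] tk_epoch0[of r] by simp
      qed
      also have "\<dots> = real (?k i - ?j j') * t r" by simp
      also have "\<dots> \<le> real (2 * m) * t r"
        using i step_tau_pos[of r] by (intro mult_right_mono) auto
      finally show ?thesis by simp
    qed
    have "(tk (?k i))\<^sup>2 * G (?j j') (?k i) + p (?k i) + t2 * pot (?k i)
        \<le> kk (?j j') + (1 + (\<Sum>l=?j j'..<?k i. tk l)) * p (?j j') + t2 * pot (?j j')"
    proof -
      have "0 \<le> (\<Sum>l=?j j'..<?k i. tk l * p l)"
        by (intro sum_nonneg mult_nonneg_nonneg p_nonneg) (simp add: tk_pos less_imp_le)
      then show ?thesis using chain[OF jk kS] by linarith
    qed
    moreover have "(1 + (\<Sum>l=?j j'..<?k i. tk l)) * p (?j j') \<le> (1 + 2 * real m * t r) * p (?j j')"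
      using sm p_nonneg by (intro mult_right_mono) auto
    ultimately show ?thesis using tk_epoch[OF i, of "Suc r"] by (simp add: H_def algebra_simps)
  qed
  have "(t (Suc r))\<^sup>2 * prv m (Suc r) (\<lambda>j. G j (?k i)) \<le> (\<Sum>j'<m. H (?j j')) / real m - p (?k i) - t2 * pot (?k i)"
    if i: "i < m" for i
  proof -
    have "(t (Suc r))\<^sup>2 * prv m (Suc r) (\<lambda>j. G j (?k i)) = (\<Sum>j'<m. (t (Suc r))\<^sup>2 * G (?j j') (?k i)) / real m"
      unfolding prv_Suc by (simp add: sum_distrib_left)
    also have "\<dots> \<le> (\<Sum>j'<m. H (?j j') - p (?k i) - t2 * pot (?k i)) / real m"
      using pw[OF i] by (intro divide_right_mono sum_mono) auto
    also have "\<dots> = (\<Sum>j'<m. H (?j j')) / real m - p (?k i) - t2 * pot (?k i)"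
      using m_pos by (simp add: sum_subtractf diff_divide_distrib)
    finally show ?thesis .
  qed
  then have "(\<Sum>i<m. (t (Suc r))\<^sup>2 * prv m (Suc r) (\<lambda>j. G j (?k i)))
      \<le> (\<Sum>i<m. (\<Sum>j'<m. H (?j j')) / real m - p (?k i) - t2 * pot (?k i))"
    by (intro sum_mono) auto
  also have "\<dots> = (\<Sum>j'<m. H (?j j')) - fs p (Suc r) - t2 * fs pot (Suc r)"
    using m_pos by (simp add: sum_subtractf fs_def sum_distrib_left[symmetric])
  also have "(\<Sum>j'<m. H (?j j')) = (\<Sum>j'<m. kk (?j j')) + (\<Sum>j'<m. p (?j j'))
      + 2 * real m * t r * (\<Sum>j'<m. p (?j j')) + t2 * (\<Sum>j'<m. pot (?j j'))"
    unfolding H_def by (simp add: sum.distrib sum_distrib_left)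
  also have "\<dots> = (fz kk r + kk (Suc r * m)) + (fz p r + p (Suc r * m))
      + 2 * real m * t r * bp (Suc r) + t2 * (fz pot r + pot (Suc r * m))"
    unfolding sum_shift_fz bp_Suc_fz ..
  finally show ?thesis
    unfolding fz_def[of p "Suc r"] fz_def[of pot "Suc r"] by (simp add: algebra_simps)
qed

lemma c0_pos: "c0 > 0" by (simp add: c0_def)

lemma That_ge: "That k \<ge> c0 * Gam"
  unfolding That_def using tk_pos by (simp add: sum_nonneg less_imp_le)

lemma That_pos: "That k > 0"
  using That_ge[of k] Gam_ge_1 mult_pos_pos[of c0 Gam] c0_pos by linarith

lemma That_split: "k \<le> k' \<Longrightarrow> k' \<le> m * S \<Longrightarrow> That k = That k' + (\<Sum>i=k..<k'. tk i)"
  using sum.atLeastLessThan_concat[of k k' "m * S" tk] by (simp add: That_def)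

lemma w_pos: "w k > 0"
  using That_pos[of k] by (simp add: w_def)

lemma w_mono: "k \<le> k' \<Longrightarrow> k' \<le> m * S \<Longrightarrow> w k \<le> w k'"
proof -
  assume k: "k \<le> k'" "k' \<le> m * S"
  have "That k' \<le> That k"
    unfolding That_split[OF k] using tk_pos by (simp add: sum_nonneg less_imp_le)
  then show ?thesis
    unfolding w_def using That_pos[of k'] That_pos[of k]
    by (intro divide_left_mono power_mono) (simp_all add: less_imp_le)
qed

text \<open>\<open>That\<close> changes by a factor \<open>1 + y\<close> with
  \<open>y \<le> D / (c0 * Gam) \<le> 1\<close>, and then (1 + y)^2 \<le> 1 + 3 y.\<close>

lemma w_ratio:
  assumes k: "k \<le> k'" "k' \<le> m * S" and D: "(\<Sum>i=k..<k'. tk i) \<le> D" "D \<le> c0 * Gam"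
  shows "w k' \<le> w k * (1 + 3 * (D / (c0 * Gam)))"
proof -
  define T where "T = That k'"
  define d where "d = (\<Sum>i=k..<k'. tk i)"
  have cg: "c0 * Gam > 0" using c0_pos Gam_ge_1 by simp
  have T: "T > 0" "T \<ge> c0 * Gam" using That_pos That_ge by (simp_all add: T_def)
  have d: "d \<ge> 0" unfolding d_def using tk_pos by (simp add: sum_nonneg less_imp_le)
  have x: "d / T \<le> D / (c0 * Gam)"
    using d D T cg unfolding d_def[symmetric] by (intro frac_le) auto
  have x1: "D / (c0 * Gam) \<le> 1" using D(2) cg by simp
  have "That k = T * (1 + d / T)" using That_split[OF k] T by (simp add: T_def d_def field_simps)
  then have "w k = w k' / (1 + d / T)\<^sup>2" using T by (simp add: w_def T_def power_mult_distrib)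
  then have "w k' = w k * (1 + d / T)\<^sup>2" using d T by (simp add: add_nonneg_eq_0_iff field_simps)
  also have "\<dots> \<le> w k * (1 + 3 * (D / (c0 * Gam)))"
  proof (intro mult_left_mono)
    define y where "y = d / T"
    have y: "0 \<le> y" "y \<le> D / (c0 * Gam)" using d T x by (simp_all add: y_def)
    then have y1: "y \<le> 1" using x1 by linarith
    have "y * y \<le> 1 * y" using y y1 by (intro mult_right_mono) auto
    then have "(1 + y)\<^sup>2 \<le> 1 + 3 * y" by (simp add: power2_eq_square algebra_simps)
    then show "(1 + d / T)\<^sup>2 \<le> 1 + 3 * (D / (c0 * Gam))" using y unfolding y_def[symmetric] by linarith
  qed (use w_pos[of k] in simp)
  finally show ?thesis .
qed

lemma w_within_epoch:
  assumes s: "J \<le> s + 2" "s < S" and i: "i \<le> m"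
  shows "w (s * m + i) \<le> w (s * m) * (1 + 3 / c0 * (real m * t s / Gam))"
    and "w (s * m) \<le> w (s * m + i)" "w (s * m + i) \<le> w (Suc s * m)" "w (s * m + i) \<le> 2 * w (s * m)"
proof -
  have le: "s * m + i \<le> Suc s * m" "Suc s * m \<le> m * S"
    using i s(2) mult_right_mono[of "Suc s" S m] by (auto simp: mult.commute)
  have D: "(\<Sum>l=s*m..<s*m+i. tk l) \<le> real m * t s"
  proof -
    have "(\<Sum>l=s*m..<s*m+i. tk l) \<le> (\<Sum>l=s*m..<s*m+i. t s)"
    proof (rule sum_mono)
      fix l assume "l \<in> {s*m..<s*m+i}"
      then show "tk l \<le> t s" using tk_antimono[of "s * m" l] tk_epoch0[of s] by simp
    qed
    also have "\<dots> \<le> real m * t s" using i step_tau_pos[of s] by simp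
    finally show ?thesis .
  qed
  have mt: "real m * t s \<le> 11 / 5 * Gam" using mt_le_Gam[OF s(1)] .
  have "w (s * m + i) \<le> w (s * m) * (1 + 3 * (real m * t s / (c0 * Gam)))"
    by (rule w_ratio[OF _ _ D]) (use le mt Gam_ge_1 in \<open>auto simp: c0_def\<close>)
  then show *: "w (s * m + i) \<le> w (s * m) * (1 + 3 / c0 * (real m * t s / Gam))" by simp
  show "w (s * m) \<le> w (s * m + i)" "w (s * m + i) \<le> w (Suc s * m)"
    using le by (auto intro!: w_mono)
  have "real m * t s / Gam \<le> 11 / 5" using mt Gam_ge_1 by (simp add: field_simps)
  then have "3 / c0 * (real m * t s / Gam) \<le> 3 / c0 * (11 / 5)"
    using c0_pos by (intro mult_left_mono) auto
  also have "3 / c0 * (11 / 5) \<le> 1" by (simp add: c0_def)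
  finally have "1 + 3 / c0 * (real m * t s / Gam) \<le> 2" by linarith
  then have "w (s * m) * (1 + 3 / c0 * (real m * t s / Gam)) \<le> w (s * m) * 2"
    using w_pos[of "s * m"] by (intro mult_left_mono) auto
  with * show "w (s * m + i) \<le> 2 * w (s * m)" by simp
qed

lemma w_Suc:
  assumes k: "J * m \<le> k" "k < m * S"
  shows "w (Suc k) \<le> w k * (1 + tk k / 1000)" "w (Suc k) \<le> 2 * w k"
proof -
  have tk: "tk k \<le> 1 / 10"
    using tk_antimono[OF k(1)] t_le_eta[of J] eta_le tk_epoch0[of J] by simp
  have "w (Suc k) \<le> w k * (1 + 3 * (tk k / (c0 * Gam)))"
    by (rule w_ratio) (use k tk Gam_ge_1 in \<open>auto simp: c0_def\<close>)
  also have "\<dots> \<le> w k * (1 + tk k / 1000)"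
  proof (intro mult_left_mono add_left_mono)
    have "tk k / (c0 * Gam) \<le> tk k / 3000"
      using tk_pos[of k] Gam_ge_1 by (intro divide_left_mono) (auto simp: c0_def)
    then show "3 * (tk k / (c0 * Gam)) \<le> tk k / 1000" by linarith
  qed (use w_pos[of k] in simp)
  finally show *: "w (Suc k) \<le> w k * (1 + tk k / 1000)" .
  also have "\<dots> \<le> w k * 2" using tk w_pos[of k] by (intro mult_left_mono) auto
  finally show "w (Suc k) \<le> 2 * w k" by simp
qed

text \<open>The energy that an epoch hands to the next one through the snapshot. In
  \<open>energy_epoch\<close> an epoch receives \<open>Psi r\<close> and passes on
  \<open>Psi (Suc r)\<close>.\<close>

definition Psi :: "nat \<Rightarrow> real" where
  "Psi s = sg * fz kk s + (sg + t2) * fz p s + sg * t2 * fz pot s"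

lemma fz_pot_le: "fz pot s \<le> real m * (bp s + bp (Suc s))"
proof -
  have "fs pot s \<le> (\<Sum>i<m. bp s + bp (Suc s))"
    unfolding fs_def by (intro sum_mono pot_le) auto
  then show ?thesis unfolding fz_def using pot_nonneg[of "s * m"] by simp
qed

lemma fz_p_le: "fz p s \<le> bp (Suc s)"
  unfolding bp_Suc_fz using p_nonneg by simp

lemma Psi_nonneg: "Psi s \<ge> 0"
  unfolding Psi_def using sg_bounds t2_nonneg
  by (intro add_nonneg_nonneg mult_nonneg_nonneg fz_nonneg kk_nonneg p_nonneg pot_nonneg) auto

definition cp :: "nat \<Rightarrow> real" where "cp s = (\<Sum>i<m. kk (s * m + i + 1))"

lemma cp_eq: "cp s = fz kk s + kk (Suc s * m)"
  unfolding cp_def sum_shift_fz ..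

lemma cp_nonneg: "cp s \<ge> 0"
  unfolding cp_def by (intro sum_nonneg kk_nonneg)

text \<open>Over an epoch the weight grows by the relative amount
  \<open>3 / c0 * (m * t s / Gam)\<close>. Since \<open>m * sg\<close> and \<open>m * t2\<close> are
  of order \<open>Gam\<close>, the factor \<open>m / Gam\<close> turns the coefficients in
  \<open>Psi\<close> into constants, up to one \<open>Gam\<close> at the gaps; the error is then
  \<open>t s / c0\<close> times kinetic terms and gaps.\<close>

lemma Psi_le: "real m / Gam * Psi s \<le> 2 * cp s + 10 * Gam * (bp s + bp (Suc s))"
proof -
  have Gp: "Gam > 0" using Gam_ge_1 by simp
  have a: "real m / Gam * sg \<le> 11 / 10" and b: "real m / Gam * t2 \<le> 1"
    using msg_le_Gam mt2_le_Gam Gp by (auto simp: field_simps)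
  have "real m / Gam * Psi s = (real m / Gam * sg) * fz kk s + (real m / Gam * sg + real m / Gam * t2) * fz p s
      + (real m / Gam * sg) * (t2 * fz pot s)"
    unfolding Psi_def by (simp add: algebra_simps)
  also have "\<dots> \<le> 11 / 10 * cp s + 21 / 10 * bp (Suc s) + 11 / 10 * (Gam * (bp s + bp (Suc s)))"
  proof (rule add_mono[OF add_mono])
    have "fz kk s \<le> cp s" unfolding cp_eq using kk_nonneg by simp
    then show "real m / Gam * sg * fz kk s \<le> 11 / 10 * cp s"
      by (intro mult_mono a) (auto intro: fz_nonneg kk_nonneg)
    have "real m / Gam * sg + real m / Gam * t2 \<le> 21 / 10" using a b by linarith
    then show "(real m / Gam * sg + real m / Gam * t2) * fz p s \<le> 21 / 10 * bp (Suc s)"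
      by (intro mult_mono fz_p_le) (auto intro: fz_nonneg p_nonneg)
    have "t2 * fz pot s \<le> t2 * (real m * (bp s + bp (Suc s)))"
      using t2_nonneg fz_pot_le by (intro mult_left_mono)
    also have "\<dots> = (real m * t2) * (bp s + bp (Suc s))" by simp
    also have "\<dots> \<le> Gam * (bp s + bp (Suc s))"
      using mt2_le_Gam bp_nonneg by (intro mult_right_mono) (auto intro: add_nonneg_nonneg)
    finally have "t2 * fz pot s \<le> Gam * (bp s + bp (Suc s))" .
    moreover have "0 \<le> t2 * fz pot s"
      using t2_nonneg by (intro mult_nonneg_nonneg fz_nonneg pot_nonneg)
    ultimately show "real m / Gam * sg * (t2 * fz pot s) \<le> 11 / 10 * (Gam * (bp s + bp (Suc s)))"
      by (intro mult_mono[OF a]) auto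
  qed
  also have "\<dots> \<le> 2 * cp s + 10 * Gam * (bp s + bp (Suc s))"
  proof -
    have "1 * bp (Suc s) \<le> Gam * bp (Suc s)" using Gam_ge_1 bp_nonneg by (intro mult_right_mono)
    moreover have "0 \<le> Gam * bp s" using Gp bp_nonneg by simp
    ultimately show ?thesis using cp_nonneg[of s] bp_nonneg[of "Suc s"] unfolding distrib_left mult.assoc by linarith
  qed
  finally show ?thesis .
qed

text \<open>In the weighted sum of \<open>energy_step\<close> the gains from the snapshot get the
  largest weight \<open>w1\<close> of the epoch and the losses the smallest one \<open>w0\<close>.
  With the common weight \<open>w0\<close> they reduce to \<open>Psi r - Psi (Suc r)\<close> by
  \<open>past_average\<close>; the difference \<open>w1 - w0\<close> is an error of relative size
  \<open>1 / c0\<close>.\<close>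

lemma energy_epoch:
  assumes s: "J \<le> Suc r" "Suc r < S"
  shows "(\<Sum>i<m. w (Suc r * m + i) * ((p (Suc r * m + i + 1) - p (Suc r * m + i))
            + (kk (Suc r * m + i + 1) - kk (Suc r * m + i)) + t (Suc r) / 4 * kk (Suc r * m + i + 1)))
    \<le> w (Suc r * m) * (Psi r - Psi (Suc r))
      + w (Suc r * m) * t (Suc r) * (8 * Gam * (bp r + bp (Suc r)) + cp r / 1000)"
proof -
  define s where "s = Suc r"
  define \<tau> where "\<tau> = t s"
  define w0 w1 where "w0 = w (s * m)" and "w1 = w (Suc s * m)"
  have sJ: "J \<le> s" "s < S" using assms by (auto simp: s_def)
  have tau: "\<tau> > 0" "\<tau> \<le> 1 / 10" using step_tau_pos t_le_eta[of s] eta_le sJ by (auto simp: \<tau>_def)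
  have tr: "t r \<le> 11 / 5 * \<tau>" unfolding \<tau>_def using s sJ by (intro t_ratio) auto
  have Gp: "Gam > 0" using Gam_ge_1 by simp
  have w0: "w0 > 0" by (simp add: w0_def w_pos)
  have w1: "w1 - w0 \<le> w0 * (3 / c0 * (real m * \<tau> / Gam))" and w01: "w0 \<le> w1"
    using w_within_epoch(1,2)[of s m] sJ by (auto simp: w0_def w1_def \<tau>_def algebra_simps)
  define rr where "rr i = \<tau>\<^sup>2 * prv m s (\<lambda>j. G j (s * m + i))" for i
  define \<rho> where "\<rho> = (\<Sum>i<m. rr i)"
  define a where "a = t2 + \<tau> * sg"
  have a: "a \<ge> 0" using t2_nonneg tau sg_bounds by (simp add: a_def)
  have rr: "rr i \<ge> 0" for i unfolding rr_def by (intro mult_nonneg_nonneg prv_nonneg G_nonneg) simp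
  have "(\<Sum>i<m. w (s * m + i) * ((p (s * m + i + 1) - p (s * m + i))
            + (kk (s * m + i + 1) - kk (s * m + i)) + \<tau> / 4 * kk (s * m + i + 1)))
      \<le> (\<Sum>i<m. sg * (w1 * rr i - w0 * kk (s * m + i)) + a * (w1 * (bp s / real m) - w0 * p (s * m + i)))"
  proof (rule sum_mono)
    fix i assume "i \<in> {..<m}"
    then have i: "i < m" by simp
    let ?k = "s * m + i"
    have wk: "w0 \<le> w ?k" "w ?k \<le> w1" "w ?k \<ge> 0"
      using w_within_epoch(2,3)[of s i] i sJ w_pos[of ?k] by (auto simp: w0_def w1_def)
    have "(p (?k + 1) - p ?k) + (kk (?k + 1) - kk ?k) + \<tau> / 4 * kk (?k + 1)
        \<le> sg * (rr i - kk ?k) + a * (bp s / real m - p ?k)"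
      using energy_step[OF sJ i] unfolding \<tau>_def[symmetric] rr_def[symmetric] by (simp add: a_def algebra_simps)
    then have "w ?k * ((p (?k + 1) - p ?k) + (kk (?k + 1) - kk ?k) + \<tau> / 4 * kk (?k + 1))
        \<le> w ?k * (sg * (rr i - kk ?k) + a * (bp s / real m - p ?k))"
      using wk by (intro mult_left_mono)
    also have "\<dots> = sg * (w ?k * rr i - w ?k * kk ?k) + a * (w ?k * (bp s / real m) - w ?k * p ?k)"
      by (simp add: algebra_simps)
    also have "\<dots> \<le> sg * (w1 * rr i - w0 * kk ?k) + a * (w1 * (bp s / real m) - w0 * p ?k)"
      using wk rr kk_nonneg p_nonneg bp_nonneg[of s] sg_bounds a m_pos
      by (intro add_mono mult_left_mono diff_mono mult_right_mono) auto
    finally show "w ?k * ((p (?k + 1) - p ?k) + (kk (?k + 1) - kk ?k) + \<tau> / 4 * kk (?k + 1))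
        \<le> sg * (w1 * rr i - w0 * kk ?k) + a * (w1 * (bp s / real m) - w0 * p ?k)" .
  qed
  also have "\<dots> = sg * (w1 * \<rho> - w0 * fs kk s) + a * (w1 * bp s - w0 * fs p s)"
    using m_pos by (simp add: sum.distrib sum_subtractf sum_distrib_left[symmetric] \<rho>_def fs_def)
  also have "\<dots> = w0 * (sg * (\<rho> - fs kk s) + a * (bp s - fs p s)) + (w1 - w0) * (sg * \<rho> + a * bp s)"
    by (simp add: algebra_simps)
  finally have L: "(\<Sum>i<m. w (s * m + i) * ((p (s * m + i + 1) - p (s * m + i))
            + (kk (s * m + i + 1) - kk (s * m + i)) + \<tau> / 4 * kk (s * m + i + 1)))
      \<le> w0 * (sg * (\<rho> - fs kk s) + a * (bp s - fs p s)) + (w1 - w0) * (sg * \<rho> + a * bp s)" .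
  have \<rho>: "\<rho> \<le> cp r + (fz p r - fz p s) + 2 * real m * t r * bp s + t2 * (fz pot r - fz pot s)"
    using past_average[OF assms] unfolding \<rho>_def rr_def s_def \<tau>_def cp_eq by simp
  have bps: "bp s - fs p s = fz p r - fz p s" "fz p r \<le> bp s"
    using p_nonneg unfolding s_def bp_Suc_fz by (auto simp: fz_def)
  have cps: "cp r - fs kk s = fz kk r - fz kk s" unfolding s_def cp_eq by (simp add: fz_def)
  have fzn: "fz p s \<ge> 0" "fz pot s \<ge> 0" "fz p r \<ge> 0" "fz pot r \<ge> 0"
    by (intro fz_nonneg p_nonneg pot_nonneg)+
  have tsg: "\<tau> * sg * (bp s - fs p s) \<le> \<tau> * sg * bp s"
    using tau sg_bounds bps fzn by (intro mult_left_mono) auto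
  have main1: "sg * (\<rho> - fs kk s) + a * (bp s - fs p s)
      \<le> Psi r - Psi s + (2 * real m * sg * t r + \<tau> * sg) * bp s"
  proof -
    have "sg * (\<rho> - fs kk s) \<le> sg * ((fz kk r - fz kk s) + (fz p r - fz p s) + 2 * real m * t r * bp s + t2 * (fz pot r - fz pot s))"
      using \<rho> cps sg_bounds by (intro mult_left_mono) auto
    then show ?thesis using tsg unfolding a_def bps(1) Psi_def by (simp add: algebra_simps)
  qed
  have k1: "(2 * real m * sg * t r + \<tau> * sg) * bp s \<le> \<tau> * (6 * Gam * bp s)"
  proof -
    have "real m * sg * t r \<le> (11 / 10 * Gam) * (11 / 5 * \<tau>)"
      using Gp step_tau_pos[of r] by (intro mult_mono[OF msg_le_Gam tr]) auto
    moreover have "\<tau> * sg \<le> \<tau> * (21 / 100 * Gam)"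
      using tau sg_bounds Gam_ge_1 by (intro mult_left_mono) auto
    moreover have "0 \<le> Gam * \<tau>" using Gp tau by simp
    ultimately have "2 * real m * sg * t r + \<tau> * sg \<le> \<tau> * (6 * Gam)" by (simp add: algebra_simps)
    then show ?thesis using mult_right_mono[OF _ bp_nonneg[of s]] by (metis mult.assoc)
  qed
  have main2: "real m / Gam * (sg * \<rho> + a * bp s) \<le> 2 * cp r + 20 * Gam * (bp r + bp s)"
  proof -
    have x1: "real m / Gam * sg \<le> 11 / 10" and x2: "real m / Gam * a \<le> 2"
    proof -
      show "real m / Gam * sg \<le> 11 / 10" using msg_le_Gam Gp by (simp add: field_simps)
      have "real m * a \<le> 2 * Gam"
      proof -
        have "real m * (\<tau> * sg) \<le> 1 / 10 * (real m * sg)"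
          using tau sg_bounds m_pos mult_right_mono[of \<tau> "1 / 10" "real m * sg"] by (simp add: mult_ac)
        then show ?thesis using mt2_le_Gam msg_le_Gam Gp by (simp add: a_def algebra_simps)
      qed
      then show "real m / Gam * a \<le> 2" using Gp by (simp add: field_simps)
    qed
    have rb: "\<rho> \<le> cp r + (1 + 5 * Gam) * bp s + Gam * (bp r + bp s)"
    proof -
      have "2 * real m * t r * bp s \<le> 5 * Gam * bp s"
        using mt_le_Gam[of r] s bp_nonneg Gp by (intro mult_right_mono) auto
      moreover have "t2 * (fz pot r - fz pot s) \<le> Gam * (bp r + bp s)"
      proof -
        have "t2 * (fz pot r - fz pot s) \<le> t2 * (real m * (bp r + bp s))"
          using fz_pot_le[of r] fzn t2_nonneg by (intro mult_left_mono) (auto simp: s_def)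
        also have "\<dots> = real m * t2 * (bp r + bp s)" by simp
        also have "\<dots> \<le> Gam * (bp r + bp s)"
          using mt2_le_Gam bp_nonneg by (intro mult_right_mono add_nonneg_nonneg)
        finally show ?thesis .
      qed
      ultimately show ?thesis using \<rho> bps fzn by (simp add: algebra_simps)
    qed
    have "real m / Gam * (sg * \<rho> + a * bp s) = (real m / Gam * sg) * \<rho> + (real m / Gam * a) * bp s"
      by (simp add: algebra_simps)
    also have "\<dots> \<le> 11 / 10 * (cp r + (1 + 5 * Gam) * bp s + Gam * (bp r + bp s)) + 2 * bp s"
      using x1 x2 rb bp_nonneg \<rho>_def rr by (intro add_mono mult_mono) (auto simp: sum_nonneg)
    also have "\<dots> \<le> 2 * cp r + 20 * Gam * (bp r + bp s)"
    proof -
      have "1 * bp s \<le> Gam * bp s" using Gam_ge_1 bp_nonneg by (intro mult_right_mono)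
      moreover have "0 \<le> Gam * bp r" "0 \<le> Gam * bp s" using Gp bp_nonneg by auto
      ultimately show ?thesis using cp_nonneg[of r] bp_nonneg[of s] unfolding distrib_left distrib_right mult.assoc by linarith
    qed
    finally show ?thesis .
  qed
  have nn: "0 \<le> sg * \<rho> + a * bp s"
    using sg_bounds a bp_nonneg rr by (auto simp: \<rho>_def intro!: add_nonneg_nonneg mult_nonneg_nonneg sum_nonneg)
  have "(w1 - w0) * (sg * \<rho> + a * bp s) \<le> w0 * (3 / c0 * (real m * \<tau> / Gam)) * (sg * \<rho> + a * bp s)"
    using w1 nn by (intro mult_right_mono)
  also have "\<dots> = w0 * \<tau> * (3 / c0) * (real m / Gam * (sg * \<rho> + a * bp s))" by simp
  also have "\<dots> \<le> w0 * \<tau> * (3 / c0) * (2 * cp r + 20 * Gam * (bp r + bp s))"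
    using main2 w0 tau c0_pos by (intro mult_left_mono) auto
  also have "\<dots> \<le> w0 * \<tau> * (cp r / 1000 + Gam * (bp r + bp s))"
  proof -
    have "(3 / c0) * (2 * cp r + 20 * Gam * (bp r + bp s)) \<le> cp r / 1000 + Gam * (bp r + bp s)"
      using cp_nonneg[of r] mult_nonneg_nonneg[of Gam "bp r + bp s"] Gp bp_nonneg[of r] bp_nonneg[of s]
      by (simp add: c0_def)
    then have "w0 * \<tau> * ((3 / c0) * (2 * cp r + 20 * Gam * (bp r + bp s))) \<le> w0 * \<tau> * (cp r / 1000 + Gam * (bp r + bp s))"
      using w0 tau by (intro mult_left_mono) auto
    then show ?thesis by (simp only: mult.assoc)
  qed
  finally have e2: "(w1 - w0) * (sg * \<rho> + a * bp s) \<le> w0 * \<tau> * (cp r / 1000 + Gam * (bp r + bp s))" .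
  have "w0 * (sg * (\<rho> - fs kk s) + a * (bp s - fs p s)) \<le> w0 * (Psi r - Psi s + \<tau> * (6 * Gam * bp s))"
    using main1 k1 w0 by (intro mult_left_mono) auto
  with L e2 have "(\<Sum>i<m. w (s * m + i) * ((p (s * m + i + 1) - p (s * m + i))
            + (kk (s * m + i + 1) - kk (s * m + i)) + \<tau> / 4 * kk (s * m + i + 1)))
      \<le> w0 * (Psi r - Psi s) + w0 * \<tau> * (6 * Gam * bp s) + w0 * \<tau> * (cp r / 1000 + Gam * (bp r + bp s))"
    by (simp add: algebra_simps)
  also have "\<dots> \<le> w0 * (Psi r - Psi s) + w0 * \<tau> * (8 * Gam * (bp r + bp s) + cp r / 1000)"
  proof -
    have "6 * Gam * bp s + (cp r / 1000 + Gam * (bp r + bp s)) \<le> 8 * Gam * (bp r + bp s) + cp r / 1000"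
      using Gp bp_nonneg[of r] bp_nonneg[of s] mult_nonneg_nonneg[of Gam "bp r"] mult_nonneg_nonneg[of Gam "bp s"]
      by (simp add: algebra_simps)
    then have "w0 * \<tau> * (6 * Gam * bp s + (cp r / 1000 + Gam * (bp r + bp s))) \<le> w0 * \<tau> * (8 * Gam * (bp r + bp s) + cp r / 1000)"
      using w0 tau by (intro mult_left_mono) auto
    then show ?thesis by (simp add: algebra_simps)
  qed
  finally show ?thesis unfolding s_def w0_def \<tau>_def .
qed

end

text \<open>Summation by parts, used to move the slowly growing weights past a telescoping
  sum.\<close>

lemma sum_weighted_telescope:
  fixes w q :: "nat \<Rightarrow> real"
  assumes "a \<le> n"
  shows "(\<Sum>k=a..<n. w k * (q (Suc k) - q k)) = w n * q n - w a * q a - (\<Sum>k=a..<n. (w (Suc k) - w k) * q (Suc k))"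
  using assms by (induction n rule: dec_induct) (simp_all add: algebra_simps)

context small_tau_sequences
begin

text \<open>The weighted dissipation. The last epoch \<open>S - 1\<close> is left out; it is the
  subject of \<open>last_epoch_bound\<close>.\<close>

definition nk :: real where "nk = (\<Sum>s=J..<S-1. \<Sum>i<m. w (s * m + i) * t s * kk (s * m + i + 1))"

definition nb :: real where "nb = (\<Sum>s=J..<S-1. t s * w (s * m) * (bp (s - 1) + bp s + bp (Suc s)))"

text \<open>Collects what the telescoped inequalities leave at their lower end, the start of epoch
  \<open>J\<close>.\<close>

definition bnd :: real where
  "bnd = w (J * m) * (p (J * m) + kk (J * m) + Psi (J - 1) + cp (J - 1))"

lemma w_cp_le: "J \<le> s \<Longrightarrow> s < S \<Longrightarrow> w (s * m) * cp s \<le> (\<Sum>i<m. w (s * m + i) * kk (s * m + i + 1))"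
  unfolding cp_def sum_distrib_left
  by (intro sum_mono mult_right_mono w_within_epoch(2) kk_nonneg) auto

text \<open>Summing \<open>energy_epoch\<close> leaves the dissipation \<open>nk / 4\<close> on the
  left. The growth of the weights and the terms \<open>cp / 1000\<close> return only a few
  thousandths of \<open>nk\<close>, which are absorbed. Besides the boundary terms only gaps remain,
  with the factor \<open>Gam\<close>.\<close>

lemma kinetic_bound: "nk \<le> 8 * bnd + 200 * Gam * nb"
proof -
  define K0 K1 where "K0 = J * m" and "K1 = (S - 1) * m"
  have KK: "K0 \<le> K1" unfolding K0_def K1_def using J_bounds by (intro mult_right_mono) auto
  have K1S: "K1 \<le> m * S" by (simp add: K1_def mult.commute[of m])
  define q where "q k = p k + kk k" for k
  have q: "q k \<ge> 0" for k using p_nonneg kk_nonneg by (simp add: q_def)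
  have Gp: "Gam > 0" using Gam_ge_1 by simp
  have JS: "J \<le> S - 1" using J_bounds by simp
  define np where "np = (\<Sum>s=J..<S-1. \<Sum>i<m. w (s * m + i) * t s * p (s * m + i + 1))"
  have kin_nonneg: "0 \<le> w (s * m + i) * t s * kk (s * m + i + 1)" for s i
    using w_pos step_tau_pos kk_nonneg by (simp add: less_imp_le)
  have tel: "(\<Sum>k=K0..<K1. w k * (q (Suc k) - q k)) \<ge> - w K0 * q K0 - (nk + np) / 1000"
  proof -
    have "(\<Sum>k=K0..<K1. (w (Suc k) - w k) * q (Suc k)) \<le> (\<Sum>k=K0..<K1. w k * tk k / 1000 * q (Suc k))"
    proof (intro sum_mono mult_right_mono q)
      fix k assume "k \<in> {K0..<K1}"
      then have "w (Suc k) \<le> w k * (1 + tk k / 1000)" using K1S by (intro w_Suc) (auto simp: K0_def)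
      then show "w (Suc k) - w k \<le> w k * tk k / 1000" by (simp add: algebra_simps)
    qed
    also have "\<dots> = (\<Sum>s=J..<S-1. \<Sum>i<m. w (s * m + i) * tk (s * m + i) / 1000 * q (Suc (s * m + i)))"
      unfolding K0_def K1_def by (rule sum_epochs[OF JS])
    also have "\<dots> = (nk + np) / 1000"
      unfolding nk_def np_def sum.distrib[symmetric] sum_divide_distrib
      by (intro sum.cong refl) (simp add: tk_def q_def algebra_simps add_divide_distrib)
    finally have "(\<Sum>k=K0..<K1. (w (Suc k) - w k) * q (Suc k)) \<le> (nk + np) / 1000" .
    moreover have "w K1 * q K1 \<ge> 0" using w_pos[of K1] q[of K1] by (simp add: less_imp_le)
    ultimately show ?thesis unfolding sum_weighted_telescope[OF KK] by linarith
  qed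
  have "(\<Sum>k=K0..<K1. w k * (q (Suc k) - q k)) + nk / 4
      = (\<Sum>s=J..<S-1. \<Sum>i<m. w (s * m + i) * ((p (s * m + i + 1) - p (s * m + i))
            + (kk (s * m + i + 1) - kk (s * m + i)) + t s / 4 * kk (s * m + i + 1)))"
    unfolding K0_def K1_def sum_epochs[OF JS] nk_def sum_divide_distrib sum.distrib[symmetric]
    by (intro sum.cong refl) (simp add: q_def algebra_simps)
  also have "\<dots> \<le> (\<Sum>s=J..<S-1. w (s * m) * (Psi (s - 1) - Psi s)
      + w (s * m) * t s * (8 * Gam * (bp (s - 1) + bp s) + cp (s - 1) / 1000))"
  proof (rule sum_mono)
    fix s assume "s \<in> {J..<S-1}"
    moreover from this obtain r where r: "s = Suc r" using J_bounds by (cases s) auto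
    ultimately have "J \<le> Suc r" "Suc r < S" by auto
    then show "(\<Sum>i<m. w (s * m + i) * ((p (s * m + i + 1) - p (s * m + i))
            + (kk (s * m + i + 1) - kk (s * m + i)) + t s / 4 * kk (s * m + i + 1)))
       \<le> w (s * m) * (Psi (s - 1) - Psi s)
      + w (s * m) * t s * (8 * Gam * (bp (s - 1) + bp s) + cp (s - 1) / 1000)"
      unfolding r diff_Suc_1 by (rule energy_epoch)
  qed
  also have "\<dots> = (\<Sum>s=J..<S-1. w (s * m) * (Psi (s - 1) - Psi s))
      + (\<Sum>s=J..<S-1. w (s * m) * t s * (8 * Gam * (bp (s - 1) + bp s)))
      + (\<Sum>s=J..<S-1. w (s * m) * t s * cp (s - 1)) / 1000"
    unfolding sum.distrib[symmetric] sum_divide_distrib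
    by (intro sum.cong refl) (simp add: distrib_left)
  finally have main: "(\<Sum>k=K0..<K1. w k * (q (Suc k) - q k)) + nk / 4 \<le> \<dots>" .
  have b1: "(\<Sum>s=J..<S-1. w (s * m) * t s * (8 * Gam * (bp (s - 1) + bp s))) \<le> 8 * Gam * nb"
    unfolding nb_def sum_distrib_left
  proof (rule sum_mono)
    fix s
    have "0 \<le> 8 * Gam * (t s * w (s * m) * bp (Suc s))"
      using Gp step_tau_pos[of s] w_pos[of "s * m"] bp_nonneg[of "Suc s"] by simp
    then show "w (s * m) * t s * (8 * Gam * (bp (s - 1) + bp s)) \<le> 8 * Gam * (t s * w (s * m) * (bp (s - 1) + bp s + bp (Suc s)))"
      by (simp add: algebra_simps)
  qed
  have wcp: "w (s * m) * t s * cp s \<le> (\<Sum>i<m. w (s * m + i) * t s * kk (s * m + i + 1))" if "J \<le> s" "s < S" for s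
  proof -
    have "t s * (w (s * m) * cp s) \<le> t s * (\<Sum>i<m. w (s * m + i) * kk (s * m + i + 1))"
      using w_cp_le[OF that] step_tau_pos[of s] by (intro mult_left_mono) auto
    then show ?thesis by (simp add: sum_distrib_left mult_ac)
  qed
  \<comment> \<open>The sum is shifted by one epoch: the kinetic terms of epoch \<open>s - 1\<close>
    are charged to the dissipation of that epoch. Epoch \<open>J - 1\<close> has none in
    \<open>nk\<close> and goes into \<open>bnd\<close>.\<close>
  have b2: "(\<Sum>s=J..<S-1. w (s * m) * t s * cp (s - 1)) \<le> bnd + 2 * nk"
  proof -
    have "(\<Sum>s=J..<S-1. w (s * m) * t s * cp (s - 1))
        = w (J * m) * t J * cp (J - 1) + (\<Sum>s=J..<S-2. w (Suc s * m) * t (Suc s) * cp s)"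
    proof -
      have "(\<Sum>s=J..<S-1. w (s * m) * t s * cp (s - 1)) = w (J * m) * t J * cp (J - 1) + (\<Sum>s=Suc J..<S-1. w (s * m) * t s * cp (s - 1))"
        using J_bounds by (intro sum.atLeast_Suc_lessThan) auto
      also have "(\<Sum>s=Suc J..<S-1. w (s * m) * t s * cp (s - 1)) = (\<Sum>s=J..<S-2. w (Suc s * m) * t (Suc s) * cp s)"
      proof -
        have "S - 1 = Suc (S - 2)" using S40 by simp
        then show ?thesis by (simp only: sum.shift_bounds_Suc_ivl diff_Suc_1)
      qed
      finally show ?thesis .
    qed
    also have "\<dots> \<le> w (J * m) * 1 * cp (J - 1) + (\<Sum>s=J..<S-2. 2 * (w (s * m) * t s * cp s))"
    proof (intro add_mono sum_mono)
      show "w (J * m) * t J * cp (J - 1) \<le> w (J * m) * 1 * cp (J - 1)"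
        using step_tau_le_half[of J] w_pos[of "J * m"] cp_nonneg by (intro mult_right_mono mult_left_mono) auto
      fix s assume s: "s \<in> {J..<S-2}"
      have "s < S" using s by auto
      then have "w (Suc s * m) \<le> 2 * w (s * m)" using w_within_epoch(4)[of s m] s by (simp add: add.commute)
      moreover have "t (Suc s) \<le> t s" by (rule step_tau_antimono) simp
      ultimately have "w (Suc s * m) * t (Suc s) \<le> (2 * w (s * m)) * t s"
        using w_pos[of "s * m"] step_tau_pos[of "Suc s"] by (intro mult_mono) auto
      then have "w (Suc s * m) * t (Suc s) * cp s \<le> (2 * w (s * m)) * t s * cp s"
        using cp_nonneg by (intro mult_right_mono)
      then show "w (Suc s * m) * t (Suc s) * cp s \<le> 2 * (w (s * m) * t s * cp s)" by simp
    qed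
    also have "(\<Sum>s=J..<S-2. 2 * (w (s * m) * t s * cp s)) \<le> 2 * nk"
    proof -
      have "(\<Sum>s=J..<S-2. w (s * m) * t s * cp s) \<le> (\<Sum>s=J..<S-2. \<Sum>i<m. w (s * m + i) * t s * kk (s * m + i + 1))"
        by (intro sum_mono wcp) auto
      also have "\<dots> \<le> nk"
        unfolding nk_def
      proof (rule sum_mono2)
        show "{J..<S-2} \<subseteq> {J..<S-1}" by auto
      qed (intro finite_atLeastLessThan sum_nonneg kin_nonneg)+
      finally show ?thesis by (simp add: sum_distrib_left[symmetric])
    qed
    also have "w (J * m) * 1 * cp (J - 1) \<le> bnd"
      unfolding bnd_def using w_pos[of "J * m"] p_nonneg[of "J * m"] kk_nonneg[of "J * m"] Psi_nonneg[of "J - 1"]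
      by (simp add: less_imp_le)
    finally show ?thesis by simp
  qed
  \<comment> \<open>Summation by parts again; \<open>Psi_le\<close> charges the increments of the
    weights to dissipation and gaps.\<close>
  have b3: "(\<Sum>s=J..<S-1. w (s * m) * (Psi (s - 1) - Psi s)) \<le> w K0 * Psi (J - 1) + nk / 1000 + Gam * nb"
  proof -
    have *: "(\<Sum>s=J..<n. w (s * m) * (Psi (s - 1) - Psi s))
        = w K0 * Psi (J - 1) - w (n * m) * Psi (n - 1) + (\<Sum>s=J..<n. (w (Suc s * m) - w (s * m)) * Psi s)"
      if "J \<le> n" for n
      using that
    proof (induction n rule: dec_induct)
      case base
      then show ?case by (simp add: K0_def)
    next
      case (step n)
      have "w (Suc n * m) * Psi (Suc n - 1) = w (n * m) * Psi n + (w (Suc n * m) - w (n * m)) * Psi n"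
        by (simp add: algebra_simps)
      with step show ?case by (simp add: algebra_simps)
    qed
    have "(\<Sum>s=J..<S-1. (w (Suc s * m) - w (s * m)) * Psi s)
        \<le> (\<Sum>s=J..<S-1. (\<Sum>i<m. w (s * m + i) * t s * kk (s * m + i + 1)) / 1000
            + Gam * (t s * w (s * m) * (bp (s - 1) + bp s + bp (Suc s))))"
    proof (rule sum_mono)
      fix s assume s: "s \<in> {J..<S-1}"
      define x where "x = w (s * m) * t s"
      have x: "x \<ge> 0" unfolding x_def using w_pos[of "s * m"] step_tau_pos[of s] by simp
      have "w (Suc s * m) - w (s * m) \<le> w (s * m) * (3 / c0 * (real m * t s / Gam))"
      proof -
        have "s < S" using s by auto
        then have "w (s * m + m) \<le> w (s * m) * (1 + 3 / c0 * (real m * t s / Gam))"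
          using w_within_epoch(1)[of s m] s by simp
        then show ?thesis by (simp add: algebra_simps)
      qed
      then have "(w (Suc s * m) - w (s * m)) * Psi s \<le> w (s * m) * (3 / c0 * (real m * t s / Gam)) * Psi s"
        using Psi_nonneg by (intro mult_right_mono)
      also have "\<dots> = x * (3 / c0 * (real m / Gam * Psi s))" by (simp add: x_def)
      also have "\<dots> \<le> x * (cp s / 1000 + Gam * (bp (s - 1) + bp s + bp (Suc s)))"
      proof (rule mult_left_mono[OF _ x])
        have "3 / c0 * (real m / Gam * Psi s) \<le> 3 / c0 * (2 * cp s + 10 * Gam * (bp s + bp (Suc s)))"
          using Psi_le c0_pos by (intro mult_left_mono) auto
        also have "\<dots> = 6 / 100000 * cp s + 30 / 100000 * (Gam * bp s) + 30 / 100000 * (Gam * bp (Suc s))"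
          by (simp add: c0_def algebra_simps)
        also have "\<dots> \<le> cp s / 1000 + Gam * (bp (s - 1) + bp s + bp (Suc s))"
          using cp_nonneg[of s] mult_nonneg_nonneg[OF less_imp_le[OF Gp] bp_nonneg, of "s - 1"]
            mult_nonneg_nonneg[OF less_imp_le[OF Gp] bp_nonneg, of s]
            mult_nonneg_nonneg[OF less_imp_le[OF Gp] bp_nonneg, of "Suc s"]
          unfolding distrib_left by linarith
        finally show "3 / c0 * (real m / Gam * Psi s) \<le> cp s / 1000 + Gam * (bp (s - 1) + bp s + bp (Suc s))" .
      qed
      also have "\<dots> = (w (s * m) * t s * cp s) / 1000 + Gam * (t s * w (s * m) * (bp (s - 1) + bp s + bp (Suc s)))"
        by (simp add: x_def distrib_left)
      also have "\<dots> \<le> (\<Sum>i<m. w (s * m + i) * t s * kk (s * m + i + 1)) / 1000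
            + Gam * (t s * w (s * m) * (bp (s - 1) + bp s + bp (Suc s)))"
        using wcp[of s] s by auto
      finally show "(w (Suc s * m) - w (s * m)) * Psi s \<le> (\<Sum>i<m. w (s * m + i) * t s * kk (s * m + i + 1)) / 1000
            + Gam * (t s * w (s * m) * (bp (s - 1) + bp s + bp (Suc s)))" .
    qed
    also have "\<dots> = nk / 1000 + Gam * nb"
      unfolding nk_def nb_def by (simp only: sum.distrib sum_divide_distrib sum_distrib_left)
    finally have "(\<Sum>s=J..<S-1. (w (Suc s * m) - w (s * m)) * Psi s) \<le> nk / 1000 + Gam * nb" .
    moreover have "0 \<le> w ((S - 1) * m) * Psi (S - 1 - 1)"
      using w_pos[of "(S - 1) * m"] Psi_nonneg[of "S - 1 - 1"] by (intro mult_nonneg_nonneg) auto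
    ultimately show ?thesis unfolding *[OF JS] by linarith
  qed
  have b4: "np \<le> 2 * nb"
    unfolding np_def nb_def sum_distrib_left
  proof (rule sum_mono)
    fix s assume s: "s \<in> {J..<S-1}"
    have "(\<Sum>i<m. w (s * m + i) * t s * p (s * m + i + 1)) \<le> (\<Sum>i<m. 2 * w (s * m) * t s * p (s * m + i + 1))"
    proof (intro sum_mono mult_right_mono p_nonneg)
      fix i assume "i \<in> {..<m}"
      then show "w (s * m + i) \<le> 2 * w (s * m)" using w_within_epoch(4)[of s i] s by auto
    qed (simp add: step_tau_pos less_imp_le)
    also have "\<dots> = 2 * w (s * m) * t s * bp (Suc s)" by (simp add: bp_Suc sum_distrib_left)
    also have "\<dots> \<le> 2 * w (s * m) * t s * (bp (s - 1) + bp s + bp (Suc s))"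
      using w_pos[of "s * m"] step_tau_pos[of s] bp_nonneg[of s] bp_nonneg[of "s - 1"] by (intro mult_left_mono) auto
    finally show "(\<Sum>i<m. w (s * m + i) * t s * p (s * m + i + 1)) \<le> 2 * (t s * w (s * m) * (bp (s - 1) + bp s + bp (Suc s)))"
      by (simp add: mult_ac)
  qed
  have nb0: "nb \<ge> 0"
    unfolding nb_def using w_pos step_tau_pos bp_nonneg by (intro sum_nonneg mult_nonneg_nonneg add_nonneg_nonneg) (auto simp: less_imp_le)
  have Gnb: "nb \<le> Gam * nb" using mult_right_mono[OF Gam_ge_1 nb0] by simp
  have nk0: "nk \<ge> 0" unfolding nk_def by (intro sum_nonneg kin_nonneg)
  have wq: "w K0 * q K0 + w K0 * Psi (J - 1) \<le> bnd"
    unfolding bnd_def q_def K0_def using w_pos[of "J * m"] mult_nonneg_nonneg[OF less_imp_le cp_nonneg, of "w (J * m)" "J - 1"]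
    by (simp add: algebra_simps)
  have bnd0: "bnd \<ge> 0"
    unfolding bnd_def using w_pos[of "J * m"] p_nonneg[of "J * m"] kk_nonneg[of "J * m"] Psi_nonneg[of "J - 1"] cp_nonneg[of "J - 1"]
    by simp
  define z1 z2 z3 z4 z5 z6 z7 where "z1 = (\<Sum>k=K0..<K1. w k * (q (Suc k) - q k))"
    and "z2 = (\<Sum>s=J..<S-1. w (s * m) * (Psi (s - 1) - Psi s))"
    and "z3 = (\<Sum>s=J..<S-1. w (s * m) * t s * (8 * Gam * (bp (s - 1) + bp s)))"
    and "z4 = (\<Sum>s=J..<S-1. w (s * m) * t s * cp (s - 1))"
    and "z5 = w K0 * q K0" and "z6 = Gam * nb" and "z7 = w K0 * Psi (J - 1)"
  have "nb \<le> z6" using Gnb unfolding z6_def .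
  have "z1 + nk / 4 \<le> z2 + z3 + z4 / 1000" using main unfolding z1_def z2_def z3_def z4_def .
  moreover have "- z5 - (nk + np) / 1000 \<le> z1" using tel unfolding z1_def z5_def by simp
  moreover have "z3 \<le> 8 * z6" using b1 unfolding z3_def z6_def by (simp only: mult.assoc)
  moreover have "z4 \<le> bnd + 2 * nk" using b2 unfolding z4_def .
  moreover have "z2 \<le> z7 + nk / 1000 + z6" using b3 unfolding z2_def z6_def z7_def .
  moreover have "z5 + z7 \<le> bnd" using wq unfolding z5_def z7_def .
  ultimately have "nk / 4 \<le> 1001 / 1000 * bnd + 4 / 1000 * nk + 9 * z6 + 2 / 1000 * nb" using b4 by argo
  then have "nk \<le> 8 * bnd + 200 * z6" using nb0 nk0 bnd0 \<open>nb \<le> z6\<close> by argo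
  then show ?thesis unfolding z6_def by (simp only: mult.assoc)
qed

definition yb :: "nat \<Rightarrow> real" where "yb s = t s * w (s * m) * bp (Suc s)"

definition np :: real where "np = (\<Sum>k=J*m..(S-1)*m. w k * (tk k * p k))"

lemma yb_nonneg: "yb s \<ge> 0"
  unfolding yb_def using step_tau_pos[of s] w_pos[of "s * m"] bp_nonneg[of "Suc s"] by simp

lemma yb_prev:
  assumes "J \<le> Suc s + 1" "Suc s < S" "x \<ge> 0"
  shows "t (Suc s) * w (Suc s * m) * x \<le> 2 * (t s * w (s * m) * x)"
proof -
  have "w (Suc s * m) \<le> 2 * w (s * m)" using w_within_epoch(4)[of s m] assms by (simp add: add.commute)
  moreover have "t (Suc s) \<le> t s" by (rule step_tau_antimono) simp
  ultimately have "t (Suc s) * w (Suc s * m) \<le> t s * (2 * w (s * m))"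
    using step_tau_pos[of s] w_pos[of "Suc s * m"] by (intro mult_mono) auto
  then have "t (Suc s) * w (Suc s * m) * x \<le> t s * (2 * w (s * m)) * x"
    using assms(3) by (intro mult_right_mono)
  then show ?thesis by simp
qed

text \<open>Moving a weight by one epoch costs a factor 2, so the three neighbouring epochs in
  \<open>nb\<close> count 4 + 2 + 1 = 7 times, and the two epochs before \<open>J\<close> remain as
  boundary terms. Returning to the steps of the single iterates costs 11/5, and 7 * 11/5 is below
  16.\<close>

lemma nb_bound: "nb \<le> 16 * np + 7 * (yb (J - 2) + yb (J - 1))"
proof -
  have J: "J = Suc (Suc (J - 2))" "J - 1 = Suc (J - 2)" using J_bounds by auto
  have SS: "S - 1 = Suc (Suc (S - 3))" using S40 by simp
  have "nb \<le> (\<Sum>s=J..<S-1. 4 * yb (s - 2) + 2 * yb (s - 1) + yb s)"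
    unfolding nb_def
  proof (rule sum_mono)
    fix s assume s: "s \<in> {J..<S-1}"
    define r where "r = s - 2"
    have sr: "s = Suc (Suc r)" using s J_bounds by (auto simp: r_def)
    have Jr: "J \<le> Suc (Suc r)" "Suc (Suc r) < S" using s sr by auto
    have "t s * w (s * m) * bp s \<le> 2 * yb (s - 1)"
      using yb_prev[of "Suc r" "bp s"] Jr bp_nonneg unfolding yb_def sr by simp
    moreover have "t s * w (s * m) * bp (s - 1) \<le> 4 * yb (s - 2)"
      using yb_prev[of "Suc r" "bp (Suc r)"] yb_prev[of r "bp (Suc r)"] Jr bp_nonneg[of "Suc r"]
      unfolding yb_def sr by simp
    ultimately show "t s * w (s * m) * (bp (s - 1) + bp s + bp (Suc s)) \<le> 4 * yb (s - 2) + 2 * yb (s - 1) + yb s"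
      unfolding distrib_left yb_def[of s] by linarith
  qed
  also have "\<dots> = 4 * (\<Sum>s=J..<S-1. yb (s - 2)) + 2 * (\<Sum>s=J..<S-1. yb (s - 1)) + (\<Sum>s=J..<S-1. yb s)"
    by (simp add: sum.distrib sum_distrib_left)
  also have "\<dots> \<le> 7 * (\<Sum>s=J-2..<S-1. yb s)"
  proof -
    have "(\<Sum>s=J..<S-1. yb (s - 2)) = (\<Sum>s=J-2..<S-3. yb s)"
      by (subst J(1), subst SS, subst sum.shift_bounds_Suc_ivl, subst sum.shift_bounds_Suc_ivl) simp
    also have "\<dots> \<le> (\<Sum>s=J-2..<S-1. yb s)" by (rule sum_mono2) (auto simp: yb_nonneg)
    finally have 1: "(\<Sum>s=J..<S-1. yb (s - 2)) \<le> (\<Sum>s=J-2..<S-1. yb s)" .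
    have "(\<Sum>s=J..<S-1. yb (s - 1)) = (\<Sum>s=Suc (J-2)..<Suc (S-3). yb s)"
      by (subst J(1), subst SS, subst sum.shift_bounds_Suc_ivl) simp
    also have "\<dots> \<le> (\<Sum>s=J-2..<S-1. yb s)" by (rule sum_mono2) (auto simp: yb_nonneg)
    finally have 2: "(\<Sum>s=J..<S-1. yb (s - 1)) \<le> (\<Sum>s=J-2..<S-1. yb s)" .
    have 3: "(\<Sum>s=J..<S-1. yb s) \<le> (\<Sum>s=J-2..<S-1. yb s)" by (rule sum_mono2) (auto simp: yb_nonneg)
    from 1 2 3 show ?thesis by linarith
  qed
  also have "(\<Sum>s=J-2..<S-1. yb s) = yb (J - 2) + yb (J - 1) + (\<Sum>s=J..<S-1. yb s)"
  proof -
    have "(\<Sum>s=J-2..<S-1. yb s) = yb (J - 2) + (\<Sum>s=Suc (J - 2)..<S-1. yb s)"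
      using J_bounds by (intro sum.atLeast_Suc_lessThan) auto
    also have "(\<Sum>s=Suc (J - 2)..<S-1. yb s) = yb (Suc (J - 2)) + (\<Sum>s=Suc (Suc (J - 2))..<S-1. yb s)"
      using J_bounds by (intro sum.atLeast_Suc_lessThan) auto
    finally show ?thesis using J by simp
  qed
  also have "(\<Sum>s=J..<S-1. yb s) \<le> 11 / 5 * np"
  proof -
    define f where "f k = w k * (tk k * p k)" for k
    have f: "f k \<ge> 0" for k unfolding f_def using w_pos[of k] tk_pos[of k] p_nonneg[of k] by simp
    have JS: "J \<le> S - 1" using J_bounds by simp
    have "(\<Sum>s=J..<S-1. yb s) \<le> (\<Sum>s=J..<S-1. \<Sum>i<m. 11 / 5 * f (Suc (s * m + i)))"
    proof (rule sum_mono)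
      fix s assume s: "s \<in> {J..<S-1}"
      have "yb s = (\<Sum>i<m. t s * w (s * m) * p (Suc (s * m + i)))"
        unfolding yb_def bp_Suc by (simp add: sum_distrib_left)
      also have "\<dots> \<le> (\<Sum>i<m. (11 / 5 * tk (Suc (s * m + i))) * w (Suc (s * m + i)) * p (Suc (s * m + i)))"
      proof (intro sum_mono mult_right_mono p_nonneg mult_mono)
        fix i assume i: "i \<in> {..<m}"
        have "Suc (s * m + i) \<le> Suc s * m" using i by simp
        also have "\<dots> \<le> (S - 1) * m" using s by (intro mult_right_mono) auto
        finally have k: "Suc (s * m + i) \<le> (S - 1) * m" .
        have "Suc (s * m + i) div m \<le> ((S - 1) * m) div m" by (rule div_le_mono[OF k])
        then have "Suc (s * m + i) div m < S" using S m by simp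
        then show "t s \<le> 11 / 5 * tk (Suc (s * m + i))" unfolding tk_def using s by (intro t_ratio) auto
        show "w (s * m) \<le> w (Suc (s * m + i))"
          using w_within_epoch(2)[of s "Suc i"] s i by auto
      qed (use tk_pos w_pos in \<open>auto simp: less_imp_le\<close>)
      also have "\<dots> = (\<Sum>i<m. 11 / 5 * f (Suc (s * m + i)))" by (simp add: f_def mult_ac)
      finally show "yb s \<le> (\<Sum>i<m. 11 / 5 * f (Suc (s * m + i)))" .
    qed
    also have "\<dots> = 11 / 5 * (\<Sum>k=J*m..<(S-1)*m. f (Suc k))"
      unfolding sum_epochs[OF JS] by (simp add: sum_distrib_left)
    also have "(\<Sum>k=J*m..<(S-1)*m. f (Suc k)) = (\<Sum>k=Suc (J*m)..<Suc ((S-1)*m). f k)"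
      by (rule sum.shift_bounds_Suc_ivl[symmetric])
    also have "\<dots> \<le> np"
      unfolding np_def f_def[symmetric] by (rule sum_mono2) (auto simp: f)
    finally show ?thesis by simp
  qed
  finally have "nb \<le> 7 * (yb (J - 2) + yb (J - 1) + 11 / 5 * np)" by simp
  moreover have "np \<ge> 0" unfolding np_def
    using w_pos tk_pos p_nonneg by (intro sum_nonneg mult_nonneg_nonneg) (auto simp: less_imp_le)
  ultimately show ?thesis by argo
qed

text \<open>The total error of the suffix averages in \<open>last_epoch_bound\<close>: using y_i as
  comparison point costs \<open>kk i + t2 * pot i\<close>.\<close>

lemma step_sum_bound:
  "(\<Sum>i=J*m..<(S-1)*m. w i * tk i * (kk i + t2 * pot i)) \<le> 17 * bnd + 402 * Gam * nb"
proof -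
  define K0 K1 where "K0 = J * m" and "K1 = (S - 1) * m"
  have JS: "J \<le> S - 1" using J_bounds by simp
  have KK: "K0 < K1" unfolding K0_def K1_def using J_bounds m by (intro mult_strict_right_mono) auto
  have K1S: "K1 \<le> m * S" by (simp add: K1_def mult.commute[of m])
  define f where "f k = w k * tk k * kk k" for k
  have f: "f k \<ge> 0" for k unfolding f_def using w_pos[of k] tk_pos[of k] kk_nonneg[of k] by simp
  have f0: "f K0 \<le> bnd"
  proof -
    have "f K0 \<le> w K0 * 1 * kk K0" unfolding f_def
      using w_pos[of K0] kk_nonneg[of K0] step_tau_le_half[of J] tk_epoch0[of J]
      by (intro mult_right_mono mult_left_mono) (auto simp: K0_def)
    also have "\<dots> \<le> bnd" unfolding bnd_def K0_def
      using w_pos[of "J * m"] p_nonneg[of "J * m"] Psi_nonneg[of "J - 1"] cp_nonneg[of "J - 1"] by simp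
    finally show ?thesis .
  qed
  have "(\<Sum>i=K0..<K1. f i) \<le> f K0 + (\<Sum>i=K0..<K1. f (Suc i))"
  proof -
    have "(\<Sum>i=K0..<K1. f i) \<le> (\<Sum>i=K0..<Suc K1. f i)" by (rule sum_mono2) (auto simp: f)
    also have "\<dots> = f K0 + (\<Sum>i=Suc K0..<Suc K1. f i)" using KK by (intro sum.atLeast_Suc_lessThan) auto
    finally show ?thesis by (simp only: sum.shift_bounds_Suc_ivl)
  qed
  also have "(\<Sum>i=K0..<K1. f (Suc i)) \<le> (\<Sum>i=K0..<K1. 2 * (w i * tk i * kk (Suc i)))"
  proof (rule sum_mono)
    fix i assume i: "i \<in> {K0..<K1}"
    have "w (Suc i) \<le> 2 * w i" using i K1S by (intro w_Suc(2)) (auto simp: K0_def)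
    then have "w (Suc i) * tk (Suc i) \<le> (2 * w i) * tk i"
      using tk_antimono[of i "Suc i"] tk_pos[of "Suc i"] w_pos[of i] by (intro mult_mono) auto
    then have "w (Suc i) * tk (Suc i) * kk (Suc i) \<le> (2 * w i) * tk i * kk (Suc i)"
      using kk_nonneg by (intro mult_right_mono)
    then show "f (Suc i) \<le> 2 * (w i * tk i * kk (Suc i))" by (simp add: f_def)
  qed
  also have "\<dots> = 2 * nk"
    unfolding K0_def K1_def sum_epochs[OF JS] nk_def sum_distrib_left
    by (intro sum.cong refl) (simp add: tk_def)
  finally have A: "(\<Sum>i=K0..<K1. f i) \<le> bnd + 2 * nk" using f0 by simp
  have "(\<Sum>i=K0..<K1. w i * tk i * (t2 * pot i)) = (\<Sum>s=J..<S-1. \<Sum>i<m. w (s * m + i) * t s * (t2 * pot (s * m + i)))"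
    unfolding K0_def K1_def sum_epochs[OF JS] by (intro sum.cong refl) (simp add: tk_def)
  also have "\<dots> \<le> (\<Sum>s=J..<S-1. 2 * Gam * (t s * w (s * m) * (bp (s - 1) + bp s + bp (Suc s))))"
  proof (rule sum_mono)
    fix s assume s: "s \<in> {J..<S-1}"
    have "(\<Sum>i<m. w (s * m + i) * t s * (t2 * pot (s * m + i))) \<le> (\<Sum>i<m. (2 * w (s * m)) * t s * (t2 * (bp s + bp (Suc s))))"
    proof (intro sum_mono mult_mono)
      fix i assume i: "i \<in> {..<m}"
      show "w (s * m + i) \<le> 2 * w (s * m)" using w_within_epoch(4)[of s i] s i by auto
      show "pot (s * m + i) \<le> bp s + bp (Suc s)" using i by (intro pot_le) auto
    qed (use t2_nonneg w_pos step_tau_pos pot_nonneg in \<open>auto simp: less_imp_le\<close>)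
    also have "\<dots> = 2 * (real m * t2) * (t s * w (s * m) * (bp s + bp (Suc s)))" by (simp add: mult_ac)
    also have "\<dots> \<le> 2 * Gam * (t s * w (s * m) * (bp (s - 1) + bp s + bp (Suc s)))"
    proof (rule mult_mono)
      show "2 * (real m * t2) \<le> 2 * Gam" using mt2_le_Gam by simp
      show "t s * w (s * m) * (bp s + bp (Suc s)) \<le> t s * w (s * m) * (bp (s - 1) + bp s + bp (Suc s))"
        using step_tau_pos[of s] w_pos[of "s * m"] bp_nonneg[of "s - 1"] by (intro mult_left_mono) auto
      show "0 \<le> 2 * Gam" using Gam_ge_1 by simp
      show "0 \<le> t s * w (s * m) * (bp s + bp (Suc s))"
        using step_tau_pos[of s] w_pos[of "s * m"] bp_nonneg by (intro mult_nonneg_nonneg add_nonneg_nonneg) auto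
    qed
    finally show "(\<Sum>i<m. w (s * m + i) * t s * (t2 * pot (s * m + i)))
        \<le> 2 * Gam * (t s * w (s * m) * (bp (s - 1) + bp s + bp (Suc s)))" .
  qed
  also have "\<dots> = 2 * Gam * nb" unfolding nb_def sum_distrib_left ..
  finally have B: "(\<Sum>i=K0..<K1. w i * tk i * (t2 * pot i)) \<le> 2 * Gam * nb" .
  have "(\<Sum>i=K0..<K1. w i * tk i * (kk i + t2 * pot i)) = (\<Sum>i=K0..<K1. f i) + (\<Sum>i=K0..<K1. w i * tk i * (t2 * pot i))"
    by (simp add: f_def sum.distrib[symmetric] distrib_left)
  then show ?thesis using A B kinetic_bound unfolding K0_def K1_def by linarith
qed

section \<open>Sizes in the second half of the run\<close>

lemma t_sq_unit: "J \<le> s + 2 \<Longrightarrow> (t s)\<^sup>2 * scl \<le> 16 * unit"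
proof -
  assume "J \<le> s + 2"
  then have "(t s)\<^sup>2 \<le> eta\<^sup>2" using t_le_eta[of s] step_tau_pos[of s] by (intro power_mono) auto
  then have "(t s)\<^sup>2 * scl \<le> eta\<^sup>2 * scl" using scl_nonneg by (intro mult_right_mono)
  then show ?thesis by (simp add: eta_def unit_def power_divide)
qed

lemma p_unit: "J \<le> s + 2 \<Longrightarrow> s < S \<Longrightarrow> n \<le> m \<Longrightarrow> n \<ge> 1 \<Longrightarrow> p (s * m + n) \<le> 64 * unit"
  using p_le[of s n] t_sq_unit[of s] by simp

lemma gam_bp_unit: "J \<le> s + 2 \<Longrightarrow> s < S \<Longrightarrow> (t s + t2) * bp (Suc s) \<le> 64 * unit"
  using gam_bp_le[of s] t_sq_unit[of s] by simp

lemma t2_bp_unit: "J \<le> s + 2 \<Longrightarrow> s < S \<Longrightarrow> t2 * bp (Suc s) \<le> 64 * unit"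
  using gam_bp_unit[of s] mult_nonneg_nonneg[OF less_imp_le[OF step_tau_pos] bp_nonneg, of s "Suc s"]
  by (simp add: algebra_simps)

lemma t_bp_unit: "J \<le> s + 2 \<Longrightarrow> s < S \<Longrightarrow> t s * bp (Suc s) \<le> 64 * unit"
  using gam_bp_unit[of s] mult_nonneg_nonneg[OF t2_nonneg bp_nonneg, of "Suc s"] by (simp add: algebra_simps)

lemma kk_unit: "(J - 1) * m \<le> k \<Longrightarrow> k \<le> m * S \<Longrightarrow> kk k \<le> 2048 * unit"
proof -
  assume k: "(J - 1) * m \<le> k" "k \<le> m * S"
  have "tk k \<le> t (J - 1)" using tk_antimono[OF k(1)] tk_epoch0 by simp
  then have "(tk k)\<^sup>2 * G k k \<le> (t (J - 1))\<^sup>2 * (128 * scl)"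
    using tk_pos[of k] G_nonneg[of k k] G_diag_le[OF k(2)] by (intro mult_mono power_mono) auto
  moreover have "(t (J - 1))\<^sup>2 * scl \<le> 16 * unit" by (rule t_sq_unit) simp
  ultimately show ?thesis unfolding kk_def by linarith
qed

text \<open>The surplus kept in \<open>Phi_decrease\<close> controls the interior of all epochs, and
  \<open>p_unit\<close> the first gap of each epoch. Either part contributes
  \<open>256 * unit\<close>.\<close>

lemma epoch_sum_bound: "(\<Sum>s=J..<S. t s * fs p s) \<le> 512 * unit"
proof -
  have "(\<Sum>s=J..<S. t s * fs p s) \<le> (\<Sum>s=J..<S. eta * (64 * unit) + 64 / (real S)\<^sup>2 * ((real s + 4) / 8 * (bp (Suc s) - p (Suc s * m))))"
  proof (rule sum_mono)
    fix s assume s: "s \<in> {J..<S}"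
    then obtain r where r: "s = Suc r" using J_bounds by (cases s) auto
    have "p (r * m + m) \<le> 64 * unit" using s r m by (intro p_unit) auto
    then have "t s * p (s * m) \<le> eta * (64 * unit)"
      using t_le_eta[of s] s r p_nonneg[of "s * m"] eta_pos by (intro mult_mono) (auto simp: add.commute)
    moreover have "t s * fz p s \<le> 64 / (real S)\<^sup>2 * ((real s + 4) / 8 * fz p s)"
    proof -
      have "real S \<le> 2 * (real s + 4)" using s J_bounds by auto
      then have "(real S)\<^sup>2 \<le> (2 * (real s + 4))\<^sup>2" by (intro power_mono) auto
      then have "2 / (real s + 4) \<le> 64 / (real S)\<^sup>2 * ((real s + 4) / 8)"
        using S40 by (simp add: field_simps power2_eq_square)
      then have "t s * fz p s \<le> 64 / (real S)\<^sup>2 * ((real s + 4) / 8) * fz p s"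
        unfolding step_tau_def by (intro mult_right_mono fz_nonneg p_nonneg)
      then show ?thesis by (simp only: mult.assoc)
    qed
    moreover have "fs p s = p (s * m) + fz p s" by (simp add: fz_def)
    moreover have "fz p s = bp (Suc s) - p (Suc s * m)" using bp_Suc_fz[of s] by simp
    ultimately show "t s * fs p s \<le> eta * (64 * unit) + 64 / (real S)\<^sup>2 * ((real s + 4) / 8 * (bp (Suc s) - p (Suc s * m)))"
      by (simp add: distrib_left)
  qed
  also have "\<dots> = real (S - J) * (eta * (64 * unit)) + 64 / (real S)\<^sup>2 * (\<Sum>s=J..<S. (real s + 4) / 8 * (bp (Suc s) - p (Suc s * m)))"
    by (simp add: sum.distrib sum_distrib_left)
  also have "\<dots> \<le> real S * (eta * (64 * unit)) + 64 / (real S)\<^sup>2 * (4 * scl)"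
  proof (intro add_mono mult_left_mono mult_right_mono)
    have "(\<Sum>s=J..<S. (real s + 4) / 8 * (bp (Suc s) - p (Suc s * m))) \<le> (\<Sum>s<S. (real s + 4) / 8 * (bp (Suc s) - p (Suc s * m)))"
    proof (rule sum_mono2)
      fix s
      show "0 \<le> (real s + 4) / 8 * (bp (Suc s) - p (Suc s * m))"
        using p_last_le_bp[of s] by (intro mult_nonneg_nonneg) auto
    qed auto
    moreover have "Phi S \<ge> 0"
      unfolding Phi_def using gam_le_1[of S] p_nonneg t2_nonneg bp_nonneg R_nonneg
      by (intro add_nonneg_nonneg divide_nonneg_nonneg mult_nonneg_nonneg) auto
    ultimately show "(\<Sum>s=J..<S. (real s + 4) / 8 * (bp (Suc s) - p (Suc s * m))) \<le> 4 * scl"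
      using Phi_sum[of S] Phi_0 by simp
  qed (use eta_pos unit_nonneg in auto)
  also have "\<dots> = 512 * unit" using S40 by (simp add: eta_def unit_def)
  finally show ?thesis .
qed

text \<open>About \<open>S / 2\<close> epochs remain, each with \<open>m\<close> steps of size about
  \<open>2 / S\<close>, so the mass left is of order \<open>m\<close> for every value of
  \<open>Gam\<close>.\<close>

lemma That_J: "That (J * m) \<ge> real m / 2"
proof -
  have "(\<Sum>i=J*m..<m*S. t (S - 1)) \<le> (\<Sum>i=J*m..<m*S. tk i)"
  proof (rule sum_mono)
    fix i assume "i \<in> {J*m..<m*S}"
    then have "i div m < S" by (simp add: less_mult_imp_div_less mult.commute)
    then show "t (S - 1) \<le> tk i" unfolding tk_def by (intro step_tau_antimono) auto
  qed
  moreover have "(\<Sum>i=J*m..<m*S. t (S - 1)) = real m * (real (S - J) * t (S - 1))"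
  proof -
    have "m * S - J * m = m * (S - J)" by (simp add: diff_mult_distrib2 mult.commute)
    then show ?thesis by simp
  qed
  moreover have "real m * (1 / 2) \<le> real m * (real (S - J) * t (S - 1))"
  proof (rule mult_left_mono)
    have "real (S - J) \<ge> real S / 2" using J_bounds by auto
    moreover have "t (S - 1) = 2 / (real S + 3)" using S by (simp add: step_tau_def)
    ultimately have "real S / 2 * (2 / (real S + 3)) \<le> real (S - J) * t (S - 1)"
      by (intro mult_mono) auto
    moreover have "1 / 2 \<le> real S / 2 * (2 / (real S + 3))" using S40 by (simp add: field_simps)
    ultimately show "1 / 2 \<le> real (S - J) * t (S - 1)" by linarith
  qed simp
  moreover have "c0 * Gam \<ge> 0" using c0_pos Gam_ge_1 by simp
  ultimately show ?thesis unfolding That_def by linarith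
qed

lemma w_J: "w (J * m) \<le> 4 / (real m)\<^sup>2"
proof -
  have "(real m / 2)\<^sup>2 \<le> (That (J * m))\<^sup>2" using That_J m_pos by (intro power_mono) auto
  then have "1 / (That (J * m))\<^sup>2 \<le> 1 / (real m / 2)\<^sup>2" using m_pos That_pos[of "J * m"] by (intro divide_left_mono mult_pos_pos zero_less_power) auto
  then show ?thesis by (simp add: w_def power_divide)
qed

lemma bnd_unit: "bnd \<le> 30000 * unit / real m"
proof -
  have J: "Suc (J - 1) = J" "Suc (J - 2) = J - 1" "J - 1 < S" "J - 2 < S" "J \<le> (J - 1) + 2" "J \<le> (J - 2) + 2" "J < S"
    using J_bounds by auto
  have u: "unit \<ge> 0" by (rule unit_nonneg)
  have m1: "1 \<le> real m" using m by simp
  have p1: "p (J * m) \<le> 64 * unit"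
  proof -
    have "(J - 1) * m + m = J * m" using J(1) by (metis add.commute mult_Suc)
    then show ?thesis using p_unit[of "J - 1" m] J m by simp
  qed
  have JS: "J * m \<le> m * S" using J(7) by (simp add: mult.commute)
  have k1: "kk (J * m) \<le> 2048 * unit" using JS by (intro kk_unit) auto
  have c1: "cp (J - 1) \<le> real m * (2048 * unit)"
  proof -
    have "cp (J - 1) \<le> (\<Sum>i<m. 2048 * unit)" unfolding cp_def
    proof (intro sum_mono kk_unit)
      fix i assume "i \<in> {..<m}"
      then show "(J - 1) * m + i + 1 \<le> m * S" using idx_less[OF J(3), of i] by simp
    qed auto
    then show ?thesis by simp
  qed
  have bJ: "t2 * bp J \<le> 64 * unit" and bJ1: "t2 * bp (J - 1) \<le> 64 * unit"
    using t2_bp_unit[of "J - 1"] t2_bp_unit[of "J - 2"] J by simp_all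
  have "Psi (J - 1) \<le> cp (J - 1) + 3 * (t2 * bp J) + real m * (t2 * bp (J - 1) + t2 * bp J)"
  proof -
    have "sg * fz kk (J - 1) \<le> 1 * cp (J - 1)"
      using sg_bounds kk_nonneg by (intro mult_mono) (auto simp: cp_eq intro: fz_nonneg)
    moreover have "(sg + t2) * fz p (J - 1) \<le> (3 * t2) * bp J"
      using sg_bounds t2_nonneg fz_p_le[of "J - 1"] J p_nonneg by (intro mult_mono) (auto intro: fz_nonneg)
    moreover have "sg * t2 * fz pot (J - 1) \<le> 1 * t2 * (real m * (bp (J - 1) + bp J))"
      using sg_bounds t2_nonneg fz_pot_le[of "J - 1"] J pot_nonneg by (intro mult_mono) (auto intro: fz_nonneg)
    ultimately show ?thesis unfolding Psi_def by (simp add: algebra_simps)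
  qed
  also have "\<dots> \<le> real m * (2048 * unit) + 3 * (64 * unit) + real m * (64 * unit + 64 * unit)"
    using c1 bJ bJ1 by (intro add_mono mult_left_mono) auto
  finally have P1: "Psi (J - 1) \<le> real m * (2176 * unit) + 192 * unit" by (simp add: algebra_simps)
  have "p (J * m) + kk (J * m) + Psi (J - 1) + cp (J - 1) \<le> 2304 * unit + real m * (4224 * unit)"
    using p1 k1 P1 c1 by (simp add: algebra_simps)
  also have "\<dots> \<le> real m * (7000 * unit)"
  proof -
    have "1 * unit \<le> real m * unit" using m1 u by (intro mult_right_mono)
    then show ?thesis using u by (simp add: algebra_simps)
  qed
  finally have "bnd \<le> 4 / (real m)\<^sup>2 * (real m * (7000 * unit))"
    unfolding bnd_def using w_J w_pos[of "J * m"] p_nonneg kk_nonneg Psi_nonneg cp_nonneg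
    by (intro mult_mono) (auto intro!: add_nonneg_nonneg)
  also have "\<dots> = 28000 * unit / real m" using m_pos by (simp add: power2_eq_square)
  also have "\<dots> \<le> 30000 * unit / real m" using u by (intro divide_right_mono) auto
  finally show ?thesis .
qed

lemma yb_unit: "Gam * (yb (J - 2) + yb (J - 1)) \<le> 1024 * unit / real m"
proof -
  have *: "yb s \<le> 256 * unit / (real m)\<^sup>2" if "J \<le> s + 2" "s \<le> J" for s
  proof -
    have "s < S" using that J_bounds by simp
    have JS: "J * m \<le> m * S" using J_bounds by (simp add: mult.commute)
    have "w (s * m) \<le> w (J * m)" using that JS by (intro w_mono) auto
    also note w_J
    finally have "(t s * bp (Suc s)) * w (s * m) \<le> (64 * unit) * (4 / (real m)\<^sup>2)"
      using t_bp_unit[OF that(1) \<open>s < S\<close>] w_pos[of "s * m"] unit_nonneg by (intro mult_mono[of "t s * bp (Suc s)"]) auto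
    then show ?thesis by (simp add: yb_def mult_ac)
  qed
  have "Gam * (yb (J - 2) + yb (J - 1)) \<le> (2 * real m) * (256 * unit / (real m)\<^sup>2 + 256 * unit / (real m)\<^sup>2)"
    using Gam_le *[of "J - 2"] *[of "J - 1"] yb_nonneg by (intro mult_mono add_mono) (auto intro: add_nonneg_nonneg)
  also have "\<dots> = 1024 * unit / real m" using m_pos by (simp add: power2_eq_square field_simps)
  finally show ?thesis .
qed

text \<open>Comparison with y_i from \<open>i\<close> on gives
  \<open>U i + F \<le> X + That i * p i\<close>, so up to the error \<open>X\<close> the gap
  \<open>p i\<close> is not below the suffix average \<open>W i\<close>. Removing it raises the
  average by no more than the error permits, and \<open>W\<close> at the start of the last epoch is
  compared with \<open>W\<close> at the middle of the run. The end \<open>T'\<close> is arbitrary in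
  the last epoch so that single gaps as well as the whole sum can be read off.\<close>

lemma last_epoch_bound:
  assumes T': "(S - 1) * m < T'" "T' \<le> m * S"
  shows "(\<Sum>k=(S-1)*m..<T'. tk k * p k) + (p T' + t2 * pot T')
    \<le> 100001 * Gam * (20000000 * unit / real m)"
proof -
  define K0 K1 where "K0 = J * m" and "K1 = (S - 1) * m"
  have KK: "K0 \<le> K1" unfolding K0_def K1_def using J_bounds by (intro mult_right_mono) auto
  have K1T: "K1 < T'" "K1 < m * S" using T' unfolding K1_def by linarith+
  define U where "U i = (\<Sum>k=i..<T'. tk k * p k)" for i
  define F where "F = p T' + t2 * pot T'"
  define W where "W i = (U i + F) / That i" for i
  have tp: "tk k * p k \<ge> 0" for k using tk_pos[of k] p_nonneg[of k] by simp
  have U0: "U i \<ge> 0" for i unfolding U_def by (intro sum_nonneg tp)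
  have F0: "F \<ge> 0" unfolding F_def using p_nonneg t2_nonneg pot_nonneg by simp
  have U_Suc: "U i = tk i * p i + U (Suc i)" if "i < T'" for i
    unfolding U_def using that by (rule sum.atLeast_Suc_lessThan)
  have W_step: "W (Suc i) \<le> W i + 2 * (w i * tk i * (kk i + t2 * pot i))" if i: "i < K1" for i
  proof -
    define X where "X = kk i + t2 * pot i"
    define A where "A = U i + F"
    define T where "T = That i"
    define T1 where "T1 = That (Suc i)"
    have X0: "X \<ge> 0" using kk_nonneg t2_nonneg pot_nonneg by (simp add: X_def)
    have iS: "Suc i \<le> m * S" "i < T'" using i K1T by auto
    have TT: "T = T1 + tk i" using That_split[of i "Suc i"] iS by (simp add: T_def T1_def)
    have Tp: "T > 0" "T1 > 0" using That_pos by (auto simp: T_def T1_def)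
    have cG: "c0 * Gam \<ge> 100000" using Gam_ge_1 by (simp add: c0_def)
    have T1b: "T1 \<ge> 1" using That_ge[of "Suc i"] cG by (simp add: T1_def)
    have tkh: "tk i \<le> 1 / 2" unfolding tk_def by (rule step_tau_le_half)
    have "A \<le> kk i + (1 + (\<Sum>l=i..<T'. tk l)) * p i + t2 * pot i"
    proof -
      have "0 \<le> (tk T')\<^sup>2 * G i T'" by (simp add: G_nonneg)
      then show ?thesis using chain[of i T'] iS T' unfolding A_def U_def F_def by simp
    qed
    also have "(1 + (\<Sum>l=i..<T'. tk l)) * p i \<le> T * p i"
    proof (rule mult_right_mono[OF _ p_nonneg])
      have "(\<Sum>l=i..<T'. tk l) \<le> (\<Sum>l=i..<m*S. tk l)"
        by (rule sum_mono2) (use T' tk_pos in \<open>auto simp: less_imp_le\<close>)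
      then show "1 + (\<Sum>l=i..<T'. tk l) \<le> T" unfolding T_def That_def using cG by simp
    qed
    finally have AX: "A \<le> X + T * p i" by (simp add: X_def)
    have "(U (Suc i) + F) = A - tk i * p i" using U_Suc[OF iS(2)] by (simp add: A_def)
    then have "W (Suc i) - W i = (A - tk i * p i) / T1 - A / T" by (simp add: W_def A_def T_def T1_def)
    also have "\<dots> = tk i * (A - T * p i) / (T * T1)"
      using Tp by (simp add: field_simps TT)
    also have "\<dots> \<le> tk i * X / (T * T1)"
      using AX tk_pos[of i] Tp by (intro divide_right_mono mult_left_mono) auto
    \<comment> \<open>Here \<open>T1 \<ge> T / 2\<close>, since one step changes \<open>That\<close>
      by at most 1/2 and \<open>T1 \<ge> 1\<close>. This makes the weight
      \<open>w i = 1 / T\<^sup>2\<close> appear.\<close>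
    also have "\<dots> \<le> tk i * X / (T * (T / 2))"
    proof (rule divide_left_mono)
      show "T * (T / 2) \<le> T * T1" using Tp T1b tkh TT by (intro mult_left_mono) auto
      show "0 \<le> tk i * X" using X0 tk_pos[of i] by simp
      show "0 < T * T1 * (T * (T / 2))" using Tp by simp
    qed
    also have "\<dots> = 2 * (w i * tk i * X)" using Tp by (simp add: w_def T_def power2_eq_square field_simps)
    finally show ?thesis by (simp add: X_def)
  qed
  have W_sum: "W n \<le> W K0 + 2 * (\<Sum>i=K0..<n. w i * tk i * (kk i + t2 * pot i))" if "K0 \<le> n" "n \<le> K1" for n
    using that
  proof (induction n rule: dec_induct)
    case (step n)
    then show ?case using W_step[of n] by (simp add: distrib_left)
  qed simp
  \<comment> \<open>The accumulated errors contain gaps that are to be bounded by \<open>W\<close>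
    itself; hence the maximum, for which an inequality with \<open>Wm\<close> on both sides is
    derived.\<close>
  define Wm where "Wm = Max (W ` {K0..K1})"
  have W_le: "W n \<le> Wm" if "K0 \<le> n" "n \<le> K1" for n unfolding Wm_def using that by (intro Max_ge) auto
  have "Wm \<in> W ` {K0..K1}" unfolding Wm_def using KK by (intro Max_in) auto
  then obtain n0 where n0: "K0 \<le> n0" "n0 \<le> K1" "Wm = W n0" by auto
  have W0: "W i \<ge> 0" for i unfolding W_def using U0 F0 That_pos by (intro divide_nonneg_nonneg) (auto simp: less_imp_le)
  have U_le: "U n \<le> Wm * That n" if "K0 \<le> n" "n \<le> K1" for n
  proof -
    have "U n \<le> W n * That n" using F0 That_pos[of n] by (simp add: W_def)
    also have "\<dots> \<le> Wm * That n" using W_le[OF that] That_pos[of n] by (intro mult_right_mono) auto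
    finally show ?thesis .
  qed
  \<comment> \<open>Summation by parts with \<open>U n \<le> Wm * That n\<close>. For
    \<open>w = 1 / That\<^sup>2\<close> the sum behaves like an integral of 2/T^2, which is governed
    by the smallest value of \<open>That\<close>, at least \<open>c0 * Gam\<close>.\<close>
  have np_le: "np \<le> 2 * Wm / (c0 * Gam)"
  proof -
    have "(\<Sum>k=K0..n. w k * (tk k * p k)) + w n * U (Suc n) \<le> Wm * (2 / That n - 1 / That K0)"
      if "K0 \<le> n" "n \<le> K1" for n
      using that
    proof (induction n rule: dec_induct)
      case base
      have "w K0 * (tk K0 * p K0) + w K0 * U (Suc K0) = w K0 * U K0"
        using U_Suc[of K0] KK K1T by (simp add: distrib_left)
      also have "\<dots> \<le> w K0 * (Wm * That K0)"
        using U_le[of K0] KK w_pos[of K0] by (intro mult_left_mono) auto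
      also have "\<dots> = Wm * (2 / That K0 - 1 / That K0)"
        using That_pos[of K0] by (simp add: w_def power2_eq_square)
      finally show ?case by simp
    next
      case (step n)
      define T T1 where "T = That n" and "T1 = That (Suc n)"
      have Tp: "T > 0" "T1 > 0" using That_pos by (auto simp: T_def T1_def)
      have Sn: "Suc n \<le> K1" "K0 \<le> Suc n" "Suc n < T'" "Suc n \<le> m * S" using step K1T by auto
      have wm: "w n \<le> w (Suc n)" using Sn by (intro w_mono) auto
      have "(\<Sum>k=K0..Suc n. w k * (tk k * p k)) + w (Suc n) * U (Suc (Suc n))
          = (\<Sum>k=K0..n. w k * (tk k * p k)) + w n * U (Suc n) + (w (Suc n) - w n) * U (Suc n)"
        using U_Suc[OF Sn(3)] step.hyps by (simp add: algebra_simps)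
      also have "\<dots> \<le> Wm * (2 / T - 1 / That K0) + (w (Suc n) - w n) * (Wm * T1)"
        using step U_le[OF Sn(2,1)] wm by (intro add_mono mult_left_mono) (auto simp: T_def T1_def)
      also have "(w (Suc n) - w n) * (Wm * T1) \<le> Wm * (2 / T1 - 2 / T)"
      proof -
        \<comment> \<open>The deviation from 2/T1 - 2/T is a completed square.\<close>
        have "(w (Suc n) - w n) * T1 = (2 / T1 - 2 / T) - (1 - T1 / T)\<^sup>2 / T1"
          using Tp by (simp add: w_def T_def[symmetric] T1_def[symmetric] field_simps power2_eq_square)
        also have "\<dots> \<le> 2 / T1 - 2 / T" using Tp by simp
        finally have "Wm * ((w (Suc n) - w n) * T1) \<le> Wm * (2 / T1 - 2 / T)"
          using W0 n0 by (intro mult_left_mono) auto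
        then show ?thesis by (simp add: mult_ac)
      qed
      finally show ?case by (simp add: T1_def algebra_simps)
    qed
    from this[of K1] have "np + w K1 * U (Suc K1) \<le> Wm * (2 / That K1 - 1 / That K0)"
      using KK by (simp add: np_def K0_def K1_def)
    moreover have "w K1 * U (Suc K1) \<ge> 0" using w_pos[of K1] U0 by simp
    moreover have "Wm * (2 / That K1 - 1 / That K0) \<le> Wm * (2 / (c0 * Gam))"
    proof (rule mult_left_mono)
      have "2 / That K1 \<le> 2 / (c0 * Gam)"
        using That_ge[of K1] That_pos[of K1] c0_pos Gam_ge_1 by (intro divide_left_mono) auto
      moreover have "0 \<le> 1 / That K0" using That_pos[of K0] by simp
      ultimately show "2 / That K1 - 1 / That K0 \<le> 2 / (c0 * Gam)" by linarith
    qed (use W0 n0 in simp)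
    ultimately have "np \<le> Wm * (2 / (c0 * Gam))" by linarith
    then show ?thesis by (simp add: mult.commute)
  qed
  define D where "D = yb (J - 2) + yb (J - 1)"
  have "Wm \<le> W K0 + 2 * (\<Sum>i=K0..<K1. w i * tk i * (kk i + t2 * pot i))"
  proof -
    have "(\<Sum>i=K0..<n0. w i * tk i * (kk i + t2 * pot i)) \<le> (\<Sum>i=K0..<K1. w i * tk i * (kk i + t2 * pot i))"
      by (rule sum_mono2) (use n0 w_pos tk_pos kk_nonneg t2_nonneg pot_nonneg in \<open>auto intro!: mult_nonneg_nonneg add_nonneg_nonneg simp: less_imp_le\<close>)
    then show ?thesis using W_sum[OF n0(1,2)] n0(3) by simp
  qed
  also have "\<dots> \<le> W K0 + 34 * bnd + 804 * (Gam * nb)"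
    using step_sum_bound unfolding K0_def K1_def by simp
  also have "804 * (Gam * nb) \<le> 12864 * (Gam * np) + 5628 * (Gam * D)"
  proof -
    have "Gam * nb \<le> Gam * (16 * np + 7 * D)" using nb_bound Gam_ge_1 unfolding D_def by (intro mult_left_mono) auto
    then show ?thesis by (simp add: algebra_simps)
  qed
  also have "Gam * np \<le> 2 / 100000 * Wm"
  proof -
    have "Gam * np \<le> Gam * (2 * Wm / (c0 * Gam))" using np_le Gam_ge_1 by (intro mult_left_mono) auto
    also have "\<dots> = 2 / 100000 * Wm" using Gam_ge_1 by (simp add: c0_def)
    finally show ?thesis .
  qed
  \<comment> \<open>The feedback factor is 12864 * 2 / 100000, about 0.26. The size of
    \<open>c0\<close> is chosen to bring it below 1.\<close>
  finally have Wm1: "Wm \<le> W K0 + 34 * bnd + 12864 * (2 / 100000 * Wm) + 5628 * (Gam * D)" by simp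
  have Wm0: "Wm \<ge> 0" using W0 n0 by simp
  have W_K0: "W K0 \<le> 1408 * unit / real m"
  proof -
    have "U K0 \<le> 512 * unit"
    proof -
      have "U K0 \<le> (\<Sum>k=J*m..<S*m. tk k * p k)"
        unfolding U_def K0_def by (rule sum_mono2) (use T' tp in \<open>auto simp: mult.commute\<close>)
      also have "\<dots> = (\<Sum>s=J..<S. t s * fs p s)"
        using J_bounds by (subst sum_epochs) (auto simp: fs_def sum_distrib_left tk_def intro!: sum.cong)
      finally show ?thesis using epoch_sum_bound by simp
    qed
    moreover have "F \<le> 192 * unit"
    proof -
      define l where "l = T' - (S - 1) * m"
      have l: "T' = (S - 1) * m + l" "1 \<le> l" "l \<le> m"
      proof -
        have "m * S = (S - 1) * m + m" using S by (cases S) (auto simp: mult.commute)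
        then show "T' = (S - 1) * m + l" "1 \<le> l" "l \<le> m" using T' by (auto simp: l_def)
      qed
      have 1: "p T' \<le> 64 * unit" unfolding l(1) using l S J_bounds by (intro p_unit) auto
      have "pot T' \<le> bp (S - 1) + bp S" using pot_le[OF l(3), of "S - 1"] S unfolding l(1) by simp
      then have "t2 * pot T' \<le> t2 * (bp (S - 1) + bp S)" using t2_nonneg by (intro mult_left_mono)
      moreover have "t2 * bp (S - 1) \<le> 64 * unit" using t2_bp_unit[of "S - 2"] S40 J_bounds by (simp add: Suc_diff_Suc numeral_2_eq_2)
      moreover have "t2 * bp S \<le> 64 * unit" using t2_bp_unit[of "S - 1"] S40 J_bounds by simp
      ultimately have "t2 * pot T' \<le> 128 * unit" by (simp add: distrib_left)
      with 1 show ?thesis by (simp add: F_def)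
    qed
    ultimately have "W K0 \<le> (704 * unit) / (real m / 2)"
      unfolding W_def using That_J U0[of K0] F0 unit_nonneg m_pos by (intro frac_le) (auto simp: K0_def)
    then show ?thesis by simp
  qed
  define v where "v = unit / real m"
  have v: "v \<ge> 0" using unit_nonneg by (simp add: v_def)
  have "bnd \<le> 30000 * v" "Gam * D \<le> 1024 * v" "W K0 \<le> 1408 * v"
    using bnd_unit yb_unit W_K0 by (simp_all add: v_def D_def)
  then have "Wm \<le> 20000000 * v" using Wm1 Wm0 v by argo
  then have Wm_unit: "Wm \<le> 20000000 * unit / real m" by (simp add: v_def)
  have "U K1 + F = W K1 * That K1" using That_pos[of K1] by (simp add: W_def)
  also have "\<dots> \<le> (20000000 * unit / real m) * (100001 * Gam)"
  proof (rule mult_mono)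
    show "W K1 \<le> 20000000 * unit / real m" using W_le[of K1] KK Wm_unit by simp
    have "(\<Sum>i=K1..<m*S. tk i) \<le> (\<Sum>i=K1..<m*S. t (S - 1))"
    proof (rule sum_mono)
      fix i assume "i \<in> {K1..<m*S}"
      then show "tk i \<le> t (S - 1)" using tk_antimono[of K1 i] tk_epoch0[of "S - 1"] by (simp add: K1_def)
    qed
    also have "\<dots> = real m * t (S - 1)"
    proof -
      have "m * S - K1 = m" using S by (cases S) (auto simp: K1_def mult.commute)
      then show ?thesis by simp
    qed
    also have "\<dots> \<le> Gam" unfolding Gam_def using m_pos t2_nonneg by (simp add: distrib_left)
    finally show "That K1 \<le> 100001 * Gam" by (simp add: That_def c0_def)
  qed (use That_pos[of K1] unit_nonneg m_pos in auto)
  finally show ?thesis unfolding U_def F_def K1_def by (simp add: mult_ac)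
qed

text \<open>\<open>Q\<close> bounds every gap of the last epoch and, with \<open>T' = m * S\<close>,
  also \<open>(t (S - 1) + t2) * bp S\<close>. Adding \<open>bp S \<le> m * Q\<close> to
  \<open>m\<close> times the latter produces \<open>Gam * bp S\<close>, and the factor
  \<open>Gam\<close> in \<open>Q\<close> cancels.\<close>

lemma small_tau_rate: "bp S \<le> 5000000000000 * unit"
proof -
  define Q where "Q = 100001 * Gam * (20000000 * unit / real m)"
  have mS: "m * S = Suc (S - 1) * m" "Suc (S - 1) = S" using S by (auto simp: mult.commute)
  have pw: "p ((S - 1) * m + i + 1) \<le> Q" if i: "i < m" for i
  proof -
    let ?T = "(S - 1) * m + i + 1"
    have "?T \<le> m * S" using i idx_less[of "S - 1" i] S by simp
    then have *: "(\<Sum>k=(S-1)*m..<?T. tk k * p k) + (p ?T + t2 * pot ?T) \<le> Q"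
      unfolding Q_def by (intro last_epoch_bound) auto
    have "0 \<le> (\<Sum>k=(S-1)*m..<?T. tk k * p k)"
      using tk_pos p_nonneg by (intro sum_nonneg mult_nonneg_nonneg) (auto simp: less_imp_le)
    moreover have "0 \<le> t2 * pot ?T" using t2_nonneg pot_nonneg by simp
    ultimately show ?thesis using * by linarith
  qed
  have "bp (Suc (S - 1)) \<le> (\<Sum>i<m. Q)" unfolding bp_Suc by (intro sum_mono pw) auto
  then have A: "bp S \<le> real m * Q" using mS by simp
  have "(t (S - 1) + t2) * bp S \<le> Q"
  proof -
    have *: "(\<Sum>k=(S-1)*m..<m*S. tk k * p k) + (p (m * S) + t2 * pot (m * S)) \<le> Q"
      unfolding Q_def using S m by (intro last_epoch_bound) (auto simp: mult.commute)
    have "(\<Sum>k=(S-1)*m..<S*m. tk k * p k) = (\<Sum>s=S-1..<S. \<Sum>i<m. tk (s * m + i) * p (s * m + i))"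
      by (rule sum_epochs) simp
    also have "{S-1..<S} = {S-1}" using S by auto
    also have "(\<Sum>s\<in>{S-1}. \<Sum>i<m. tk (s * m + i) * p (s * m + i)) = t (S - 1) * fs p (S - 1)"
      by (simp add: fs_def sum_distrib_left tk_def)
    finally have U: "(\<Sum>k=(S-1)*m..<m*S. tk k * p k) = t (S - 1) * fs p (S - 1)" by (simp only: mult.commute)
    have "pot (m * S) = bp S - p (m * S)"
      using pot_eq[of 0 S] by (simp add: pt_def mult.commute)
    have "fs p (S - 1) \<ge> bp S - p (m * S)"
      using bp_Suc_fz[of "S - 1"] p_nonneg[of "(S - 1) * m"] unfolding fz_def mS(2) by (simp add: mult.commute)
    then have "t (S - 1) * (bp S - p (m * S)) \<le> t (S - 1) * fs p (S - 1)"
      using step_tau_pos[of "S - 1"] by (intro mult_left_mono) auto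
    moreover have "(t (S - 1) + t2) * p (m * S) \<le> 1 * p (m * S)"
      using gam_le_1 p_nonneg by (intro mult_right_mono)
    moreover have "t2 * pot (m * S) = t2 * bp S - t2 * p (m * S)"
      unfolding \<open>pot (m * S) = bp S - p (m * S)\<close> by (simp only: right_diff_distrib)
    ultimately show ?thesis using * unfolding U distrib_right right_diff_distrib by linarith
  qed
  then have "real m * ((t (S - 1) + t2) * bp S) \<le> real m * Q" using m_pos by (intro mult_left_mono) auto
  with A have "Gam * bp S \<le> 2 * (real m * Q)" by (simp add: Gam_def algebra_simps)
  also have "\<dots> = Gam * (200002 * 20000000 * unit)" unfolding Q_def using m_pos by simp
  finally have "bp S \<le> 200002 * 20000000 * unit" using Gam_ge_1 by simp
  then show ?thesis using unit_nonneg by simp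
qed

end

theorem (in rate_sequences) last_average_rate:
  "prv m S p \<le> 5000000000000 * (real m * p 0 + R 0) / (real m * (real S)\<^sup>2)"
proof -
  have "bp S \<le> 5000000000000 * (scl / (real S)\<^sup>2)"
  proof (cases "t2 \<ge> 19 / 100 \<or> S < 40")
    case True
    have "bp S \<le> 400 * (scl / (real S)\<^sup>2)" using standard_rate[OF True] by simp
    moreover have "0 \<le> scl / (real S)\<^sup>2" using scl_nonneg by simp
    ultimately show ?thesis by linarith
  next
    case False
    then interpret small_tau_sequences m S t2 p R Y e G by unfold_locales auto
    show ?thesis using small_tau_rate unfolding unit_def .
  qed
  then have "bp S / real m \<le> 5000000000000 * (scl / (real S)\<^sup>2) / real m" by (intro divide_right_mono) auto
  then show ?thesis unfolding prv_p scl_def by (simp add: mult.commute)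
qed

section \<open>Convex analysis and proximal steps\<close>

definition vdiff :: "rvec \<Rightarrow> rvec \<Rightarrow> rvec" where "vdiff x y = (\<lambda>j. x j - y j)"

definition sqn :: "nat \<Rightarrow> rvec \<Rightarrow> real" where "sqn d x = ip d x x"

lemma sqn_sum: "sqn d x = (\<Sum>j<d. (x j)\<^sup>2)"
  by (simp add: sqn_def ip_def power2_eq_square)

lemma sqn_nonneg: "sqn d x \<ge> 0"
  by (simp add: sqn_sum sum_nonneg)

lemma nrm_sq: "(nrm d x)\<^sup>2 = sqn d x"
  using sqn_nonneg[of d x] by (simp add: nrm_def sqn_def)

lemma nrm_nonneg: "nrm d x \<ge> 0"
  using sqn_nonneg[of d x] by (simp add: nrm_def sqn_def)

lemma ip_diff_left: "ip d (\<lambda>j. x j - y j) z = ip d x z - ip d y z"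
  by (simp add: ip_def sum_subtractf algebra_simps)

lemma ip_diff_right: "ip d z (\<lambda>j. x j - y j) = ip d z x - ip d z y"
  by (simp add: ip_def sum_subtractf algebra_simps)

lemma ip_scale_right: "ip d z (\<lambda>j. c * x j) = c * ip d z x"
  by (simp add: ip_def sum_distrib_left mult_ac)

lemma sqn_scale: "sqn d (\<lambda>j. c * x j) = c\<^sup>2 * sqn d x"
  by (simp add: sqn_sum sum_distrib_left power_mult_distrib)

lemma sqn_swap: "sqn d (vdiff x y) = sqn d (vdiff y x)"
  by (simp add: sqn_sum vdiff_def power2_commute)

lemma ip_young:
  assumes "c > 0"
  shows "ip d x y \<le> sqn d x / (4 * c) + c * sqn d y"
proof -
  have "x j * y j \<le> (x j)\<^sup>2 / (4 * c) + c * (y j)\<^sup>2" for j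
  proof -
    have "0 \<le> (x j - 2 * c * y j)\<^sup>2 / (4 * c)" using assms by simp
    also have "\<dots> = (x j)\<^sup>2 / (4 * c) + c * (y j)\<^sup>2 - x j * y j"
      using assms by (simp add: field_simps power2_eq_square)
    finally show ?thesis by simp
  qed
  then have "(\<Sum>j<d. x j * y j) \<le> (\<Sum>j<d. (x j)\<^sup>2 / (4 * c) + c * (y j)\<^sup>2)" by (intro sum_mono)
  then show ?thesis
    by (simp add: ip_def sqn_sum sum.distrib sum_divide_distrib sum_distrib_left)
qed

lemma ip_le_nrm: "\<bar>ip d x y\<bar> \<le> nrm d x * nrm d y"
proof -
  have "(ip d x y)\<^sup>2 \<le> (nrm d x)\<^sup>2 * (nrm d y)\<^sup>2"
    unfolding nrm_sq sqn_sum ip_def by (rule Cauchy_Schwarz_ineq_sum)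
  then have "\<bar>ip d x y\<bar> \<le> \<bar>nrm d x * nrm d y\<bar>"
    by (simp add: abs_le_square_iff power_mult_distrib)
  then show ?thesis using nrm_nonneg by simp
qed

lemma sqn_young:
  assumes "b > 0"
  shows "sqn d (\<lambda>j. x j + y j) \<le> (1 + b) * sqn d x + (1 + 1 / b) * sqn d y"
proof -
  have "(x j + y j)\<^sup>2 \<le> (1 + b) * (x j)\<^sup>2 + (1 + 1 / b) * (y j)\<^sup>2" for j
  proof -
    have "0 \<le> (b * x j - y j)\<^sup>2 / b" using assms by simp
    also have "\<dots> = (1 + b) * (x j)\<^sup>2 + (1 + 1 / b) * (y j)\<^sup>2 - (x j + y j)\<^sup>2"
      using assms by (simp add: field_simps power2_eq_square)
    finally show ?thesis by simp
  qed
  then have "(\<Sum>j<d. (x j + y j)\<^sup>2) \<le> (\<Sum>j<d. (1 + b) * (x j)\<^sup>2 + (1 + 1 / b) * (y j)\<^sup>2)"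
    by (intro sum_mono)
  then show ?thesis by (simp add: sqn_sum sum.distrib sum_distrib_left)
qed

text \<open>Convexity of the set is included, so that Jensen's inequality also returns membership.
  It is applied to \<open>hr\<close> and \<open>Pr\<close> on the domain of \<open>h\<close> and to
  squared distances on the whole space.\<close>

definition conv_fun_on :: "rvec set \<Rightarrow> (rvec \<Rightarrow> real) \<Rightarrow> bool" where
  "conv_fun_on C F \<longleftrightarrow> (\<forall>x\<in>C. \<forall>y\<in>C. \<forall>t. 0 \<le> t \<and> t \<le> 1 \<longrightarrow>
     (\<lambda>j. (1 - t) * x j + t * y j) \<in> C \<and>
     F (\<lambda>j. (1 - t) * x j + t * y j) \<le> (1 - t) * F x + t * F y)"

lemma conv_fun_onD:
  assumes "conv_fun_on C F" "x \<in> C" "y \<in> C" "0 \<le> t" "t \<le> 1"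
  shows "(\<lambda>j. (1 - t) * x j + t * y j) \<in> C"
    and "F (\<lambda>j. (1 - t) * x j + t * y j) \<le> (1 - t) * F x + t * F y"
  using assms unfolding conv_fun_on_def by blast+

lemma conv_fun_on_jensen:
  fixes k :: nat
  assumes F: "conv_fun_on C F"
  shows "(\<And>i. i < k \<Longrightarrow> x i \<in> C) \<Longrightarrow> (\<And>i. i < k \<Longrightarrow> w i \<ge> 0) \<Longrightarrow> (\<Sum>i<k. w i) = 1 \<Longrightarrow>
    (\<lambda>j. \<Sum>i<k. w i * x i j) \<in> C \<and> F (\<lambda>j. \<Sum>i<k. w i * x i j) \<le> (\<Sum>i<k. w i * F (x i))"
proof (induction k arbitrary: w)
  case 0
  then show ?case by simp
next
  case (Suc k)
  define W where "W = (\<Sum>i<k. w i)"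
  have W: "W + w k = 1" "W \<ge> 0" using Suc.prems(2,3) by (auto simp: W_def intro!: sum_nonneg)
  show ?case
  proof (cases "W = 0")
    case True
    have "w i = 0" if "i < k" for i
    proof -
      have "w i \<le> W" unfolding W_def using that Suc.prems(2) by (intro member_le_sum) auto
      then show ?thesis using True Suc.prems(2)[of i] that by simp
    qed
    moreover have "w k = 1" using W True by simp
    ultimately have "(\<lambda>j. \<Sum>i<Suc k. w i * x i j) = x k" "(\<Sum>i<Suc k. w i * F (x i)) = F (x k)" by simp_all
    then show ?thesis using Suc.prems(1)[of k] by simp
  next
    case False
    then have Wp: "W > 0" using W by simp
    let ?u = "\<lambda>j. \<Sum>i<k. w i / W * x i j"
    have IH: "?u \<in> C \<and> F ?u \<le> (\<Sum>i<k. w i / W * F (x i))"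
    proof (rule Suc.IH)
      show "(\<Sum>i<k. w i / W) = 1" using Wp by (simp add: W_def sum_divide_distrib[symmetric])
    qed (use Suc.prems Wp in auto)
    have t: "0 \<le> w k" "w k \<le> 1" "1 - w k = W" using W Suc.prems(2)[of k] by auto
    have eq: "(\<lambda>j. (1 - w k) * ?u j + w k * x k j) = (\<lambda>j. \<Sum>i<Suc k. w i * x i j)"
      unfolding t(3) using Wp by (simp add: sum_distrib_left)
    have "(1 - w k) * F ?u + w k * F (x k) \<le> W * (\<Sum>i<k. w i / W * F (x i)) + w k * F (x k)"
      unfolding t(3) using IH Wp by simp
    also have "\<dots> = (\<Sum>i<Suc k. w i * F (x i))" using Wp by (simp add: sum_distrib_left)
    finally show ?thesis
      using conv_fun_onD[OF F conjunct1[OF IH] Suc.prems(1)[of k] t(1,2)] unfolding eq by simp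
  qed
qed

lemma conv_fun_on_comb3:
  assumes F: "conv_fun_on C F" and C: "x \<in> C" "y \<in> C" "z \<in> C"
    and ab: "a \<ge> 0" "b \<ge> 0" "a + b \<le> 1"
  shows "(\<lambda>j. a * x j + b * y j + (1 - a - b) * z j) \<in> C"
    and "F (\<lambda>j. a * x j + b * y j + (1 - a - b) * z j) \<le> a * F x + b * F y + (1 - a - b) * F z"
proof -
  define X where "X i = (if i = 0 then x else if i = 1 then y else z)" for i :: nat
  define w where "w i = (if i = 0 then a else if i = 1 then b else 1 - a - b)" for i :: nat
  have "(\<lambda>j. \<Sum>i<3. w i * X i j) \<in> C \<and> F (\<lambda>j. \<Sum>i<3. w i * X i j) \<le> (\<Sum>i<3. w i * F (X i))"
    by (rule conv_fun_on_jensen[OF F]) (use C ab in \<open>auto simp: X_def w_def numeral_3_eq_3\<close>)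
  then show "(\<lambda>j. a * x j + b * y j + (1 - a - b) * z j) \<in> C"
    "F (\<lambda>j. a * x j + b * y j + (1 - a - b) * z j) \<le> a * F x + b * F y + (1 - a - b) * F z"
    by (simp_all add: X_def w_def numeral_3_eq_3)
qed

lemma conv_fun_on_sqn: "conv_fun_on UNIV (\<lambda>x. sqn d (vdiff x q))"
  unfolding conv_fun_on_def
proof (intro ballI allI impI conjI UNIV_I)
  fix x y :: rvec and t :: real assume t: "0 \<le> t \<and> t \<le> 1"
  have "((1 - t) * x j + t * y j - q j)\<^sup>2 \<le> (1 - t) * (x j - q j)\<^sup>2 + t * (y j - q j)\<^sup>2" for j
  proof -
    have "0 \<le> t * (1 - t) * (x j - y j)\<^sup>2" using t by simp
    also have "\<dots> = (1 - t) * (x j - q j)\<^sup>2 + t * (y j - q j)\<^sup>2 - ((1 - t) * x j + t * y j - q j)\<^sup>2"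
      by (simp add: power2_eq_square algebra_simps)
    finally show ?thesis by simp
  qed
  then have "(\<Sum>j<d. ((1 - t) * x j + t * y j - q j)\<^sup>2) \<le> (\<Sum>j<d. (1 - t) * (x j - q j)\<^sup>2 + t * (y j - q j)\<^sup>2)"
    by (intro sum_mono)
  then show "sqn d (vdiff (\<lambda>j. (1 - t) * x j + t * y j) q) \<le> (1 - t) * sqn d (vdiff x q) + t * sqn d (vdiff y q)"
    by (simp add: sqn_sum vdiff_def sum.distrib sum_distrib_left)
qed

section \<open>Gradient inequalities by restriction to lines\<close>

lemma Vd_lin: "x \<in> Vd d \<Longrightarrow> y \<in> Vd d \<Longrightarrow> (\<lambda>j. a * x j + b * y j) \<in> Vd d"
  by (auto simp: Vd_def)

lemma Vd_diff: "x \<in> Vd d \<Longrightarrow> y \<in> Vd d \<Longrightarrow> vdiff x y \<in> Vd d"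
  by (auto simp: Vd_def vdiff_def)

lemma nrm_scale: "nrm d (\<lambda>j. c * x j) = \<bar>c\<bar> * nrm d x"
  using sqn_scale[of d c x] by (simp add: nrm_def sqn_def real_sqrt_mult)

lemma has_grad_line:
  assumes g: "has_grad d f g" and x: "x \<in> Vd d" and k: "k \<in> Vd d"
  shows "((\<lambda>t. f (\<lambda>j. x j + t * k j)) has_real_derivative ip d (g (\<lambda>j. x j + t * k j)) k) (at t)"
proof -
  let ?z = "\<lambda>j. x j + t * k j"
  have z: "?z \<in> Vd d" using Vd_lin[OF x k, of 1 t] by simp
  show ?thesis
    unfolding has_field_derivative_def has_derivative_at_within
  proof (intro conjI)
    show "bounded_linear ((*) (ip d (g ?z) k))" by (rule bounded_linear_mult_right)
    show "((\<lambda>y. (f (\<lambda>j. x j + y * k j) - f ?z - ip d (g ?z) k * (y - t)) /\<^sub>R norm (y - t)) \<longlongrightarrow> 0) (at t)"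
    proof (rule tendstoI)
      fix e :: real assume e: "e > 0"
      \<comment> \<open>Adding 1 to the norm covers the case k = 0; the factor 2 leaves room for the
        strict inequality.\<close>
      define e' where "e' = e / (2 * (nrm d k + 1))"
      have e': "e' > 0" using e nrm_nonneg[of d k] by (simp add: e'_def)
      have "\<exists>r>0. \<forall>u\<in>Vd d. nrm d u < r \<longrightarrow>
          \<bar>f (\<lambda>j. ?z j + u j) - f ?z - ip d (g ?z) u\<bar> \<le> e' * nrm d u"
        using conjunct2[OF bspec[OF g[unfolded has_grad_def] z]] e' by simp
      then obtain r where r: "r > 0" "\<forall>u\<in>Vd d. nrm d u < r \<longrightarrow>
          \<bar>f (\<lambda>j. ?z j + u j) - f ?z - ip d (g ?z) u\<bar> \<le> e' * nrm d u"
        by (elim exE conjE)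
      define r' where "r' = r / (nrm d k + 1)"
      have r': "r' > 0" using r(1) nrm_nonneg[of d k] by (simp add: r'_def)
      show "\<forall>\<^sub>F y in at t. dist ((f (\<lambda>j. x j + y * k j) - f ?z - ip d (g ?z) k * (y - t)) /\<^sub>R norm (y - t)) 0 < e"
        unfolding eventually_at
      proof (intro exI[of _ r'] conjI ballI impI r')
        fix y assume y: "y \<noteq> t \<and> dist y t < r'"
        define s where "s = y - t"
        have s: "s \<noteq> 0" "\<bar>s\<bar> < r'" using y by (auto simp: s_def dist_real_def)
        let ?u = "\<lambda>j. s * k j"
        have u: "?u \<in> Vd d" using Vd_lin[OF k k, of s 0] by simp
        have nu: "nrm d ?u = \<bar>s\<bar> * nrm d k" by (rule nrm_scale)
        have "\<bar>s\<bar> * nrm d k \<le> \<bar>s\<bar> * (nrm d k + 1)" by (intro mult_left_mono) auto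
        also have "\<dots> < r" using s nrm_nonneg[of d k] by (simp add: r'_def field_simps)
        finally have "nrm d ?u < r" by (simp add: nu)
        from r(2)[rule_format, OF u this] have "\<bar>f (\<lambda>j. ?z j + ?u j) - f ?z - ip d (g ?z) ?u\<bar> \<le> e' * (\<bar>s\<bar> * nrm d k)"
          by (simp add: nu)
        moreover have "(\<lambda>j. ?z j + ?u j) = (\<lambda>j. x j + y * k j)" by (auto simp: s_def algebra_simps)
        moreover have "ip d (g ?z) ?u = ip d (g ?z) k * (y - t)" by (simp add: ip_scale_right s_def)
        ultimately have b: "\<bar>f (\<lambda>j. x j + y * k j) - f ?z - ip d (g ?z) k * (y - t)\<bar> \<le> e' * (\<bar>s\<bar> * nrm d k)" by simp
        have "\<bar>(f (\<lambda>j. x j + y * k j) - f ?z - ip d (g ?z) k * (y - t)) /\<^sub>R norm (y - t)\<bar>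
            = \<bar>f (\<lambda>j. x j + y * k j) - f ?z - ip d (g ?z) k * (y - t)\<bar> / \<bar>s\<bar>"
          by (simp add: s_def abs_mult divide_inverse mult.commute)
        also have "\<dots> \<le> e' * (\<bar>s\<bar> * nrm d k) / \<bar>s\<bar>" using b by (intro divide_right_mono) auto
        also have "\<dots> = e' * nrm d k" using s by simp
        also have "\<dots> \<le> e / 2"
        proof -
          have "nrm d k / (nrm d k + 1) \<le> 1" using nrm_nonneg[of d k] by simp
          then have "e / 2 * (nrm d k / (nrm d k + 1)) \<le> e / 2 * 1" using e by (intro mult_left_mono) auto
          then show ?thesis by (simp add: e'_def)
        qed
        finally show "dist ((f (\<lambda>j. x j + y * k j) - f ?z - ip d (g ?z) k * (y - t)) /\<^sub>R norm (y - t)) 0 < e"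
          using e by simp
      qed
    qed
  qed
qed

text \<open>Along the segment from \<open>x\<close> to \<open>y\<close>, the difference of
  \<open>f\<close> and the claimed quadratic bound has a nonpositive derivative, by Cauchy-Schwarz
  and the Lipschitz condition.\<close>

lemma smooth_descent:
  assumes g: "has_grad d f g" and lip: "lipschitz_grad d L g" and x: "x \<in> Vd d" and y: "y \<in> Vd d"
  shows "f y \<le> f x + ip d (g x) (vdiff y x) + L / 2 * sqn d (vdiff y x)"
proof -
  define k where "k = vdiff y x"
  have k: "k \<in> Vd d" unfolding k_def by (rule Vd_diff[OF y x])
  define \<psi> where "\<psi> t = f (\<lambda>j. x j + t * k j) - t * ip d (g x) k - L / 2 * t\<^sup>2 * sqn d k" for t
  define \<psi>' where "\<psi>' t = ip d (g (\<lambda>j. x j + t * k j)) k - ip d (g x) k - L * t * sqn d k" for t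
  have der: "(\<psi> has_real_derivative \<psi>' t) (at t)" for t
    unfolding \<psi>_def \<psi>'_def by (auto intro!: derivative_eq_intros has_grad_line[OF g x k])
  have "\<psi> 1 \<le> \<psi> 0"
  proof (rule DERIV_nonpos_imp_nonincreasing[of 0 1 \<psi>])
    fix t :: real assume t: "0 \<le> t" "t \<le> 1"
    let ?z = "\<lambda>j. x j + t * k j"
    have z: "?z \<in> Vd d" using Vd_lin[OF x k, of 1 t] by simp
    have "ip d (g ?z) k - ip d (g x) k = ip d (\<lambda>j. g ?z j - g x j) k" by (simp add: ip_diff_left)
    also have "\<dots> \<le> nrm d (\<lambda>j. g ?z j - g x j) * nrm d k" using ip_le_nrm abs_ge_self order_trans by blast
    also have "\<dots> \<le> (L * nrm d (\<lambda>j. ?z j - x j)) * nrm d k"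
      using lip z x unfolding lipschitz_grad_def by (intro mult_right_mono nrm_nonneg) blast
    also have "nrm d (\<lambda>j. ?z j - x j) = t * nrm d k" using nrm_scale[of d t k] t by simp
    also have "L * (t * nrm d k) * nrm d k = L * t * sqn d k" by (simp add: nrm_sq[symmetric] power2_eq_square)
    finally have "\<psi>' t \<le> 0" by (simp add: \<psi>'_def)
    then show "\<exists>y. (\<psi> has_real_derivative y) (at t) \<and> y \<le> 0" using der by blast
  qed simp
  moreover have "(\<lambda>j. x j + 1 * k j) = y" by (simp add: k_def vdiff_def)
  ultimately show ?thesis by (simp add: \<psi>_def k_def)
qed

lemma convex_gradient_bound:
  assumes g: "has_grad d f g" and c: "convex_Vd d f" and x: "x \<in> Vd d" and y: "y \<in> Vd d"
  shows "f x + ip d (g x) (vdiff y x) \<le> f y"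
proof -
  define k where "k = vdiff y x"
  have k: "k \<in> Vd d" unfolding k_def by (rule Vd_diff[OF y x])
  define \<phi> where "\<phi> t = f (\<lambda>j. x j + t * k j)" for t
  have "(\<phi> has_real_derivative ip d (g (\<lambda>j. x j + 0 * k j)) k) (at 0)"
    unfolding \<phi>_def by (rule has_grad_line[OF g x k])
  then have "((\<lambda>h. (\<phi> (0 + h) - \<phi> 0) / h) \<longlongrightarrow> ip d (g x) k) (at 0)" by (simp add: DERIV_def)
  then have lim: "((\<lambda>h. (\<phi> h - \<phi> 0) / h) \<longlongrightarrow> ip d (g x) k) (at_right 0)"
    by (simp add: filterlim_at_split)
  have "\<forall>\<^sub>F h in at_right 0. (\<phi> h - \<phi> 0) / h \<le> f y - f x"
    unfolding eventually_at_right_field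
  proof (intro exI[of _ 1] conjI allI impI)
    fix h :: real assume h: "0 < h" "h < 1"
    have "f (\<lambda>j. (1 - h) * x j + h * y j) \<le> (1 - h) * f x + h * f y"
      using c x y h unfolding convex_Vd_def by auto
    moreover have "(\<lambda>j. (1 - h) * x j + h * y j) = (\<lambda>j. x j + h * k j)" by (simp add: k_def vdiff_def algebra_simps)
    ultimately have "\<phi> h - \<phi> 0 \<le> h * (f y - f x)" by (simp add: \<phi>_def algebra_simps)
    then show "(\<phi> h - \<phi> 0) / h \<le> f y - f x" using h by (simp add: pos_divide_le_eq mult.commute)
  qed simp
  then have "ip d (g x) k \<le> f y - f x"
    using tendsto_upperbound[OF lim] by simp
  then show ?thesis by (simp add: k_def)
qed

text \<open>Evaluate \<open>f\<close> at \<open>z = y - q / L\<close>, a gradient step from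
  \<open>y\<close> for \<open>f\<close> minus its linearization at \<open>x\<close>: convexity
  bounds \<open>f z\<close> below from \<open>x\<close>, smoothness bounds it above from
  \<open>y\<close>, and the step length 1/L is the best one for this pair of bounds.\<close>

lemma gradient_diff_bregman:
  assumes g: "has_grad d f g" and lip: "lipschitz_grad d L g" and c: "convex_Vd d f" and L: "L > 0"
    and x: "x \<in> Vd d" and y: "y \<in> Vd d"
  shows "sqn d (vdiff (g x) (g y)) \<le> 2 * L * (f y - f x - ip d (g x) (vdiff y x))"
proof -
  define q where "q = vdiff (g y) (g x)"
  have q: "q \<in> Vd d" unfolding q_def using g x y by (intro Vd_diff) (auto simp: has_grad_def)
  define z where "z = (\<lambda>j. y j + (- 1 / L) * q j)"
  have z: "z \<in> Vd d" using Vd_lin[OF y q, of 1 "- 1 / L"] by (simp add: z_def)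
  have zy: "vdiff z y = (\<lambda>j. (- 1 / L) * q j)" by (simp add: z_def vdiff_def)
  have "f x + ip d (g x) (vdiff z x) \<le> f z" by (rule convex_gradient_bound[OF g c x z])
  also have "f z \<le> f y + ip d (g y) (vdiff z y) + L / 2 * sqn d (vdiff z y)"
    by (rule smooth_descent[OF g lip y z])
  finally have "f x + ip d (g x) (vdiff z x) \<le> f y + ip d (g y) (vdiff z y) + L / 2 * sqn d (vdiff z y)" .
  moreover have "ip d (g x) (vdiff z x) = ip d (g x) (vdiff z y) + ip d (g x) (vdiff y x)"
    unfolding vdiff_def ip_diff_right by simp
  moreover have "ip d (g y) (vdiff z y) - ip d (g x) (vdiff z y) = - (sqn d q / L)"
    unfolding zy ip_scale_right sqn_def by (simp add: q_def vdiff_def ip_diff_left diff_divide_distrib)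
  moreover have "L / 2 * sqn d (vdiff z y) = sqn d q / L / 2"
    unfolding zy sqn_scale using L by (simp add: field_simps power2_eq_square)
  ultimately have "sqn d q / L / 2 \<le> f y - f x - ip d (g x) (vdiff y x)" by linarith
  then show ?thesis using L sqn_swap[of d "g x" "g y"] by (simp add: q_def field_simps)
qed

section \<open>The composite objective and its proximal steps\<close>

locale composite_problem =
  fixes n d :: nat and L :: real and f :: "nat \<Rightarrow> rvec \<Rightarrow> real" and gr :: "nat \<Rightarrow> rvec \<Rightarrow> rvec"
    and h :: "rvec \<Rightarrow> ereal" and xs :: rvec
  assumes n_ge: "n \<ge> 1" and L_pos: "L > 0"
    and comps: "\<And>i. i \<in> {1..n} \<Longrightarrow> has_grad d (f i) (gr i) \<and> lipschitz_grad d L (gr i) \<and> convex_Vd d (f i)"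
    and h_reg: "proper_convex_lsc d h" and xs_min: "is_minimizer d (PP n f h) xs"
begin

definition gb :: "rvec \<Rightarrow> rvec" where "gb x = (\<lambda>j. (1 / real n) * (\<Sum>i=1..n. gr i x j))"

text \<open>The effective domain of \<open>h\<close>. The iterates stay in it, so the
  extended-valued \<open>h\<close> can be replaced by the real function \<open>hr\<close>.\<close>

definition dm :: "rvec set" where "dm = {x \<in> Vd d. h x \<noteq> \<infinity>}"

definition hr :: "rvec \<Rightarrow> real" where "hr x = real_of_ereal (h x)"

definition Pr :: "rvec \<Rightarrow> real" where "Pr x = fbar n f x + hr x"

lemma n_pos: "real n > 0" using n_ge by simp

lemma dm_Vd: "x \<in> dm \<Longrightarrow> x \<in> Vd d" by (simp add: dm_def)

lemma h_not_minf: "h x \<noteq> -\<infinity>" using h_reg by (simp add: proper_convex_lsc_def)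

lemma h_hr: "x \<in> dm \<Longrightarrow> h x = ereal (hr x)"
  using h_not_minf[of x] by (cases "h x") (auto simp: dm_def hr_def)

lemma PP_Pr: "x \<in> dm \<Longrightarrow> PP n f h x = ereal (Pr x)"
  by (simp add: PP_def Pr_def h_hr)

lemma dm_nonempty: "dm \<noteq> {}"
  using h_reg by (auto simp: proper_convex_lsc_def dm_def)

lemma xs_dm: "xs \<in> dm"
proof -
  obtain x where x: "x \<in> dm" using dm_nonempty by auto
  have "PP n f h xs \<le> PP n f h x" using xs_min x by (auto simp: is_minimizer_def dm_Vd)
  then have "h xs \<noteq> \<infinity>" using PP_Pr[OF x] by (auto simp: PP_def)
  then show ?thesis using xs_min by (simp add: dm_def is_minimizer_def)
qed

lemma Pr_min: "x \<in> dm \<Longrightarrow> Pr xs \<le> Pr x"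
proof -
  assume x: "x \<in> dm"
  have "PP n f h xs \<le> PP n f h x" using xs_min dm_Vd[OF x] by (simp add: is_minimizer_def)
  then show ?thesis by (simp add: PP_Pr x xs_dm)
qed

lemma hr_conv: "conv_fun_on dm hr"
  unfolding conv_fun_on_def
proof (intro ballI allI impI)
  fix x y and t :: real assume x: "x \<in> dm" and y: "y \<in> dm" and t: "0 \<le> t \<and> t \<le> 1"
  let ?z = "\<lambda>j. (1 - t) * x j + t * y j"
  have z: "?z \<in> Vd d" using x y by (intro Vd_lin) (auto simp: dm_Vd)
  have "h ?z \<le> ereal (1 - t) * h x + ereal t * h y"
    using h_reg x y t unfolding proper_convex_lsc_def by (auto simp: dm_Vd)
  also have "\<dots> = ereal ((1 - t) * hr x + t * hr y)" by (simp add: h_hr x y)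
  finally have le: "h ?z \<le> ereal ((1 - t) * hr x + t * hr y)" .
  then have "?z \<in> dm" using z by (auto simp: dm_def)
  then show "?z \<in> dm \<and> hr ?z \<le> (1 - t) * hr x + t * hr y" using le h_hr[of ?z] by simp
qed

lemma f_grad: "i \<in> {1..n} \<Longrightarrow> has_grad d (f i) (gr i)"
  and f_lip: "i \<in> {1..n} \<Longrightarrow> lipschitz_grad d L (gr i)"
  and f_conv: "i \<in> {1..n} \<Longrightarrow> convex_Vd d (f i)"
  using comps by auto

lemma gb_ip: "ip d (gb x) v = (1 / real n) * (\<Sum>i=1..n. ip d (gr i x) v)"
proof -
  have "ip d (gb x) v = (\<Sum>j<d. \<Sum>i=1..n. (1 / real n) * (gr i x j * v j))"
    unfolding ip_def gb_def by (simp add: sum_distrib_right sum_divide_distrib)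
  also have "\<dots> = (\<Sum>i=1..n. \<Sum>j<d. (1 / real n) * (gr i x j * v j))" by (rule sum.swap)
  finally show ?thesis unfolding ip_def by (simp only: sum_distrib_left)
qed

lemma fbar_descent:
  assumes x: "x \<in> Vd d" and y: "y \<in> Vd d"
  shows "fbar n f y \<le> fbar n f x + ip d (gb x) (vdiff y x) + L / 2 * sqn d (vdiff y x)"
proof -
  have "(1 / real n) * (\<Sum>i=1..n. f i y) \<le> (1 / real n) * (\<Sum>i=1..n. f i x + ip d (gr i x) (vdiff y x) + L / 2 * sqn d (vdiff y x))"
    using n_pos by (intro mult_left_mono sum_mono smooth_descent f_grad f_lip x y) auto
  also have "\<dots> = fbar n f x + ip d (gb x) (vdiff y x) + L / 2 * sqn d (vdiff y x)"
    unfolding gb_ip fbar_def using n_pos by (simp add: sum.distrib distrib_left)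
  finally show ?thesis by (simp only: fbar_def)
qed

lemma fbar_gradient_bound:
  assumes x: "x \<in> Vd d" and y: "y \<in> Vd d"
  shows "fbar n f x + ip d (gb x) (vdiff y x) \<le> fbar n f y"
proof -
  have "(1 / real n) * (\<Sum>i=1..n. f i x + ip d (gr i x) (vdiff y x)) \<le> (1 / real n) * (\<Sum>i=1..n. f i y)"
    using n_pos by (intro mult_left_mono sum_mono convex_gradient_bound f_grad f_conv x y) auto
  moreover have "(1 / real n) * (\<Sum>i=1..n. f i x + ip d (gr i x) (vdiff y x)) = fbar n f x + ip d (gb x) (vdiff y x)"
    unfolding gb_ip fbar_def by (simp add: sum.distrib distrib_left)
  ultimately show ?thesis by (simp only: fbar_def)
qed

definition breg :: "rvec \<Rightarrow> rvec \<Rightarrow> real" where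
  "breg y x = fbar n f y - fbar n f x - ip d (gb x) (vdiff y x)"

lemma gradient_variance_bregman:
  assumes x: "x \<in> Vd d" and y: "y \<in> Vd d"
  shows "(1 / real n) * (\<Sum>i=1..n. sqn d (vdiff (gr i x) (gr i y))) \<le> 2 * L * breg y x"
proof -
  have "(1 / real n) * (\<Sum>i=1..n. sqn d (vdiff (gr i x) (gr i y)))
      \<le> (1 / real n) * (\<Sum>i=1..n. 2 * L * (f i y - f i x - ip d (gr i x) (vdiff y x)))"
    using n_pos by (intro mult_left_mono sum_mono gradient_diff_bregman f_grad f_lip f_conv x y L_pos) auto
  also have "\<dots> = 2 * L * breg y x"
  proof -
    have "(\<Sum>i=1..n. 2 * L * (f i y - f i x - ip d (gr i x) (vdiff y x)))
        = 2 * L * ((\<Sum>i=1..n. f i y) - (\<Sum>i=1..n. f i x) - (\<Sum>i=1..n. ip d (gr i x) (vdiff y x)))"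
      by (simp only: sum_subtractf sum_distrib_left[symmetric])
    then show ?thesis unfolding breg_def gb_ip fbar_def
      by (simp only:) (simp add: algebra_simps diff_divide_distrib add_divide_distrib)
  qed
  finally show ?thesis .
qed

lemma fbar_conv:
  assumes x: "x \<in> Vd d" and y: "y \<in> Vd d" and t: "0 \<le> t" "t \<le> 1"
  shows "fbar n f (\<lambda>j. (1 - t) * x j + t * y j) \<le> (1 - t) * fbar n f x + t * fbar n f y"
proof -
  have "f i (\<lambda>j. (1 - t) * x j + t * y j) \<le> (1 - t) * f i x + t * f i y" if "i \<in> {1..n}" for i
    using f_conv[OF that] x y t unfolding convex_Vd_def by auto
  then have "(1 / real n) * (\<Sum>i=1..n. f i (\<lambda>j. (1 - t) * x j + t * y j)) \<le> (1 / real n) * (\<Sum>i=1..n. (1 - t) * f i x + t * f i y)"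
    using n_pos by (intro mult_left_mono sum_mono) auto
  also have "\<dots> = (1 - t) * fbar n f x + t * fbar n f y"
    unfolding fbar_def by (simp add: sum.distrib sum_distrib_left[symmetric] add_divide_distrib)
  finally show ?thesis unfolding fbar_def .
qed

lemma Pr_conv: "conv_fun_on dm Pr"
  unfolding conv_fun_on_def
proof (intro ballI allI impI)
  fix x y and t :: real assume xy: "x \<in> dm" "y \<in> dm" and t: "0 \<le> t \<and> t \<le> 1"
  show "(\<lambda>j. (1 - t) * x j + t * y j) \<in> dm \<and> Pr (\<lambda>j. (1 - t) * x j + t * y j) \<le> (1 - t) * Pr x + t * Pr y"
    using conv_fun_onD[OF hr_conv xy, of t] fbar_conv[of x y t] t xy
    by (auto simp: Pr_def dm_Vd algebra_simps)
qed

text \<open>First-order optimality: \<open>- gb xs\<close> is a subgradient of \<open>h\<close> at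
  the minimizer. This affine minorant is what bounds the proximal objectives from below.\<close>

lemma h_affine_minorant:
  assumes w: "w \<in> dm"
  shows "hr xs - ip d (gb xs) (vdiff w xs) \<le> hr w"
proof (rule ccontr)
  assume neg: "\<not> ?thesis"
  define D where "D = hr xs - ip d (gb xs) (vdiff w xs) - hr w"
  define q where "q = sqn d (vdiff w xs)"
  have D: "D > 0" using neg by (simp add: D_def)
  have q: "q \<ge> 0" by (simp add: q_def sqn_nonneg)
  \<comment> \<open>Small enough to keep the quadratic remainder \<open>L / 2 * (t * q)\<close>
    below the supposed defect \<open>D\<close>; the 1 in \<open>q + 1\<close> covers
    \<open>q = 0\<close>.\<close>
  define t where "t = min 1 (D / (L * (q + 1)))"
  have t: "0 < t" "t \<le> 1" using D q L_pos by (auto simp: t_def)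
  let ?z = "\<lambda>j. (1 - t) * xs j + t * w j"
  have z: "?z \<in> dm" "hr ?z \<le> (1 - t) * hr xs + t * hr w"
    using conv_fun_onD[OF hr_conv xs_dm w, of t] t by auto
  have zx: "vdiff ?z xs = (\<lambda>j. t * vdiff w xs j)" by (simp add: vdiff_def algebra_simps)
  have "fbar n f ?z \<le> fbar n f xs + t * ip d (gb xs) (vdiff w xs) + L / 2 * (t\<^sup>2 * q)"
    using fbar_descent[of xs ?z] xs_dm z unfolding zx ip_scale_right sqn_scale q_def by (simp add: dm_Vd)
  moreover have "fbar n f xs + hr xs \<le> fbar n f ?z + hr ?z" using Pr_min[OF z(1)] by (simp add: Pr_def)
  ultimately have "hr xs \<le> t * ip d (gb xs) (vdiff w xs) + L / 2 * (t\<^sup>2 * q) + ((1 - t) * hr xs + t * hr w)"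
    using z(2) by linarith
  then have "t * D \<le> t * (L / 2 * (t * q))" by (simp add: D_def power2_eq_square algebra_simps)
  then have "D \<le> L / 2 * (t * q)" using t by simp
  also have "\<dots> \<le> L / 2 * (D / (L * (q + 1)) * q)"
    using q L_pos by (intro mult_left_mono mult_right_mono) (auto simp: t_def)
  also have "\<dots> = D * (q / (q + 1)) / 2" using L_pos by simp
  also have "\<dots> < D"
  proof -
    have "q / (q + 1) \<le> 1" using q by simp
    then have "D * (q / (q + 1)) \<le> D" using D mult_left_mono[of "q / (q + 1)" 1 D] by simp
    then have "D * (q / (q + 1)) / 2 \<le> D / 2" by (rule divide_right_mono) simp
    also have "\<dots> < D" using D by simp
    finally show ?thesis .
  qed
  finally show False by simp
qed

definition prox_obj :: "real \<Rightarrow> rvec \<Rightarrow> rvec \<Rightarrow> rvec \<Rightarrow> real" where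
  "prox_obj c p v w = c * sqn d (vdiff w p) + ip d v w + hr w"

lemma prox_obj_strong:
  assumes x: "x \<in> dm" and y: "y \<in> dm" and t: "0 \<le> t" "t \<le> 1"
  shows "prox_obj c p v (\<lambda>j. (1 - t) * x j + t * y j)
    \<le> (1 - t) * prox_obj c p v x + t * prox_obj c p v y - c * t * (1 - t) * sqn d (vdiff x y)"
proof -
  define z where "z = (\<lambda>j. (1 - t) * x j + t * y j)"
  have sq: "sqn d (vdiff z p) = (1 - t) * sqn d (vdiff x p) + t * sqn d (vdiff y p) - t * (1 - t) * sqn d (vdiff x y)"
  proof -
    have "((1 - t) * x j + t * y j - p j)\<^sup>2 = (1 - t) * (x j - p j)\<^sup>2 + t * (y j - p j)\<^sup>2 - t * (1 - t) * (x j - y j)\<^sup>2" for j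
      by (simp add: power2_eq_square algebra_simps)
    then show ?thesis by (simp add: z_def sqn_sum vdiff_def sum.distrib sum_subtractf sum_distrib_left)
  qed
  have ipz: "ip d v z = (1 - t) * ip d v x + t * ip d v y"
    by (simp add: z_def ip_def sum.distrib sum_subtractf sum_distrib_left algebra_simps)
  have "hr z \<le> (1 - t) * hr x + t * hr y"
    unfolding z_def by (rule conv_fun_onD(2)[OF hr_conv x y t])
  then show ?thesis unfolding z_def[symmetric] unfolding prox_obj_def sq ipz by (simp add: algebra_simps)
qed

lemma prox_obj_bounded_below:
  assumes c: "c > 0"
  shows "\<exists>B. \<forall>w\<in>dm. B \<le> prox_obj c p v w"
proof -
  define u where "u = vdiff (gb xs) v"
  define B where "B = ip d v p + hr xs - ip d (gb xs) (vdiff p xs) - sqn d u / (4 * c)"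
  have "B \<le> prox_obj c p v w" if w: "w \<in> dm" for w
  proof -
    have "ip d u (vdiff w p) \<le> sqn d u / (4 * c) + c * sqn d (vdiff w p)" by (rule ip_young[OF c])
    moreover have "ip d u (vdiff w p) = ip d (gb xs) w - ip d (gb xs) p - ip d v w + ip d v p"
      unfolding u_def vdiff_def ip_diff_right ip_diff_left by simp
    moreover have "ip d (gb xs) (vdiff p xs) = ip d (gb xs) p - ip d (gb xs) xs"
      "ip d (gb xs) (vdiff w xs) = ip d (gb xs) w - ip d (gb xs) xs"
      unfolding vdiff_def ip_diff_right by simp_all
    ultimately show ?thesis using h_affine_minorant[OF w] unfolding prox_obj_def B_def by linarith
  qed
  then show ?thesis by blast
qed

lemma coord_le_sqn: "j < d \<Longrightarrow> (x j)\<^sup>2 \<le> sqn d x"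
  unfolding sqn_sum by (rule member_le_sum) auto

text \<open>\<open>argminV\<close> is a choice and carries information only if a minimizer exists.
  Strong convexity at midpoints makes a minimizing sequence Cauchy in each coordinate, and lower
  semicontinuity of \<open>h\<close> gives the bound at the limit.\<close>

lemma prox_obj_attained:
  assumes c: "c > 0"
  shows "\<exists>y\<in>dm. \<forall>w\<in>dm. prox_obj c p v y \<le> prox_obj c p v w"
proof -
  let ?F = "prox_obj c p v"
  define I where "I = Inf (?F ` dm)"
  obtain B where B: "\<forall>w\<in>dm. B \<le> ?F w" using prox_obj_bounded_below[OF c] by blast
  have bdd: "bdd_below (?F ` dm)" using B by (auto intro: bdd_belowI2)
  have I_le: "I \<le> ?F w" if "w \<in> dm" for w unfolding I_def using bdd that by (intro cInf_lower) auto
  have "\<exists>w\<in>dm. ?F w < I + 1 / real (Suc k)" for k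
  proof -
    have "Inf (?F ` dm) < I + 1 / real (Suc k)" by (simp add: I_def)
    then show ?thesis using cInf_less_iff[OF _ bdd] dm_nonempty by auto
  qed
  then obtain W where W: "\<And>k. W k \<in> dm" "\<And>k. ?F (W k) < I + 1 / real (Suc k)" by metis
  have close: "sqn d (vdiff (W k) (W l)) \<le> 4 / c * (1 / real (Suc N))" if "N \<le> k" "N \<le> l" for k l N
  proof -
    define z where "z = (\<lambda>j. (1 - 1 / 2) * W k j + 1 / 2 * W l j)"
    have z: "z \<in> dm" unfolding z_def by (rule conv_fun_onD(1)[OF hr_conv W(1) W(1)]) auto
    have "1 / real (Suc k) \<le> 1 / real (Suc N)" "1 / real (Suc l) \<le> 1 / real (Suc N)"
      using that by (auto intro!: divide_left_mono)
    then have "?F (W k) \<le> I + 1 / real (Suc N)" "?F (W l) \<le> I + 1 / real (Suc N)"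
      using W(2)[of k] W(2)[of l] by linarith+
    moreover have "?F z \<le> ?F (W k) / 2 + ?F (W l) / 2 - c * sqn d (vdiff (W k) (W l)) / 4"
    proof -
      have "?F z \<le> (1 - 1 / 2) * ?F (W k) + 1 / 2 * ?F (W l) - c * (1 / 2) * (1 - 1 / 2) * sqn d (vdiff (W k) (W l))"
        unfolding z_def by (rule prox_obj_strong[OF W(1) W(1)]) auto
      then show ?thesis by simp
    qed
    ultimately have "c * sqn d (vdiff (W k) (W l)) / 4 \<le> 1 / real (Suc N)" using I_le[OF z] by linarith
    then have "4 / c * (c * sqn d (vdiff (W k) (W l)) / 4) \<le> 4 / c * (1 / real (Suc N))"
      using c by (intro mult_left_mono) auto
    then show ?thesis using c by simp
  qed
  have coordlim: "\<exists>l. (\<lambda>k. W k j) \<longlonglongrightarrow> l" if j: "j < d" for j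
  proof -
    have "Cauchy (\<lambda>k. W k j)"
    proof (rule metric_CauchyI)
      fix e :: real assume e: "e > 0"
      obtain N where N: "4 / c / e\<^sup>2 < real N" using reals_Archimedean2 by blast
      have "dist (W k j) (W l j) < e" if "k \<ge> N" "l \<ge> N" for k l
      proof -
        have "(W k j - W l j)\<^sup>2 \<le> sqn d (vdiff (W k) (W l))" using coord_le_sqn[OF j, of "vdiff (W k) (W l)"] by (simp add: vdiff_def)
        also have "\<dots> \<le> 4 / c * (1 / real (Suc N))" by (rule close) (use that in auto)
        also have "\<dots> < e\<^sup>2"
        proof -
          have "e\<^sup>2 > 0" using e by simp
          then have "4 / c < real N * e\<^sup>2" using N by (simp only: pos_divide_less_eq)
          also have "\<dots> \<le> real (Suc N) * e\<^sup>2" by (intro mult_right_mono) auto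
          finally have "4 / c / real (Suc N) < e\<^sup>2"
            by (subst pos_divide_less_eq) (simp_all add: mult.commute)
          then show ?thesis by simp
        qed
        finally have "\<bar>W k j - W l j\<bar> < \<bar>e\<bar>" by (metis linorder_not_less abs_le_square_iff)
        then show ?thesis using e by (simp add: dist_real_def)
      qed
      then show "\<exists>M. \<forall>m\<ge>M. \<forall>n\<ge>M. dist (W m j) (W n j) < e" by blast
    qed
    then show ?thesis by (simp add: Cauchy_convergent_iff convergent_def)
  qed
  then obtain l where l: "\<And>j. j < d \<Longrightarrow> (\<lambda>k. W k j) \<longlonglongrightarrow> l j" by metis
  define y where "y j = (if j < d then l j else 0)" for j
  have yV: "y \<in> Vd d" by (simp add: Vd_def y_def)
  have lim: "(\<lambda>k. W k j) \<longlonglongrightarrow> y j" if "j < d" for j using l[OF that] that by (simp add: y_def)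
  define q where "q = c * sqn d (vdiff y p) + ip d v y"
  have qlim: "(\<lambda>k. c * sqn d (vdiff (W k) p) + ip d v (W k)) \<longlonglongrightarrow> q"
    unfolding q_def sqn_sum ip_def vdiff_def by (intro tendsto_intros lim) auto
  have dlim: "(\<lambda>k. nrm d (\<lambda>j. W k j - y j)) \<longlonglongrightarrow> 0"
  proof -
    have "(\<lambda>k. \<Sum>j<d. (W k j - y j) * (W k j - y j)) \<longlonglongrightarrow> (\<Sum>j<d. (y j - y j) * (y j - y j))"
      by (intro tendsto_intros lim) auto
    then have "(\<lambda>k. sqrt (\<Sum>j<d. (W k j - y j) * (W k j - y j))) \<longlonglongrightarrow> sqrt (\<Sum>j<d. (y j - y j) * (y j - y j))"
      by (rule tendsto_real_sqrt)
    then show ?thesis by (simp add: nrm_def ip_def)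
  qed
  have upper: "c' \<le> I - q" if c': "ereal c' < h y" for c'
  proof -
    obtain r where r: "r > 0" "\<And>w. w \<in> Vd d \<Longrightarrow> nrm d (\<lambda>j. w j - y j) < r \<Longrightarrow> ereal c' < h w"
      using h_reg yV c' unfolding proper_convex_lsc_def by blast
    have "\<forall>\<^sub>F k in sequentially. nrm d (\<lambda>j. W k j - y j) < r" using order_tendstoD(2)[OF dlim r(1)] .
    then have ev: "\<forall>\<^sub>F k in sequentially. c' \<le> I + 1 / real (Suc k) - (c * sqn d (vdiff (W k) p) + ip d v (W k))"
    proof eventually_elim
      case (elim k)
      have "ereal c' < h (W k)" using r(2)[OF dm_Vd[OF W(1)] elim] .
      then have "c' < hr (W k)" by (simp add: h_hr[OF W(1)])
      then show ?case using W(2)[of k] unfolding prox_obj_def by linarith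
    qed
    have "(\<lambda>k. I + 1 / real (Suc k) - (c * sqn d (vdiff (W k) p) + ip d v (W k))) \<longlonglongrightarrow> I + 0 - q"
      by (intro tendsto_intros qlim LIMSEQ_Suc[OF lim_1_over_n])
    from tendsto_lowerbound[OF this ev] show ?thesis by simp
  qed
  have "h y \<le> ereal (I - q)"
  proof (rule ccontr)
    assume "\<not> ?thesis"
    then have "ereal (I - q) < h y" by simp
    then obtain b where b: "ereal (I - q) < ereal b" "ereal b < h y" using ereal_dense2 by blast
    then show False using upper[OF b(2)] by simp
  qed
  then have hle: "h y \<le> ereal (I - q)" .
  then have "y \<in> dm" using yV by (auto simp: dm_def)
  moreover from this have "hr y \<le> I - q" using hle h_hr[of y] by simp
  ultimately have "y \<in> dm" "hr y \<le> I - q" by auto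
  then have "y \<in> dm" "?F y \<le> I" by (auto simp: prox_obj_def q_def)
  then show ?thesis using I_le by (intro bexI[of _ y]) (auto intro: order_trans)
qed

text \<open>The quadratic growth comes from comparing \<open>y\<close> with the points
  \<open>(1 - t) y + t w\<close>, dividing by \<open>t\<close> and letting \<open>t\<close> tend to
  0.\<close>

lemma argmin_prox:
  fixes p v :: rvec
  assumes c: "c > 0"
  defines "y \<equiv> argminV d (\<lambda>w. ereal (c * (nrm d (\<lambda>j. w j - p j))\<^sup>2 + ip d v w) + h w)"
  shows "y \<in> dm"
    and "w \<in> dm \<Longrightarrow> prox_obj c p v y + c * sqn d (vdiff w y) \<le> prox_obj c p v w"
proof -
  let ?Fe = "\<lambda>w. ereal (c * (nrm d (\<lambda>j. w j - p j))\<^sup>2 + ip d v w) + h w"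
  have Fe: "?Fe w = ereal (prox_obj c p v w)" if "w \<in> dm" for w
    using h_hr[OF that] by (simp add: prox_obj_def nrm_sq vdiff_def)
  have Fi: "?Fe w = \<infinity>" if "w \<in> Vd d" "w \<notin> dm" for w
    using that by (simp add: dm_def)
  obtain y0 where y0: "y0 \<in> dm" "\<forall>w\<in>dm. prox_obj c p v y0 \<le> prox_obj c p v w" using prox_obj_attained[OF c] by blast
  have "y \<in> Vd d \<and> (\<forall>w\<in>Vd d. ?Fe y \<le> ?Fe w)"
    unfolding y_def argminV_def
  proof (rule someI[where P = "\<lambda>y. y \<in> Vd d \<and> (\<forall>w\<in>Vd d. ?Fe y \<le> ?Fe w)" and x = y0])
    show "y0 \<in> Vd d \<and> (\<forall>w\<in>Vd d. ?Fe y0 \<le> ?Fe w)"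
    proof (intro conjI ballI)
      show "y0 \<in> Vd d" using y0 by (simp add: dm_Vd)
      fix w assume w: "w \<in> Vd d"
      show "?Fe y0 \<le> ?Fe w"
      proof (cases "w \<in> dm")
        case True
        then show ?thesis unfolding Fe[OF y0(1)] Fe[OF True] using y0(2) by simp
      next
        case False
        then show ?thesis using Fi[OF w] by simp
      qed
    qed
  qed
  then have y: "y \<in> Vd d" "\<And>w. w \<in> Vd d \<Longrightarrow> ?Fe y \<le> ?Fe w" by auto
  show ydm: "y \<in> dm"
  proof (rule ccontr)
    assume "y \<notin> dm"
    then have "?Fe y = \<infinity>" using Fi y(1) by blast
    then show False using y(2)[OF dm_Vd[OF xs_dm]] Fe[OF xs_dm] by simp
  qed
  have opt: "prox_obj c p v y \<le> prox_obj c p v w" if "w \<in> dm" for w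
    using y(2)[OF dm_Vd[OF that]] unfolding Fe[OF that] Fe[OF ydm] by simp
  show "prox_obj c p v y + c * sqn d (vdiff w y) \<le> prox_obj c p v w" if w: "w \<in> dm"
  proof -
    define q where "q = sqn d (vdiff y w)"
    have *: "c * (1 - t) * q \<le> prox_obj c p v w - prox_obj c p v y" if t: "0 < t" "t \<le> 1" for t
    proof -
      have z: "(\<lambda>j. (1 - t) * y j + t * w j) \<in> dm" using conv_fun_onD(1)[OF hr_conv ydm w, of t] t by simp
      have "prox_obj c p v y \<le> (1 - t) * prox_obj c p v y + t * prox_obj c p v w - c * t * (1 - t) * q"
        using opt[OF z] prox_obj_strong[OF ydm w, of t c p v] t unfolding q_def by simp
      then have "t * (c * (1 - t) * q) \<le> t * (prox_obj c p v w - prox_obj c p v y)" by (simp add: algebra_simps)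
      then show ?thesis using t by simp
    qed
    have "((\<lambda>t. c * (1 - t) * q) \<longlongrightarrow> c * (1 - 0) * q) (at_right 0)"
      by (intro tendsto_intros)
    moreover have "\<forall>\<^sub>F t in at_right 0. c * (1 - t) * q \<le> prox_obj c p v w - prox_obj c p v y"
      unfolding eventually_at_right_field by (intro exI[of _ 1]) (auto intro: *)
    ultimately have "c * (1 - 0) * q \<le> prox_obj c p v w - prox_obj c p v y"
      by (rule tendsto_upperbound) simp
    then show ?thesis by (simp add: q_def sqn_swap[of d w y])
  qed
qed

end

section \<open>Sampling and quantization\<close>

abbreviation E :: "'a pmf \<Rightarrow> ('a \<Rightarrow> real) \<Rightarrow> real" where
  "E q f \<equiv> measure_pmf.expectation q f"

text \<open>All distributions of the algorithm have finite support, so the rules for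
  \<open>E\<close> ask for finiteness instead of integrability.\<close>

lemma E_bind:
  assumes "finite (set_pmf q)" "\<And>x. x \<in> set_pmf q \<Longrightarrow> finite (set_pmf (r x))"
  shows "E (bind_pmf q r) f = E q (\<lambda>x. E (r x) f)"
proof -
  have "E (bind_pmf q r) f = (\<Sum>a\<in>set_pmf q. pmf q a *\<^sub>R E (r a) f)"
    by (rule pmf_expectation_bind) (use assms in auto)
  also have "\<dots> = E q (\<lambda>x. E (r x) f)"
    by (subst integral_measure_pmf_real[of "set_pmf q"]) (use assms in \<open>auto simp: mult.commute\<close>)
  finally show ?thesis .
qed

lemma E_mono:
  assumes "finite (set_pmf q)" "\<And>x. x \<in> set_pmf q \<Longrightarrow> f x \<le> g x"
  shows "E q f \<le> E q g"
  by (intro integral_mono_AE integrable_measure_pmf_finite assms(1)) (simp add: AE_measure_pmf_iff assms(2))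

lemma E_cong: "(\<And>x. x \<in> set_pmf q \<Longrightarrow> f x = g x) \<Longrightarrow> E q f = E q g"
  by (intro integral_cong_AE) (auto simp: AE_measure_pmf_iff)

lemma E_add: "finite (set_pmf q) \<Longrightarrow> E q (\<lambda>x. f x + g x) = E q f + E q g"
  by (intro Bochner_Integration.integral_add integrable_measure_pmf_finite)

lemma E_diff: "finite (set_pmf q) \<Longrightarrow> E q (\<lambda>x. f x - g x) = E q f - E q g"
  by (intro Bochner_Integration.integral_diff integrable_measure_pmf_finite)

lemma E_sum: "finite (set_pmf q) \<Longrightarrow> E q (\<lambda>x. \<Sum>j\<in>J. f j x) = (\<Sum>j\<in>J. E q (f j))"
  by (intro Bochner_Integration.integral_sum integrable_measure_pmf_finite)

lemma E_const: "E q (\<lambda>_. c) = c"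
  by simp

lemma E_nonneg: "(\<And>x. x \<in> set_pmf q \<Longrightarrow> 0 \<le> f x) \<Longrightarrow> 0 \<le> E q f"
  by (intro integral_nonneg_AE) (simp add: AE_measure_pmf_iff)

text \<open>Cauchy-Schwarz against the constant 1.\<close>

lemma sum_list_sq_le:
  fixes g :: "'a \<Rightarrow> real"
  shows "(\<Sum>x\<leftarrow>xs. g x)\<^sup>2 \<le> real (length xs) * (\<Sum>x\<leftarrow>xs. (g x)\<^sup>2)"
proof (induction xs)
  case Nil
  then show ?case by simp
next
  case (Cons a xs)
  define s n q where "s = (\<Sum>x\<leftarrow>xs. g x)" and "n = real (length xs)" and "q = (\<Sum>x\<leftarrow>xs. (g x)\<^sup>2)"
  have IH: "s\<^sup>2 \<le> n * q" using Cons by (simp add: s_def n_def q_def)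
  have q: "q \<ge> 0" unfolding q_def by (induction xs) auto
  have "2 * (g a * s) \<le> n * (g a)\<^sup>2 + q"
  proof (cases "n = 0")
    case True
    then have "s = 0" using IH by simp
    then show ?thesis using True q by simp
  next
    case False
    then have n: "n > 0" by (simp add: n_def)
    have "0 \<le> (n * g a - s)\<^sup>2 / n" using n by simp
    also have "\<dots> = n * (g a)\<^sup>2 - 2 * (g a * s) + s\<^sup>2 / n" using n by (simp add: field_simps power2_eq_square)
    also have "s\<^sup>2 / n \<le> q" using IH n by (simp add: field_simps)
    finally show ?thesis by simp
  qed
  then have "(g a + s)\<^sup>2 \<le> (1 + n) * ((g a)\<^sup>2 + q)" using IH by (simp add: power2_eq_square algebra_simps)
  then show ?case by (simp add: s_def n_def q_def)
qed

section \<open>Moments of minibatch averages\<close>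

definition mean :: "nat \<Rightarrow> (nat \<Rightarrow> real) \<Rightarrow> real" where
  "mean n \<psi> = (1 / real n) * (\<Sum>a=1..n. \<psi> a)"

context
  fixes n :: nat
  assumes n: "n \<ge> 1"
begin

lemma index_set: "{1..n} \<noteq> {}" "finite {1..n}" using n by auto

lemma set_index: "set_pmf (pmf_of_set {Suc 0..n}) = {Suc 0..n}"
  using set_pmf_of_set[OF index_set] by simp

lemma finite_samples: "finite (set_pmf (samples n k))"
  by (induction k) (auto simp: set_index)

lemma length_samples: "I \<in> set_pmf (samples n k) \<Longrightarrow> length I = k"
  by (induction k arbitrary: I) auto

lemma E_samples_Suc: "E (samples n (Suc k)) f = mean n (\<lambda>a. E (samples n k) (\<lambda>l. f (a # l)))"
proof -
  have "E (samples n (Suc k)) f = E (pmf_of_set {1..n}) (\<lambda>a. E (samples n k) (\<lambda>l. f (a # l)))"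
    unfolding samples.simps by (subst E_bind) (auto simp: set_index finite_samples)
  also have "\<dots> = (\<Sum>a=1..n. E (samples n k) (\<lambda>l. f (a # l))) / real (card {1..n})"
    by (rule integral_pmf_of_set[OF index_set])
  finally show ?thesis by (simp add: mean_def)
qed

lemma mean_add: "mean n (\<lambda>a. f a + g a) = mean n f + mean n g"
  by (simp add: mean_def sum.distrib add_divide_distrib)

lemma mean_diff: "mean n (\<lambda>a. f a - g a) = mean n f - mean n g"
  by (simp add: mean_def sum_subtractf diff_divide_distrib)

lemma mean_cmult: "mean n (\<lambda>a. c * f a) = c * mean n f"
  by (simp add: mean_def sum_distrib_left[symmetric])

lemma mean_const: "mean n (\<lambda>a. c) = c"
  using n by (simp add: mean_def)

lemma mean_nonneg: "(\<And>a. f a \<ge> 0) \<Longrightarrow> mean n f \<ge> 0"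
  by (simp add: mean_def sum_nonneg)

lemma mean_sum: "mean n (\<lambda>a. \<Sum>j\<in>J. f a j) = (\<Sum>j\<in>J. mean n (\<lambda>a. f a j))"
  unfolding mean_def by (subst sum.swap) (simp add: sum_distrib_left)

lemma samples_mean: "E (samples n k) (\<lambda>I. \<Sum>a\<leftarrow>I. \<psi> a) = real k * mean n \<psi>"
proof (induction k)
  case (Suc k)
  have "E (samples n (Suc k)) (\<lambda>I. \<Sum>a\<leftarrow>I. \<psi> a) = mean n (\<lambda>a. \<psi> a + real k * mean n \<psi>)"
    unfolding E_samples_Suc sum_list.Cons list.map E_add[OF finite_samples] E_const Suc ..
  then show ?case by (simp add: mean_add mean_const algebra_simps)
qed simp

text \<open>The draws are independent and centred, so all cross terms vanish.\<close>

lemma samples_square: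
  assumes "mean n \<psi> = 0"
  shows "E (samples n k) (\<lambda>I. (\<Sum>a\<leftarrow>I. \<psi> a)\<^sup>2) = real k * mean n (\<lambda>a. (\<psi> a)\<^sup>2)"
proof (induction k)
  case (Suc k)
  have "E (samples n k) (\<lambda>I. (\<Sum>a\<leftarrow>b # I. \<psi> a)\<^sup>2) = (\<psi> b)\<^sup>2 + real k * mean n (\<lambda>a. (\<psi> a)\<^sup>2)" for b
  proof -
    have "E (samples n k) (\<lambda>I. (\<Sum>a\<leftarrow>b # I. \<psi> a)\<^sup>2)
        = E (samples n k) (\<lambda>I. ((\<psi> b)\<^sup>2 + 2 * \<psi> b * (\<Sum>a\<leftarrow>I. \<psi> a)) + (\<Sum>a\<leftarrow>I. \<psi> a)\<^sup>2)"
      by (simp add: power2_sum algebra_simps)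
    also have "\<dots> = (\<psi> b)\<^sup>2 + 2 * \<psi> b * E (samples n k) (\<lambda>I. \<Sum>a\<leftarrow>I. \<psi> a) + E (samples n k) (\<lambda>I. (\<Sum>a\<leftarrow>I. \<psi> a)\<^sup>2)"
      by (simp add: E_add[OF finite_samples])
    finally show ?thesis by (simp add: samples_mean assms Suc)
  qed
  then have "E (samples n (Suc k)) (\<lambda>I. (\<Sum>a\<leftarrow>I. \<psi> a)\<^sup>2) = mean n (\<lambda>b. (\<psi> b)\<^sup>2 + real k * mean n (\<lambda>a. (\<psi> a)\<^sup>2))"
    unfolding E_samples_Suc by simp
  then show ?case by (simp add: mean_add mean_const algebra_simps)
qed simp

lemma mean_square_le: "(mean n \<phi>)\<^sup>2 \<le> mean n (\<lambda>a. (\<phi> a)\<^sup>2)"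
proof -
  have "0 \<le> mean n (\<lambda>a. (\<phi> a - mean n \<phi>)\<^sup>2)" by (intro mean_nonneg) simp
  also have "\<dots> = mean n (\<lambda>a. ((\<phi> a)\<^sup>2 - 2 * mean n \<phi> * \<phi> a) + (mean n \<phi>)\<^sup>2)"
    by (simp add: power2_diff algebra_simps)
  also have "\<dots> = mean n (\<lambda>a. (\<phi> a)\<^sup>2) - (mean n \<phi>)\<^sup>2"
    unfolding mean_add mean_diff mean_cmult mean_const by (simp add: power2_eq_square)
  finally show ?thesis by simp
qed

lemma batch_variance:
  assumes B: "B \<ge> 1"
  shows "E (samples n B) (\<lambda>I. ((1 / real B) * (\<Sum>a\<leftarrow>I. \<phi> a) - mean n \<phi>)\<^sup>2)
    = (1 / real B) * (mean n (\<lambda>a. (\<phi> a)\<^sup>2) - (mean n \<phi>)\<^sup>2)"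
proof -
  define \<psi> where "\<psi> a = \<phi> a - mean n \<phi>" for a
  have m0: "mean n \<psi> = 0" unfolding \<psi>_def mean_diff mean_const by simp
  have sl: "(\<Sum>a\<leftarrow>I. \<psi> a) = (\<Sum>a\<leftarrow>I. \<phi> a) - real (length I) * mean n \<phi>" for I
    by (induction I) (simp_all add: \<psi>_def algebra_simps)
  have "E (samples n B) (\<lambda>I. ((1 / real B) * (\<Sum>a\<leftarrow>I. \<phi> a) - mean n \<phi>)\<^sup>2)
      = E (samples n B) (\<lambda>I. (1 / real B)\<^sup>2 * (\<Sum>a\<leftarrow>I. \<psi> a)\<^sup>2)"
  proof (rule E_cong)
    fix I assume "I \<in> set_pmf (samples n B)"
    then have "length I = B" by (rule length_samples)
    then have "(1 / real B) * (\<Sum>a\<leftarrow>I. \<phi> a) - mean n \<phi> = (1 / real B) * (\<Sum>a\<leftarrow>I. \<psi> a)"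
      using B by (simp add: sl field_simps)
    then show "((1 / real B) * (\<Sum>a\<leftarrow>I. \<phi> a) - mean n \<phi>)\<^sup>2 = (1 / real B)\<^sup>2 * (\<Sum>a\<leftarrow>I. \<psi> a)\<^sup>2"
      by (simp only: power_mult_distrib)
  qed
  also have "\<dots> = (1 / real B)\<^sup>2 * (real B * mean n (\<lambda>a. (\<psi> a)\<^sup>2))"
    by (simp add: samples_square[OF m0])
  also have "\<dots> = (1 / real B) * mean n (\<lambda>a. (\<psi> a)\<^sup>2)" using B by (simp add: power2_eq_square)
  also have "mean n (\<lambda>a. (\<psi> a)\<^sup>2) = mean n (\<lambda>a. ((\<phi> a)\<^sup>2 - 2 * mean n \<phi> * \<phi> a) + (mean n \<phi>)\<^sup>2)"
    by (simp add: \<psi>_def power2_diff algebra_simps)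
  also have "\<dots> = mean n (\<lambda>a. (\<phi> a)\<^sup>2) - (mean n \<phi>)\<^sup>2"
    unfolding mean_add mean_diff mean_cmult mean_const by (simp add: power2_eq_square)
  finally show ?thesis .
qed

lemma batch_variance_le:
  assumes B: "B \<ge> 1"
  shows "E (samples n B) (\<lambda>I. ((1 / real B) * (\<Sum>a\<leftarrow>I. \<phi> a) - mean n \<phi>)\<^sup>2) \<le> (1 / real B) * mean n (\<lambda>a. (\<phi> a)\<^sup>2)"
  unfolding batch_variance[OF B] by (intro mult_left_mono) auto

lemma batch_mean:
  assumes B: "B \<ge> 1"
  shows "E (samples n B) (\<lambda>I. (1 / real B) * (\<Sum>a\<leftarrow>I. \<phi> a)) = mean n \<phi>"
  using B by (simp add: samples_mean)

text \<open>Variance plus squared mean, with the gain 1/B in the variance given away. This is the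
  form needed for the quantization error, which scales with the sampled vector itself and not with
  its deviation from the mean.\<close>

lemma batch_second_moment:
  assumes B: "B \<ge> 1"
  shows "E (samples n B) (\<lambda>I. ((1 / real B) * (\<Sum>a\<leftarrow>I. \<phi> a))\<^sup>2) \<le> mean n (\<lambda>a. (\<phi> a)\<^sup>2)"
proof -
  define \<mu> where "\<mu> = mean n \<phi>"
  define X where "X I = (1 / real B) * (\<Sum>a\<leftarrow>I. \<phi> a)" for I
  have EX: "E (samples n B) X = \<mu>" unfolding X_def \<mu>_def by (rule batch_mean[OF B])
  have "E (samples n B) (\<lambda>I. (X I)\<^sup>2) = E (samples n B) (\<lambda>I. ((X I - \<mu>)\<^sup>2 + 2 * \<mu> * X I) - \<mu>\<^sup>2)"
    by (simp add: power2_diff algebra_simps)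
  also have "\<dots> = E (samples n B) (\<lambda>I. (X I - \<mu>)\<^sup>2) + 2 * \<mu> * E (samples n B) X - \<mu>\<^sup>2"
    by (simp add: E_add[OF finite_samples] E_diff[OF finite_samples])
  also have "\<dots> = (1 / real B) * (mean n (\<lambda>a. (\<phi> a)\<^sup>2) - \<mu>\<^sup>2) + \<mu>\<^sup>2"
    using batch_variance[OF B, of \<phi>] EX by (simp add: X_def \<mu>_def power2_eq_square)
  also have "\<dots> \<le> 1 * (mean n (\<lambda>a. (\<phi> a)\<^sup>2) - \<mu>\<^sup>2) + \<mu>\<^sup>2"
    using B mean_square_le[of \<phi>] by (intro add_mono mult_right_mono) (auto simp: \<mu>_def)
  finally show ?thesis by (simp add: X_def)
qed

end

section \<open>Quantization error\<close>

lemma finite_Qs: "finite (set_pmf (Qs \<delta> b y))"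
  by (simp add: Qs_def Let_def)

lemma finite_Qv: "finite (set_pmf (Qv \<delta> b k u))"
  by (induction k) (auto simp: finite_Qs)

lemma Qv_error: "E (Qv \<delta> b k u) (\<lambda>q. \<Sum>j<k. (q j - u j)\<^sup>2) = (\<Sum>j<k. E (Qs \<delta> b (u j)) (\<lambda>c. (c - u j)\<^sup>2))"
proof (induction k)
  case (Suc k)
  have "E (Qv \<delta> b (Suc k) u) (\<lambda>q. \<Sum>j<Suc k. (q j - u j)\<^sup>2)
      = E (Qv \<delta> b k u) (\<lambda>q. E (Qs \<delta> b (u k)) (\<lambda>c. \<Sum>j<Suc k. ((q(k := c)) j - u j)\<^sup>2))"
    unfolding Qv.simps by (subst E_bind) (auto simp: finite_Qs finite_Qv)
  also have "\<dots> = E (Qv \<delta> b k u) (\<lambda>q. (\<Sum>j<k. (q j - u j)\<^sup>2) + E (Qs \<delta> b (u k)) (\<lambda>c. (c - u k)\<^sup>2))"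
  proof (rule E_cong)
    fix q :: rvec
    have "(\<Sum>j<Suc k. ((q(k := c)) j - u j)\<^sup>2) = (\<Sum>j<k. (q j - u j)\<^sup>2) + (c - u k)\<^sup>2" for c by simp
    then show "E (Qs \<delta> b (u k)) (\<lambda>c. \<Sum>j<Suc k. ((q(k := c)) j - u j)\<^sup>2)
        = (\<Sum>j<k. (q j - u j)\<^sup>2) + E (Qs \<delta> b (u k)) (\<lambda>c. (c - u k)\<^sup>2)"
      by (simp only: E_add[OF finite_Qs] E_const)
  qed
  finally show ?case by (simp add: E_add[OF finite_Qv] Suc)
qed simp

text \<open>With \<theta> the distance from the grid point below, the mean squared error of the
  two-point law is \<theta> (\<delta> - \<theta>), largest at \<theta> = \<delta>/2.\<close>

lemma Qs_error_inside:
  assumes d: "\<delta> > 0" and lo: "\<not> y < - ((2::real) ^ (b - 1)) * \<delta>" and hi: "\<not> y > ((2::real) ^ (b - 1) - 1) * \<delta>"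
  shows "E (Qs \<delta> b y) (\<lambda>c. (c - y)\<^sup>2) \<le> \<delta>\<^sup>2 / 4"
proof -
  define z where "z = \<delta> * of_int \<lfloor>y / \<delta>\<rfloor>"
  define \<theta> where "\<theta> = y - z"
  have "of_int \<lfloor>y / \<delta>\<rfloor> \<le> y / \<delta>" "y / \<delta> < of_int \<lfloor>y / \<delta>\<rfloor> + 1" by linarith+
  then have "of_int \<lfloor>y / \<delta>\<rfloor> * \<delta> \<le> y" "y < (of_int \<lfloor>y / \<delta>\<rfloor> + 1) * \<delta>"
    using d by (simp_all only: pos_le_divide_eq pos_divide_less_eq)
  then have th: "0 \<le> \<theta>" "\<theta> < \<delta>" by (simp_all add: \<theta>_def z_def algebra_simps)
  define pr where "pr = (z + \<delta> - y) / \<delta>"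
  have pr: "0 \<le> pr" "pr \<le> 1" using th d by (auto simp: pr_def \<theta>_def field_simps)
  have "Qs \<delta> b y = map_pmf (\<lambda>c. if c then z else z + \<delta>) (bernoulli_pmf pr)"
    unfolding Qs_def Let_def pr_def z_def using d lo hi by simp
  then have "E (Qs \<delta> b y) (\<lambda>c. (c - y)\<^sup>2) = pr * (z - y)\<^sup>2 + (1 - pr) * (z + \<delta> - y)\<^sup>2"
    using pr by simp
  also have "\<dots> = \<theta> * (\<delta> - \<theta>)"
    using d unfolding pr_def \<theta>_def by (simp add: field_simps power2_eq_square)
  also have "\<dots> \<le> \<delta>\<^sup>2 / 4"
  proof -
    have "0 \<le> (\<delta> / 2 - \<theta>)\<^sup>2" by simp
    also have "\<dots> = \<delta>\<^sup>2 / 4 - \<theta> * (\<delta> - \<theta>)" by (simp add: field_simps power2_eq_square)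
    finally show ?thesis by simp
  qed
  finally show ?thesis .
qed

lemma nrm_inf_ge: "j < d \<Longrightarrow> \<bar>u j\<bar> \<le> nrm_inf d u"
  unfolding nrm_inf_def by (rule Max_ge) auto

lemma nrm_inf_sq_le: "d \<ge> 1 \<Longrightarrow> (nrm_inf d u)\<^sup>2 \<le> sqn d u"
proof -
  assume d: "d \<ge> 1"
  have "nrm_inf d u \<in> (\<lambda>j. \<bar>u j\<bar>) ` {..<d}" unfolding nrm_inf_def
  proof (rule Max_in)
    have "0 \<in> {..<d}" using d by simp
    then show "(\<lambda>j. \<bar>u j\<bar>) ` {..<d} \<noteq> {}" by blast
  qed simp
  then obtain j where j: "j < d" "nrm_inf d u = \<bar>u j\<bar>" by auto
  have "(u j)\<^sup>2 \<le> sqn d u" unfolding sqn_sum using j by (intro member_le_sum) auto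
  then show ?thesis using j by simp
qed

definition quant_const :: "nat \<Rightarrow> real \<Rightarrow> nat \<Rightarrow> real \<Rightarrow> real" where
  "quant_const d lam b dl = real d * lam\<^sup>2 / (4 * ((2::real) ^ (b - 1) - 1)\<^sup>2) + dl * (1 - lam)\<^sup>2"

text \<open>A coordinate inside the grid range costs at most \<delta>^2/4. One outside is moved to
  an end of the range, at \<open>lam * M\<close> above or at \<open>- (lam * M + \<delta>)\<close>
  below, which costs at most \<open>((1 - lam) * M)\<^sup>2\<close> because no coordinate exceeds
  \<open>M\<close> in modulus. Both amounts are multiples of M^2, hence bounded by the squared
  norm.\<close>

lemma Qv_error_le:
  assumes d: "d \<ge> 1" and b: "b \<ge> 2" and lam: "0 < lam" "lam \<le> 1" and oc: "real (outside_count d lam b u) \<le> dl"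
  shows "E (Qv (delta_q d lam b u) b d u) (\<lambda>q. sqn d (vdiff q u)) \<le> quant_const d lam b dl * sqn d u"
proof -
  define M where "M = nrm_inf d u"
  define \<kappa> where "\<kappa> = (2::real) ^ (b - 1) - 1"
  define \<delta> where "\<delta> = delta_q d lam b u"
  define out where "out j \<longleftrightarrow> u j < - ((2::real) ^ (b - 1)) * \<delta> \<or> u j > ((2::real) ^ (b - 1) - 1) * \<delta>" for j
  have kap: "\<kappa> \<ge> 1"
  proof -
    have "(2::real) ^ 1 \<le> 2 ^ (b - 1)" using b by (intro power_increasing) auto
    then show ?thesis by (simp add: \<kappa>_def)
  qed
  have uM: "\<bar>u j\<bar> \<le> M" if "j < d" for j using nrm_inf_ge[OF that] by (simp add: M_def)
  have M0: "M \<ge> 0" using uM[of 0] d by linarith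
  have del: "\<delta> = lam * M / \<kappa>" by (simp add: \<delta>_def delta_q_def M_def \<kappa>_def)
  have del0: "\<delta> \<ge> 0" using del lam M0 kap by simp
  have kd: "\<kappa> * \<delta> = lam * M" using del kap by simp
  have tm: "E (Qs \<delta> b (u j)) (\<lambda>c. (c - u j)\<^sup>2) \<le> \<delta>\<^sup>2 / 4 + (if out j then ((1 - lam) * M)\<^sup>2 else 0)" if j: "j < d" for j
  proof (cases "\<delta> = 0")
    \<comment> \<open>A zero step size forces the vector to vanish, and then the default output 0 is
      exact.\<close>
    case True
    then have "M = 0" using del lam kap by simp
    then have "u j = 0" using uM[OF j] by simp
    then show ?thesis using True by (simp add: Qs_def)
  next
    case False
    then have dp: "\<delta> > 0" using del0 by simp
    show ?thesis
    proof (cases "out j")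
      case out: True
      have "E (Qs \<delta> b (u j)) (\<lambda>c. (c - u j)\<^sup>2) \<le> ((1 - lam) * M)\<^sup>2"
      proof (cases "u j < - ((2::real) ^ (b - 1)) * \<delta>")
        case True
        then have "E (Qs \<delta> b (u j)) (\<lambda>c. (c - u j)\<^sup>2) = (- ((2::real) ^ (b - 1)) * \<delta> - u j)\<^sup>2"
          using dp by (simp add: Qs_def)
        also have "\<dots> \<le> ((1 - lam) * M)\<^sup>2"
        proof (rule power_mono)
          have "(2::real) ^ (b - 1) * \<delta> = lam * M + \<delta>" using kd by (simp add: \<kappa>_def algebra_simps)
          then show "- ((2::real) ^ (b - 1)) * \<delta> - u j \<le> (1 - lam) * M" using uM[OF j] dp by (simp add: algebra_simps)
          show "0 \<le> - ((2::real) ^ (b - 1)) * \<delta> - u j" using True by simp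
        qed
        finally show ?thesis .
      next
        case lo: False
        then have hi: "u j > ((2::real) ^ (b - 1) - 1) * \<delta>" using out by (simp add: out_def)
        then have "E (Qs \<delta> b (u j)) (\<lambda>c. (c - u j)\<^sup>2) = (((2::real) ^ (b - 1) - 1) * \<delta> - u j)\<^sup>2"
          using dp lo by (simp add: Qs_def)
        also have "\<dots> = (u j - lam * M)\<^sup>2" using kd by (simp add: \<kappa>_def power2_commute)
        also have "\<dots> \<le> ((1 - lam) * M)\<^sup>2"
          using uM[OF j] hi kd by (intro power_mono) (auto simp: \<kappa>_def algebra_simps)
        finally show ?thesis .
      qed
      then show ?thesis using out by (simp add: add_increasing)
    next
      case out: False
      then show ?thesis using Qs_error_inside[OF dp, of "u j" b] by (simp add: out_def)
    qed
  qed
  have "E (Qv \<delta> b d u) (\<lambda>q. sqn d (vdiff q u)) = (\<Sum>j<d. E (Qs \<delta> b (u j)) (\<lambda>c. (c - u j)\<^sup>2))"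
    unfolding sqn_sum vdiff_def by (rule Qv_error)
  also have "\<dots> \<le> (\<Sum>j<d. \<delta>\<^sup>2 / 4 + (if out j then ((1 - lam) * M)\<^sup>2 else 0))"
    by (intro sum_mono tm) auto
  also have "\<dots> = real d * (\<delta>\<^sup>2 / 4) + real (card {j. j < d \<and> out j}) * ((1 - lam) * M)\<^sup>2"
  proof -
    have "(\<Sum>j<d. (if out j then ((1 - lam) * M)\<^sup>2 else 0)) = (\<Sum>j\<in>{j\<in>{..<d}. out j}. ((1 - lam) * M)\<^sup>2)"
      by (rule sum.inter_filter[symmetric]) simp
    also have "{j\<in>{..<d}. out j} = {j. j < d \<and> out j}" by auto
    finally show ?thesis by (simp add: sum.distrib)
  qed
  also have "card {j. j < d \<and> out j} = outside_count d lam b u"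
    unfolding outside_count_def out_def \<delta>_def ..
  also have "real d * (\<delta>\<^sup>2 / 4) + real (outside_count d lam b u) * ((1 - lam) * M)\<^sup>2
      \<le> real d * (\<delta>\<^sup>2 / 4) + dl * ((1 - lam) * M)\<^sup>2"
    using oc by (intro add_left_mono mult_right_mono) auto
  also have "\<dots> = quant_const d lam b dl * M\<^sup>2"
    unfolding quant_const_def del \<kappa>_def[symmetric] by (simp add: power_mult_distrib power_divide distrib_right)
  also have "\<dots> \<le> quant_const d lam b dl * sqn d u"
  proof (rule mult_left_mono)
    show "M\<^sup>2 \<le> sqn d u" unfolding M_def by (rule nrm_inf_sq_le[OF d])
    have "dl \<ge> 0" using oc by (rule order_trans[rotated]) simp
    then show "0 \<le> quant_const d lam b dl" by (simp add: quant_const_def)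
  qed
  finally show ?thesis by (simp add: \<delta>_def)
qed

section \<open>One round of the workers\<close>

lemma length_workers: "W \<in> set_pmf (workers n gr d B lam b x xt i) \<Longrightarrow> length W = i"
  by (induction i arbitrary: W) (auto simp: Let_def)

text \<open>The bound on the number of outside coordinates is assumed for vectors recorded in a run.
  As every possible batch can be drawn by a worker, it transfers to all batches
  (\<open>few_H\<close>).\<close>

lemma sampled_in_round:
  assumes N: "N \<ge> 1" and I: "I \<in> set_pmf (samples n B)"
  shows "\<exists>W\<in>set_pmf (workers n gr d B lam b x xt N).
    (\<lambda>j. (1 / real B) * (\<Sum>a\<leftarrow>I. gr a x j - gr a xt j)) \<in> fst ` set W"
proof -
  define u where "u = (\<lambda>j. (1 / real B) * (\<Sum>a\<leftarrow>I. gr a x j - gr a xt j))"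
  obtain i where i: "N = Suc i" using N by (cases N) auto
  obtain W0 where W0: "W0 \<in> set_pmf (workers n gr d B lam b x xt i)"
    using set_pmf_not_empty[of "workers n gr d B lam b x xt i"] by blast
  obtain q where q: "q \<in> set_pmf (Qv (delta_q d lam b u) b d u)"
    using set_pmf_not_empty[of "Qv (delta_q d lam b u) b d u"] by blast
  have "W0 @ [(u, q)] \<in> set_pmf (workers n gr d B lam b x xt N)"
    unfolding i using W0 q I by (auto simp: Let_def u_def)
  then show ?thesis unfolding u_def by (intro bexI[of _ "W0 @ [(u, q)]"]) (auto simp: u_def)
qed

locale worker_round =
  fixes n d N B b :: nat and lam dl :: real and gr :: "nat \<Rightarrow> rvec \<Rightarrow> rvec" and x xt :: rvec
  assumes n: "n \<ge> 1" and d: "d \<ge> 1" and N: "N \<ge> 1" and B: "B \<ge> 1" and b: "b \<ge> 2"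
    and lam: "0 < lam" "lam \<le> 1"
    and few_outside: "\<And>I. I \<in> set_pmf (samples n B) \<Longrightarrow>
      real (outside_count d lam b (\<lambda>j. (1 / real B) * (\<Sum>a\<leftarrow>I. gr a x j - gr a xt j))) \<le> dl"
begin

definition uv :: "nat list \<Rightarrow> rvec" where
  "uv I = (\<lambda>j. (1 / real B) * (\<Sum>a\<leftarrow>I. gr a x j - gr a xt j))"

definition gd :: rvec where "gd = (\<lambda>j. mean n (\<lambda>a. gr a x j - gr a xt j))"

definition s2 :: real where "s2 = mean n (\<lambda>a. sqn d (vdiff (gr a x) (gr a xt)))"

abbreviation wk :: "nat \<Rightarrow> (rvec \<times> rvec) list pmf" where
  "wk \<equiv> workers n gr d B lam b x xt"

lemma wk_Suc: "wk (Suc i) = bind_pmf (wk i) (\<lambda>W. bind_pmf (samples n B) (\<lambda>I.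
    map_pmf (\<lambda>q. W @ [(uv I, q)]) (Qv (delta_q d lam b (uv I)) b d (uv I))))"
  by (simp add: Let_def uv_def)

lemma finite_wk: "finite (set_pmf (wk i))"
  by (induction i) (auto simp: wk_Suc finite_samples[OF n] finite_Qv simp del: workers.simps(2))

lemma E_wk_Suc: "E (wk (Suc i)) F = E (wk i) (\<lambda>W. E (samples n B) (\<lambda>I.
    E (Qv (delta_q d lam b (uv I)) b d (uv I)) (\<lambda>q. F (W @ [(uv I, q)]))))"
proof -
  have fin: "finite (set_pmf (bind_pmf (samples n B) (\<lambda>I. map_pmf (\<lambda>q. W @ [(uv I, q)]) (Qv (delta_q d lam b (uv I)) b d (uv I)))))" for W
    by (auto simp: finite_samples[OF n] finite_Qv)
  show ?thesis
    unfolding wk_Suc E_bind[OF finite_wk fin]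
    by (subst E_bind) (auto simp: finite_samples[OF n] finite_Qv)
qed

lemma uv_second_moment: "E (samples n B) (\<lambda>I. sqn d (uv I)) \<le> s2"
proof -
  have "E (samples n B) (\<lambda>I. sqn d (uv I)) = (\<Sum>j<d. E (samples n B) (\<lambda>I. (uv I j)\<^sup>2))"
    unfolding sqn_sum by (rule E_sum[OF finite_samples[OF n]])
  also have "\<dots> \<le> (\<Sum>j<d. mean n (\<lambda>a. (gr a x j - gr a xt j)\<^sup>2))"
    unfolding uv_def by (intro sum_mono batch_second_moment[OF n B])
  also have "\<dots> = s2" unfolding s2_def sqn_sum vdiff_def mean_sum[OF n] ..
  finally show ?thesis .
qed

lemma uv_variance: "E (samples n B) (\<lambda>I. sqn d (vdiff (uv I) gd)) \<le> (1 / real B) * s2"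
proof -
  have "E (samples n B) (\<lambda>I. sqn d (vdiff (uv I) gd)) = (\<Sum>j<d. E (samples n B) (\<lambda>I. (uv I j - gd j)\<^sup>2))"
    unfolding sqn_sum vdiff_def by (rule E_sum[OF finite_samples[OF n]])
  also have "\<dots> \<le> (\<Sum>j<d. (1 / real B) * mean n (\<lambda>a. (gr a x j - gr a xt j)\<^sup>2))"
    unfolding uv_def gd_def by (intro sum_mono batch_variance_le[OF n B])
  also have "\<dots> = (1 / real B) * s2"
    unfolding s2_def sqn_sum vdiff_def mean_sum[OF n] sum_distrib_left ..
  finally show ?thesis .
qed

lemma uv_mean: "E (samples n B) (\<lambda>I. uv I j) = gd j"
  unfolding uv_def gd_def by (rule batch_mean[OF n B])

lemma dl_nonneg: "dl \<ge> 0"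
proof -
  obtain I where "I \<in> set_pmf (samples n B)" using set_pmf_not_empty[of "samples n B"] by blast
  then show ?thesis using few_outside[of I] by (rule_tac order_trans[rotated]) auto
qed

lemma quant_const_nonneg: "quant_const d lam b dl \<ge> 0"
  using dl_nonneg by (simp add: quant_const_def)

lemma wk_quantization: "E (wk i) (\<lambda>W. \<Sum>p\<leftarrow>W. sqn d (vdiff (snd p) (fst p))) \<le> real i * (quant_const d lam b dl * s2)"
proof (induction i)
  case 0
  then show ?case by simp
next
  case (Suc i)
  let ?q = "quant_const d lam b dl"
  have inner: "E (samples n B) (\<lambda>I. E (Qv (delta_q d lam b (uv I)) b d (uv I)) (\<lambda>q. sqn d (vdiff q (uv I)))) \<le> ?q * s2"
  proof -
    have "E (samples n B) (\<lambda>I. E (Qv (delta_q d lam b (uv I)) b d (uv I)) (\<lambda>q. sqn d (vdiff q (uv I))))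
        \<le> E (samples n B) (\<lambda>I. ?q * sqn d (uv I))"
    proof (rule E_mono[OF finite_samples[OF n]])
      fix I assume "I \<in> set_pmf (samples n B)"
      then have "real (outside_count d lam b (uv I)) \<le> dl" unfolding uv_def by (rule few_outside)
      then show "E (Qv (delta_q d lam b (uv I)) b d (uv I)) (\<lambda>q. sqn d (vdiff q (uv I))) \<le> ?q * sqn d (uv I)"
        by (rule Qv_error_le[OF d b lam])
    qed
    also have "\<dots> = ?q * E (samples n B) (\<lambda>I. sqn d (uv I))" by simp
    also have "\<dots> \<le> ?q * s2" using uv_second_moment quant_const_nonneg by (intro mult_left_mono)
    finally show ?thesis .
  qed
  have "E (wk (Suc i)) (\<lambda>W. \<Sum>p\<leftarrow>W. sqn d (vdiff (snd p) (fst p)))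
      = E (wk i) (\<lambda>W. (\<Sum>p\<leftarrow>W. sqn d (vdiff (snd p) (fst p)))
          + E (samples n B) (\<lambda>I. E (Qv (delta_q d lam b (uv I)) b d (uv I)) (\<lambda>q. sqn d (vdiff q (uv I)))))"
    unfolding E_wk_Suc by (simp add: E_add[OF finite_Qv] E_add[OF finite_samples[OF n]])
  also have "\<dots> = E (wk i) (\<lambda>W. (\<Sum>p\<leftarrow>W. sqn d (vdiff (snd p) (fst p))))
          + E (samples n B) (\<lambda>I. E (Qv (delta_q d lam b (uv I)) b d (uv I)) (\<lambda>q. sqn d (vdiff q (uv I))))"
    by (simp only: E_add[OF finite_wk] E_const)
  also have "\<dots> \<le> real i * (?q * s2) + ?q * s2" using Suc inner by (intro add_mono)
  also have "\<dots> = real (Suc i) * (?q * s2)" by (simp add: algebra_simps)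
  finally show ?case .
qed

text \<open>The new batch is independent of the earlier workers and unbiased, so no cross term
  remains.\<close>

lemma wk_square: "E (wk i) (\<lambda>W. (\<Sum>p\<leftarrow>W. fst p j - gd j)\<^sup>2) = real i * E (samples n B) (\<lambda>I. (uv I j - gd j)\<^sup>2)"
proof (induction i)
  case (Suc i)
  let ?v = "E (samples n B) (\<lambda>I. (uv I j - gd j)\<^sup>2)"
  have "E (wk (Suc i)) (\<lambda>W. (\<Sum>p\<leftarrow>W. fst p j - gd j)\<^sup>2)
      = E (wk i) (\<lambda>W. E (samples n B) (\<lambda>I. ((\<Sum>p\<leftarrow>W. fst p j - gd j) + (uv I j - gd j))\<^sup>2))"
    unfolding E_wk_Suc by simp
  also have "\<dots> = E (wk i) (\<lambda>W. (\<Sum>p\<leftarrow>W. fst p j - gd j)\<^sup>2 + ?v)"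
  proof (rule E_cong)
    fix W
    define s where "s = (\<Sum>p\<leftarrow>W. fst p j - gd j)"
    have "E (samples n B) (\<lambda>I. (s + (uv I j - gd j))\<^sup>2)
        = E (samples n B) (\<lambda>I. (s\<^sup>2 + 2 * s * (uv I j - gd j)) + (uv I j - gd j)\<^sup>2)"
      by (rule E_cong) (simp add: power2_eq_square algebra_simps)
    also have "\<dots> = s\<^sup>2 + 2 * s * (E (samples n B) (\<lambda>I. uv I j) - gd j) + ?v"
      by (simp add: E_add[OF finite_samples[OF n]] E_diff[OF finite_samples[OF n]])
    finally show "E (samples n B) (\<lambda>I. ((\<Sum>p\<leftarrow>W. fst p j - gd j) + (uv I j - gd j))\<^sup>2) = (\<Sum>p\<leftarrow>W. fst p j - gd j)\<^sup>2 + ?v"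
      by (simp add: uv_mean s_def)
  qed
  also have "\<dots> = E (wk i) (\<lambda>W. (\<Sum>p\<leftarrow>W. fst p j - gd j)\<^sup>2) + ?v"
    by (simp only: E_add[OF finite_wk] E_const)
  finally show ?case using Suc by (simp add: algebra_simps)
qed simp

text \<open>The factor 2 separates quantization from sampling. Clipped coordinates are biased, so
  the quantization errors of the workers are combined by Cauchy-Schwarz only and gain nothing from
  \<open>N\<close>; the sampling errors are independent and centred and gain
  \<open>1 / (N * B)\<close>.\<close>

lemma estimator_error:
  "E (wk N) (\<lambda>W. sqn d (\<lambda>j. (1 / real N) * (\<Sum>p\<leftarrow>W. snd p j) - gd j))
    \<le> 2 * (quant_const d lam b dl + 1 / (real N * real B)) * s2"
proof -
  have Np: "real N > 0" using N by simp
  have path: "sqn d (\<lambda>j. (1 / real N) * (\<Sum>p\<leftarrow>W. snd p j) - gd j)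
      \<le> 2 * (1 / real N) * (\<Sum>p\<leftarrow>W. sqn d (vdiff (snd p) (fst p)))
        + (\<Sum>j<d. 2 * (1 / real N)\<^sup>2 * (\<Sum>p\<leftarrow>W. fst p j - gd j)\<^sup>2)" if W: "W \<in> set_pmf (wk N)" for W
  proof -
    have len: "length W = N" by (rule length_workers[OF W])
    have "((1 / real N) * (\<Sum>p\<leftarrow>W. snd p j) - gd j)\<^sup>2
        \<le> 2 * (1 / real N) * (\<Sum>p\<leftarrow>W. (snd p j - fst p j)\<^sup>2) + 2 * (1 / real N)\<^sup>2 * (\<Sum>p\<leftarrow>W. fst p j - gd j)\<^sup>2" for j
    proof -
      define A where "A = (1 / real N) * (\<Sum>p\<leftarrow>W. snd p j - fst p j)"
      define D where "D = (1 / real N) * (\<Sum>p\<leftarrow>W. fst p j - gd j)"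
      have sl: "(\<Sum>p\<leftarrow>W. snd p j) = (\<Sum>p\<leftarrow>W. snd p j - fst p j) + (\<Sum>p\<leftarrow>W. fst p j - gd j) + real (length W) * gd j"
        by (induction W) (auto simp: algebra_simps)
      have eq: "(1 / real N) * (\<Sum>p\<leftarrow>W. snd p j) - gd j = A + D"
        unfolding sl A_def D_def len using Np by (simp add: field_simps)
      have "0 \<le> (A - D)\<^sup>2" by simp
      then have "(A + D)\<^sup>2 \<le> 2 * A\<^sup>2 + 2 * D\<^sup>2" by (simp add: power2_eq_square algebra_simps)
      also have "A\<^sup>2 \<le> (1 / real N) * (\<Sum>p\<leftarrow>W. (snd p j - fst p j)\<^sup>2)"
      proof -
        have "A\<^sup>2 = (1 / real N)\<^sup>2 * (\<Sum>p\<leftarrow>W. snd p j - fst p j)\<^sup>2" unfolding A_def by (rule power_mult_distrib)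
        also have "\<dots> \<le> (1 / real N)\<^sup>2 * (real N * (\<Sum>p\<leftarrow>W. (snd p j - fst p j)\<^sup>2))"
          using sum_list_sq_le[of "\<lambda>p. snd p j - fst p j" W] unfolding len by (intro mult_left_mono) auto
        also have "\<dots> = (1 / real N) * (\<Sum>p\<leftarrow>W. (snd p j - fst p j)\<^sup>2)" using Np by (simp add: power2_eq_square)
        finally show ?thesis .
      qed
      also have "D\<^sup>2 = (1 / real N)\<^sup>2 * (\<Sum>p\<leftarrow>W. fst p j - gd j)\<^sup>2" unfolding D_def by (rule power_mult_distrib)
      finally show ?thesis unfolding eq by (simp add: mult.assoc)
    qed
    then have "(\<Sum>j<d. ((1 / real N) * (\<Sum>p\<leftarrow>W. snd p j) - gd j)\<^sup>2)
        \<le> (\<Sum>j<d. 2 * (1 / real N) * (\<Sum>p\<leftarrow>W. (snd p j - fst p j)\<^sup>2) + 2 * (1 / real N)\<^sup>2 * (\<Sum>p\<leftarrow>W. fst p j - gd j)\<^sup>2)"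
      by (intro sum_mono)
    also have "\<dots> = 2 * (1 / real N) * (\<Sum>j<d. \<Sum>p\<leftarrow>W. (snd p j - fst p j)\<^sup>2)
        + (\<Sum>j<d. 2 * (1 / real N)\<^sup>2 * (\<Sum>p\<leftarrow>W. fst p j - gd j)\<^sup>2)"
      by (simp only: sum.distrib sum_distrib_left)
    also have "(\<Sum>j<d. \<Sum>p\<leftarrow>W. (snd p j - fst p j)\<^sup>2) = (\<Sum>p\<leftarrow>W. sqn d (vdiff (snd p) (fst p)))"
      by (induction W) (auto simp: sqn_sum vdiff_def sum.distrib)
    finally show ?thesis unfolding sqn_sum .
  qed
  have "E (wk N) (\<lambda>W. sqn d (\<lambda>j. (1 / real N) * (\<Sum>p\<leftarrow>W. snd p j) - gd j))
      \<le> E (wk N) (\<lambda>W. 2 * (1 / real N) * (\<Sum>p\<leftarrow>W. sqn d (vdiff (snd p) (fst p)))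
        + (\<Sum>j<d. 2 * (1 / real N)\<^sup>2 * (\<Sum>p\<leftarrow>W. fst p j - gd j)\<^sup>2))"
    by (rule E_mono[OF finite_wk path])
  also have "\<dots> = 2 * (1 / real N) * E (wk N) (\<lambda>W. \<Sum>p\<leftarrow>W. sqn d (vdiff (snd p) (fst p)))
      + (\<Sum>j<d. 2 * (1 / real N)\<^sup>2 * E (wk N) (\<lambda>W. (\<Sum>p\<leftarrow>W. fst p j - gd j)\<^sup>2))"
    unfolding E_add[OF finite_wk] E_sum[OF finite_wk] by simp
  also have "(\<Sum>j<d. 2 * (1 / real N)\<^sup>2 * E (wk N) (\<lambda>W. (\<Sum>p\<leftarrow>W. fst p j - gd j)\<^sup>2))
      = 2 * (1 / real N) * E (samples n B) (\<lambda>I. sqn d (vdiff (uv I) gd))"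
  proof -
    have "E (samples n B) (\<lambda>I. sqn d (vdiff (uv I) gd)) = (\<Sum>j<d. E (samples n B) (\<lambda>I. (uv I j - gd j)\<^sup>2))"
      unfolding sqn_sum vdiff_def by (rule E_sum[OF finite_samples[OF n]])
    then show ?thesis unfolding wk_square using Np by (simp add: sum_distrib_left power2_eq_square)
  qed
  also have "2 * (1 / real N) * E (wk N) (\<lambda>W. \<Sum>p\<leftarrow>W. sqn d (vdiff (snd p) (fst p)))
      + 2 * (1 / real N) * E (samples n B) (\<lambda>I. sqn d (vdiff (uv I) gd))
      \<le> 2 * (1 / real N) * (real N * (quant_const d lam b dl * s2)) + 2 * (1 / real N) * ((1 / real B) * s2)"
    using wk_quantization[of N] uv_variance Np by (intro add_mono mult_left_mono) auto
  also have "\<dots> = 2 * (quant_const d lam b dl + 1 / (real N * real B)) * s2"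
    using Np by (simp add: algebra_simps)
  finally show ?thesis .
qed

end

section \<open>One iteration\<close>

context composite_problem
begin

lemma gb_mean: "gb x j = mean n (\<lambda>a. gr a x j)"
  by (simp add: gb_def mean_def)

text \<open>The y-step is compared with yb and the z-step with \<open>u\<close>. Since yb - x =
  \<tau> (z' - z), the cost \<open>2 * L * A\<close> of the first comparison and the cost
  \<open>L * A\<close> of the noise in \<open>vh\<close> add up to \<open>3 * L * A\<close>, exactly
  what the z-step supplies with its coefficient \<open>3 * L * \<tau>\<close>.\<close>

lemma step_pathwise:
  assumes \<tau>: "\<tau> > 0" "t2 \<ge> 0" "\<tau> + t2 \<le> 1"
    and pts: "y \<in> dm" "z \<in> dm" "xt \<in> dm" "u \<in> dm"
  defines "x \<equiv> (\<lambda>j. \<tau> * z j + t2 * xt j + (1 - \<tau> - t2) * y j)"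
  assumes y': "y' \<in> dm" "\<And>w. w \<in> dm \<Longrightarrow> prox_obj (2 * L) x v y' + 2 * L * sqn d (vdiff w y') \<le> prox_obj (2 * L) x v w"
    and z': "z' \<in> dm" "\<And>w. w \<in> dm \<Longrightarrow> prox_obj (3 * L * \<tau>) z vh z' + 3 * L * \<tau> * sqn d (vdiff w z') \<le> prox_obj (3 * L * \<tau>) z vh w"
  defines "yb \<equiv> (\<lambda>j. \<tau> * z' j + t2 * xt j + (1 - \<tau> - t2) * y j)"
  shows "Pr y' + 7 / 5 * (L * sqn d (vdiff y' yb)) + \<tau>\<^sup>2 * (3 * L * sqn d (vdiff u z'))
    \<le> fbar n f x + 5 / (12 * L) * sqn d (vdiff (gb x) v) + 1 / (4 * L) * sqn d (vdiff (gb x) vh)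
      + \<tau> * ip d vh (vdiff u z) + \<tau> * hr u + t2 * hr xt + (1 - \<tau> - t2) * hr y + \<tau>\<^sup>2 * (3 * L * sqn d (vdiff u z))"
proof -
  have xdm: "x \<in> dm" and ybdm: "yb \<in> dm"
    unfolding x_def yb_def using \<tau> pts z'(1) by (auto intro!: conv_fun_on_comb3(1)[OF hr_conv])
  have hyb: "hr yb \<le> \<tau> * hr z' + t2 * hr xt + (1 - \<tau> - t2) * hr y"
    unfolding yb_def using \<tau> pts z'(1) by (intro conv_fun_on_comb3(2)[OF hr_conv]) auto
  define A C D where "A = sqn d (vdiff yb x)" and "C = sqn d (vdiff y' yb)" and "D = sqn d (vdiff y' x)"
  have ybx: "vdiff yb x = (\<lambda>j. \<tau> * vdiff z' z j)" by (auto simp: yb_def x_def vdiff_def algebra_simps)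
  have A: "A = \<tau>\<^sup>2 * sqn d (vdiff z' z)" unfolding A_def ybx sqn_scale ..
  have 1: "fbar n f y' \<le> fbar n f x + ip d (gb x) (vdiff y' x) + L / 2 * D"
    unfolding D_def by (rule fbar_descent) (use xdm y'(1) in \<open>auto simp: dm_Vd\<close>)
  have 2: "2 * L * D + ip d v y' + hr y' + 2 * L * C \<le> 2 * L * A + ip d v yb + hr yb"
    using y'(2)[OF ybdm] unfolding prox_obj_def A_def C_def D_def by (simp add: sqn_swap[of d yb y'])
  \<comment> \<open>Of the amount \<open>2 * L * C\<close> offered by the y-step, 3/5 is spent on
    the noise of \<open>v\<close>, which determines 5/(12 L); the other 7/5 stays in the
    claim.\<close>
  have 3: "ip d (vdiff (gb x) v) (vdiff y' yb) \<le> 5 / (12 * L) * sqn d (vdiff (gb x) v) + 3 / 5 * (L * C)"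
  proof -
    have "ip d (vdiff (gb x) v) (vdiff y' yb) \<le> sqn d (vdiff (gb x) v) / (4 * (3 / 5 * L)) + 3 / 5 * L * sqn d (vdiff y' yb)"
      by (rule ip_young) (use L_pos in simp)
    then show ?thesis using L_pos by (simp add: C_def)
  qed
  have 4: "ip d (vdiff (gb x) vh) (vdiff yb x) \<le> 1 / (4 * L) * sqn d (vdiff (gb x) vh) + L * A"
    using ip_young[OF L_pos, of d "vdiff (gb x) vh" "vdiff yb x"] by (simp add: A_def)
  have 5: "ip d vh (vdiff yb x) = \<tau> * (ip d vh z' - ip d vh z)"
    unfolding ybx ip_scale_right by (simp add: vdiff_def ip_diff_right)
  have 6: "3 * L * A + \<tau> * ip d vh z' + \<tau> * hr z' + \<tau>\<^sup>2 * (3 * L * sqn d (vdiff u z'))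
      \<le> \<tau>\<^sup>2 * (3 * L * sqn d (vdiff u z)) + \<tau> * ip d vh u + \<tau> * hr u"
  proof -
    have "\<tau> * (prox_obj (3 * L * \<tau>) z vh z' + 3 * L * \<tau> * sqn d (vdiff u z')) \<le> \<tau> * prox_obj (3 * L * \<tau>) z vh u"
      using z'(2)[OF pts(4)] \<tau> by (intro mult_left_mono) auto
    then show ?thesis unfolding prox_obj_def A by (simp add: algebra_simps power2_eq_square)
  qed
  \<comment> \<open>The true gradient is replaced by \<open>v\<close> on y' - yb and by
    \<open>vh\<close> on yb - x, so each estimator is paired with the step that it drives.\<close>
  have 7: "ip d (gb x) (vdiff y' x) - ip d v y' + ip d v yb
      = ip d (vdiff (gb x) v) (vdiff y' yb) + ip d (vdiff (gb x) vh) (vdiff yb x) + ip d vh (vdiff yb x)"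
    by (simp add: vdiff_def ip_diff_left ip_diff_right)
  have 8: "\<tau> * ip d vh (vdiff u z) = \<tau> * ip d vh u - \<tau> * ip d vh z"
    by (simp add: vdiff_def ip_diff_right right_diff_distrib)
  have LD: "0 \<le> L * D" unfolding D_def using L_pos sqn_nonneg by simp
  define lA lC lD where "lA = L * A" and "lC = L * C" and "lD = L * D"
  have p2: "2 * lD + ip d v y' + hr y' + 2 * lC \<le> 2 * lA + ip d v yb + hr yb" using 2 by (simp add: lA_def lC_def lD_def)
  have p1: "fbar n f y' \<le> fbar n f x + ip d (gb x) (vdiff y' x) + lD / 2" using 1 by (simp add: lD_def)
  have p5: "ip d vh (vdiff yb x) = \<tau> * ip d vh z' - \<tau> * ip d vh z" using 5 by (simp add: right_diff_distrib)
  have p6: "3 * lA + \<tau> * ip d vh z' + \<tau> * hr z' + \<tau>\<^sup>2 * (3 * L * sqn d (vdiff u z'))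
      \<le> \<tau>\<^sup>2 * (3 * L * sqn d (vdiff u z)) + \<tau> * ip d vh u + \<tau> * hr u" using 6 by (simp add: lA_def)
  show ?thesis
    using p1 p2 3 4 p5 p6 7 8 LD hyb unfolding Pr_def C_def[symmetric] lA_def[symmetric] lC_def[symmetric] lD_def[symmetric]
    by argo
qed

text \<open>Rests on \<tau> (u - z) = \<tau> (u - x) + t2 (xt - x) + (1 - \<tau> - t2) (y - x).
  Convexity is used up at \<open>u\<close> and \<open>y\<close>, while the Bregman distance of the
  snapshot is kept to pay for the variances.\<close>

lemma bregman_recombination:
  assumes \<tau>: "\<tau> > 0" "t2 \<ge> 0" "\<tau> + t2 \<le> 1"
    and pts: "y \<in> dm" "z \<in> dm" "xt \<in> dm" "u \<in> dm"
  defines "x \<equiv> (\<lambda>j. \<tau> * z j + t2 * xt j + (1 - \<tau> - t2) * y j)"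
  shows "fbar n f x + t2 * breg xt x + \<tau> * ip d (gb x) (vdiff u z)
    \<le> \<tau> * fbar n f u + t2 * fbar n f xt + (1 - \<tau> - t2) * fbar n f y"
proof -
  have xV: "x \<in> Vd d" unfolding x_def using \<tau> pts by (intro dm_Vd conv_fun_on_comb3(1)[OF hr_conv]) auto
  have "\<tau> * ip d (gb x) (vdiff u z) = \<tau> * ip d (gb x) (vdiff u x) + t2 * ip d (gb x) (vdiff xt x) + (1 - \<tau> - t2) * ip d (gb x) (vdiff y x)"
  proof -
    have "ip d (gb x) x = \<tau> * ip d (gb x) z + t2 * ip d (gb x) xt + (1 - \<tau> - t2) * ip d (gb x) y"
      by (subst (2) x_def) (simp add: ip_def sum.distrib sum_distrib_left algebra_simps sum_subtractf)
    then show ?thesis by (simp add: vdiff_def ip_diff_right algebra_simps)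
  qed
  moreover have "\<tau> * (fbar n f x + ip d (gb x) (vdiff u x)) \<le> \<tau> * fbar n f u"
    using fbar_gradient_bound[OF xV dm_Vd[OF pts(4)]] \<tau> by (intro mult_left_mono) auto
  moreover have "(1 - \<tau> - t2) * (fbar n f x + ip d (gb x) (vdiff y x)) \<le> (1 - \<tau> - t2) * fbar n f y"
    using fbar_gradient_bound[OF xV dm_Vd[OF pts(1)]] \<tau> by (intro mult_left_mono) auto
  ultimately show ?thesis unfolding breg_def by (simp add: algebra_simps)
qed

end

section \<open>One iteration in expectation\<close>

locale alpc_step = composite_problem +
  fixes N B b :: nat and lam dl t2 :: real
  assumes d_ge: "d \<ge> 1" and N_ge: "N \<ge> 1" and B_ge: "B \<ge> 1" and b_ge: "b \<ge> 2"
    and lam: "0 < lam" "lam \<le> 1"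
    and t2_def: "t2 = 5 * (quant_const d lam b dl + 1 / (real N * real B)) / 3 + 1 / (2 * real B)"
    and t2_le: "t2 \<le> 1 / 2" and dl_ge: "dl \<ge> 0"
begin

lemma t2_nonneg: "t2 \<ge> 0"
  unfolding t2_def quant_const_def using dl_ge by (intro add_nonneg_nonneg) auto

definition newy :: "rvec \<Rightarrow> rvec \<Rightarrow> (rvec \<times> rvec) list \<Rightarrow> rvec" where
  "newy x xt W = argminV d (\<lambda>w. ereal (2 * L * (nrm d (\<lambda>j. w j - x j))\<^sup>2
      + ip d (\<lambda>j. (1 / real N) * (\<Sum>p\<leftarrow>W. snd p j) + gb xt j) w) + h w)"

definition newz :: "real \<Rightarrow> rvec \<Rightarrow> rvec \<Rightarrow> rvec \<Rightarrow> nat list \<Rightarrow> rvec" where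
  "newz \<tau> z x xt J = argminV d (\<lambda>w. ereal (1 / (2 * (1 / (6 * L * \<tau>))) * (nrm d (\<lambda>j. w j - z j))\<^sup>2
      + ip d (\<lambda>j. (1 / real B) * (\<Sum>a\<leftarrow>J. gr a x j - gr a xt j) + gb xt j) w) + h w)"

lemma newy_dm: "newy x xt W \<in> dm"
  unfolding newy_def by (rule argmin_prox(1)) (use L_pos in simp)

lemma newz_dm: "\<tau> > 0 \<Longrightarrow> newz \<tau> z x xt J \<in> dm"
  unfolding newz_def by (rule argmin_prox(1)) (use L_pos in simp)

text \<open>\<open>u\<close> and \<open>z\<close> are fixed before \<open>J\<close> is drawn, so the
  linear term has the true gradient as its expectation. Both variances are multiples of
  \<open>s2\<close>, and \<open>s2 / (2 * L)\<close> is at most \<open>breg xt x\<close>, of which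
  \<open>bregman_recombination\<close> can spare the share \<open>t2\<close>.\<close>

lemma one_step:
  assumes \<tau>: "\<tau> > 0" "\<tau> \<le> 1 / 2" and pts: "y \<in> dm" "z \<in> dm" "xt \<in> dm" "u \<in> dm"
  defines "x \<equiv> (\<lambda>j. \<tau> * z j + t2 * xt j + (1 - \<tau> - t2) * y j)"
  assumes few: "\<And>I. I \<in> set_pmf (samples n B) \<Longrightarrow>
      real (outside_count d lam b (\<lambda>j. (1 / real B) * (\<Sum>a\<leftarrow>I. gr a x j - gr a xt j))) \<le> dl"
  shows "E (workers n gr d B lam b x xt N) (\<lambda>W. E (samples n B) (\<lambda>J.
      Pr (newy x xt W)
      + 7 / 5 * (L * sqn d (vdiff (newy x xt W) (\<lambda>j. \<tau> * newz \<tau> z x xt J j + t2 * xt j + (1 - \<tau> - t2) * y j)))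
      + \<tau>\<^sup>2 * (3 * L * sqn d (vdiff u (newz \<tau> z x xt J)))))
    \<le> \<tau> * Pr u + t2 * Pr xt + (1 - \<tau> - t2) * Pr y + \<tau>\<^sup>2 * (3 * L * sqn d (vdiff u z))"
proof -
  interpret wr: worker_round n d N B b lam dl gr x xt
    by unfold_locales (use n_ge d_ge N_ge B_ge b_ge lam few in auto)
  have \<tau>2: "\<tau> + t2 \<le> 1" using \<tau> t2_le by simp
  have xV: "x \<in> Vd d" unfolding x_def using \<tau> \<tau>2 t2_nonneg pts by (intro dm_Vd conv_fun_on_comb3(1)[OF hr_conv]) auto
  define v where "v W = (\<lambda>j. (1 / real N) * (\<Sum>p\<leftarrow>W. snd p j) + gb xt j)" for W :: "(rvec \<times> rvec) list"
  define vh where "vh J = (\<lambda>j. (1 / real B) * (\<Sum>a\<leftarrow>J. gr a x j - gr a xt j) + gb xt j)" for J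
  have gd: "wr.gd j = gb x j - gb xt j" for j
    unfolding wr.gd_def gb_mean by (rule mean_diff[OF n_ge])
  define R0 where "R0 = fbar n f x + \<tau> * hr u + t2 * hr xt + (1 - \<tau> - t2) * hr y + \<tau>\<^sup>2 * (3 * L * sqn d (vdiff u z))"
  have path: "Pr (newy x xt W)
      + 7 / 5 * (L * sqn d (vdiff (newy x xt W) (\<lambda>j. \<tau> * newz \<tau> z x xt J j + t2 * xt j + (1 - \<tau> - t2) * y j)))
      + \<tau>\<^sup>2 * (3 * L * sqn d (vdiff u (newz \<tau> z x xt J)))
      \<le> (R0 + 5 / (12 * L) * sqn d (vdiff (gb x) (v W))) + (1 / (4 * L) * sqn d (vdiff (gb x) (vh J)) + \<tau> * ip d (vh J) (vdiff u z))" for W J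
  proof -
    have c2: "1 / (2 * (1 / (6 * L * \<tau>))) = 3 * L * \<tau>" by simp
    have yopt: "prox_obj (2 * L) x (v W) (newy x xt W) + 2 * L * sqn d (vdiff w (newy x xt W)) \<le> prox_obj (2 * L) x (v W) w" if "w \<in> dm" for w
      unfolding newy_def v_def by (rule argmin_prox(2)) (use L_pos that in auto)
    have zopt: "prox_obj (3 * L * \<tau>) z (vh J) (newz \<tau> z x xt J) + 3 * L * \<tau> * sqn d (vdiff w (newz \<tau> z x xt J)) \<le> prox_obj (3 * L * \<tau>) z (vh J) w" if "w \<in> dm" for w
      unfolding newz_def vh_def c2 by (rule argmin_prox(2)) (use L_pos \<tau> that in auto)
    have "Pr (newy x xt W)
      + 7 / 5 * (L * sqn d (vdiff (newy x xt W) (\<lambda>j. \<tau> * newz \<tau> z x xt J j + t2 * xt j + (1 - \<tau> - t2) * y j)))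
      + \<tau>\<^sup>2 * (3 * L * sqn d (vdiff u (newz \<tau> z x xt J)))
      \<le> fbar n f x + 5 / (12 * L) * sqn d (vdiff (gb x) (v W)) + 1 / (4 * L) * sqn d (vdiff (gb x) (vh J))
      + \<tau> * ip d (vh J) (vdiff u z) + \<tau> * hr u + t2 * hr xt + (1 - \<tau> - t2) * hr y + \<tau>\<^sup>2 * (3 * L * sqn d (vdiff u z))"
      unfolding x_def
      by (rule step_pathwise[OF \<tau>(1) t2_nonneg \<tau>2 pts newy_dm _ newz_dm[OF \<tau>(1)]])
        (erule yopt[unfolded x_def], erule zopt[unfolded x_def])
    then show ?thesis unfolding R0_def by linarith
  qed
  have "E (workers n gr d B lam b x xt N) (\<lambda>W. E (samples n B) (\<lambda>J.
      Pr (newy x xt W)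
      + 7 / 5 * (L * sqn d (vdiff (newy x xt W) (\<lambda>j. \<tau> * newz \<tau> z x xt J j + t2 * xt j + (1 - \<tau> - t2) * y j)))
      + \<tau>\<^sup>2 * (3 * L * sqn d (vdiff u (newz \<tau> z x xt J)))))
    \<le> E (workers n gr d B lam b x xt N) (\<lambda>W. E (samples n B) (\<lambda>J.
      (R0 + 5 / (12 * L) * sqn d (vdiff (gb x) (v W))) + (1 / (4 * L) * sqn d (vdiff (gb x) (vh J)) + \<tau> * ip d (vh J) (vdiff u z))))"
    by (intro E_mono wr.finite_wk finite_samples[OF n_ge] path)
  also have "\<dots> = R0 + 5 / (12 * L) * E (workers n gr d B lam b x xt N) (\<lambda>W. sqn d (vdiff (gb x) (v W)))
      + (1 / (4 * L) * E (samples n B) (\<lambda>J. sqn d (vdiff (gb x) (vh J))) + \<tau> * E (samples n B) (\<lambda>J. ip d (vh J) (vdiff u z)))"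
    unfolding E_add[OF finite_samples[OF n_ge]] E_const E_add[OF wr.finite_wk] by simp
  also have "E (workers n gr d B lam b x xt N) (\<lambda>W. sqn d (vdiff (gb x) (v W)))
      = E (workers n gr d B lam b x xt N) (\<lambda>W. sqn d (\<lambda>j. (1 / real N) * (\<Sum>p\<leftarrow>W. snd p j) - wr.gd j))"
    unfolding sqn_sum vdiff_def v_def gd by (intro E_cong sum.cong refl) (simp add: power2_eq_square algebra_simps)
  also have "E (samples n B) (\<lambda>J. sqn d (vdiff (gb x) (vh J))) = E (samples n B) (\<lambda>J. sqn d (vdiff (wr.uv J) wr.gd))"
    unfolding sqn_sum vdiff_def vh_def wr.uv_def gd by (intro E_cong sum.cong refl) (simp add: power2_eq_square algebra_simps)
  also have "E (samples n B) (\<lambda>J. ip d (vh J) (vdiff u z)) = ip d (gb x) (vdiff u z)"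
  proof -
    have "E (samples n B) (\<lambda>J. ip d (vh J) (vdiff u z)) = (\<Sum>j<d. E (samples n B) (\<lambda>J. (wr.uv J j + gb xt j) * vdiff u z j))"
      unfolding ip_def vh_def wr.uv_def by (rule E_sum[OF finite_samples[OF n_ge]])
    also have "\<dots> = (\<Sum>j<d. gb x j * vdiff u z j)"
      by (simp add: E_add[OF finite_samples[OF n_ge]] wr.uv_mean gd)
    finally show ?thesis by (simp add: ip_def)
  qed
  also have "R0 + 5 / (12 * L) * E (workers n gr d B lam b x xt N) (\<lambda>W. sqn d (\<lambda>j. (1 / real N) * (\<Sum>p\<leftarrow>W. snd p j) - wr.gd j))
      + (1 / (4 * L) * E (samples n B) (\<lambda>J. sqn d (vdiff (wr.uv J) wr.gd)) + \<tau> * ip d (gb x) (vdiff u z))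
      \<le> R0 + 5 / (12 * L) * (2 * (quant_const d lam b dl + 1 / (real N * real B)) * wr.s2)
      + (1 / (4 * L) * ((1 / real B) * wr.s2) + \<tau> * ip d (gb x) (vdiff u z))"
    using wr.estimator_error wr.uv_variance L_pos by (intro add_mono mult_left_mono order_refl) auto
  \<comment> \<open>The origin of \<open>t2\<close>: 2 * 5/(12 L) = (5/3) / (2 L) for the noise of
    \<open>v\<close>, and 1/(4 L B) = (1/(2 B)) / (2 L) for that of \<open>vh\<close>.\<close>
  also have "\<dots> = R0 + t2 * (wr.s2 / (2 * L)) + \<tau> * ip d (gb x) (vdiff u z)"
    unfolding t2_def using L_pos by (simp add: field_simps)
  also have "\<dots> \<le> R0 + t2 * breg xt x + \<tau> * ip d (gb x) (vdiff u z)"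
  proof -
    have "wr.s2 \<le> 2 * L * breg xt x"
      using gradient_variance_bregman[OF xV dm_Vd[OF pts(3)]] by (simp add: wr.s2_def mean_def)
    then have "wr.s2 / (2 * L) \<le> breg xt x" using L_pos by (simp add: field_simps)
    then show ?thesis by (intro add_mono mult_left_mono order_refl t2_nonneg)
  qed
  also have "\<dots> \<le> \<tau> * Pr u + t2 * Pr xt + (1 - \<tau> - t2) * Pr y + \<tau>\<^sup>2 * (3 * L * sqn d (vdiff u z))"
    using bregman_recombination[OF \<tau>(1) t2_nonneg \<tau>2 pts] unfolding x_def[symmetric] R0_def Pr_def
    by (simp add: distrib_left)
  finally show ?thesis .
qed

end

section \<open>The process with its history\<close>

text \<open>All iterates y and z together with the recorded vectors. The states of the algorithm
  retain only the current iterates, but a comparison point y_j requires its joint law with later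
  iterates. Entries not yet reached hold the initial point.\<close>

type_synonym hist = "(nat \<Rightarrow> rvec) \<times> (nat \<Rightarrow> rvec) \<times> rvec list"

lemma finite_workers: "n \<ge> 1 \<Longrightarrow> finite (set_pmf (workers n gr d B lam b x xt i))"
  by (induction i) (auto simp: Let_def finite_samples finite_Qv)

locale alpc_process = alpc_step +
  fixes m S :: nat and x0 :: rvec
  assumes m_ge: "m \<ge> 1" and S_ge: "S \<ge> 1" and x0_dm: "x0 \<in> dm"
    and few_final: "\<And>\<omega> u. \<omega> \<in> set_pmf (alpc_run n gr h L d N m B lam b t2 x0 S) \<Longrightarrow>
      u \<in> set (snd (snd (snd \<omega>))) \<Longrightarrow> real (outside_count d lam b u) \<le> dl"
begin

definition xt_of :: "nat \<Rightarrow> (nat \<Rightarrow> rvec) \<Rightarrow> rvec" where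
  "xt_of s Y = (if s = 0 then Y 0 else (\<lambda>j. (\<Sum>i<m. Y ((s - 1) * m + i + 1) j) / real m))"

abbreviation istep :: "nat \<Rightarrow> rvec \<Rightarrow> istate \<Rightarrow> istate pmf" where
  "istep s xt \<equiv> inner_step n gr h L d N B lam b t2 s xt (gb xt)"

definition xpt :: "nat \<Rightarrow> rvec \<Rightarrow> rvec \<Rightarrow> rvec \<Rightarrow> rvec" where
  "xpt s xt y z = (\<lambda>j. step_tau s * z j + t2 * xt j + (1 - step_tau s - t2) * y j)"

lemma istep_eq: "istep s xt (y, z, ys, us) =
  bind_pmf (workers n gr d B lam b (xpt s xt y z) xt N) (\<lambda>W.
    map_pmf (\<lambda>J. (newy (xpt s xt y z) xt W, newz (step_tau s) z (xpt s xt y z) xt J,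
        (\<lambda>j. ys j + newy (xpt s xt y z) xt W j), us @ map fst W)) (samples n B))"
  unfolding inner_step_def Let_def prod.case newy_def newz_def xpt_def step_tau_def ..

text \<open>The running sum is started at 0 and its update discarded, since it is a function of the
  history (\<open>pin\<close>).\<close>

definition hstep :: "nat \<Rightarrow> hist \<Rightarrow> hist pmf" where
  "hstep k \<omega> = (case \<omega> of (Y, Z, us) \<Rightarrow>
     map_pmf (\<lambda>(y', z', ys', us'). (Y(Suc k := y'), Z(Suc k := z'), us'))
       (istep (k div m) (xt_of (k div m) Y) (Y k, Z k, (\<lambda>_. 0), us)))"

lemma hstep_eq: "hstep k (Y, Z, us) =
  (let s = k div m; xt = xt_of s Y; x = xpt s xt (Y k) (Z k) in
   bind_pmf (workers n gr d B lam b x xt N) (\<lambda>W.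
    map_pmf (\<lambda>J. (Y(Suc k := newy x xt W), Z(Suc k := newz (step_tau s) (Z k) x xt J), us @ map fst W)) (samples n B)))"
  unfolding hstep_def istep_eq Let_def prod.case map_bind_pmf pmf.map_comp o_def ..

fun H :: "nat \<Rightarrow> hist pmf" where
  "H 0 = return_pmf ((\<lambda>_. x0), (\<lambda>_. x0), [])"
| "H (Suc k) = bind_pmf (H k) (hstep k)"

fun Hn :: "nat \<Rightarrow> nat \<Rightarrow> hist \<Rightarrow> hist pmf" where
  "Hn k 0 \<omega> = return_pmf \<omega>"
| "Hn k (Suc t) \<omega> = bind_pmf (Hn k t \<omega>) (hstep (k + t))"

lemma H_Hn: "H (k + t) = bind_pmf (H k) (Hn k t)"
proof (induction t)
  case 0
  have "Hn k 0 = return_pmf" by (rule ext) simp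
  then show ?case by (simp add: bind_return_pmf')
next
  case (Suc t)
  have "Hn k (Suc t) = (\<lambda>\<omega>. bind_pmf (Hn k t \<omega>) (hstep (k + t)))" by (rule ext) simp
  then show ?case using Suc by (simp add: bind_assoc_pmf)
qed

lemma hstep_support:
  assumes "\<omega>' \<in> set_pmf (hstep k \<omega>)"
  shows "\<exists>y z us. y \<in> dm \<and> z \<in> dm \<and> set (snd (snd \<omega>)) \<subseteq> set us
    \<and> \<omega>' = ((fst \<omega>)(Suc k := y), (fst (snd \<omega>))(Suc k := z), us)"
proof -
  obtain Y Z us where \<omega>: "\<omega> = (Y, Z, us)" by (metis prod_cases3)
  define s xt x where "s = k div m" and "xt = xt_of s Y" and "x = xpt s xt (Y k) (Z k)"
  obtain W J where WJ: "\<omega>' = (Y(Suc k := newy x xt W), Z(Suc k := newz (step_tau s) (Z k) x xt J), us @ map fst W)"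
    using assms unfolding \<omega> hstep_eq Let_def s_def xt_def x_def by auto
  show ?thesis
  proof (intro exI conjI)
    show "newy x xt W \<in> dm" by (rule newy_dm)
    show "newz (step_tau s) (Z k) x xt J \<in> dm" by (intro newz_dm step_tau_pos)
    show "\<omega>' = ((fst \<omega>)(Suc k := newy x xt W), (fst (snd \<omega>))(Suc k := newz (step_tau s) (Z k) x xt J), us @ map fst W)"
      by (simp add: WJ \<omega>)
    show "set (snd (snd \<omega>)) \<subseteq> set (us @ map fst W)" by (simp add: \<omega>)
  qed
qed

lemma xt_of_upd: "k \<ge> s * m \<Longrightarrow> xt_of s (Y(Suc k := y)) = xt_of s Y"
proof (cases s)
  case 0
  then show ?thesis by (simp add: xt_of_def)
next
  case (Suc r)
  assume k: "k \<ge> s * m"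
  have "(Y(Suc k := y)) (r * m + i + 1) = Y (r * m + i + 1)" if "i < m" for i
    using that k Suc by simp
  then show ?thesis unfolding Suc xt_of_def by (auto intro!: ext sum.cong)
qed

lemma Hn_xt_of: "\<omega>' \<in> set_pmf (Hn (s * m) t \<omega>) \<Longrightarrow> xt_of s (fst \<omega>') = xt_of s (fst \<omega>)"
proof (induction t arbitrary: \<omega>')
  case (Suc t)
  then obtain \<omega>1 where 1: "\<omega>1 \<in> set_pmf (Hn (s * m) t \<omega>)" "\<omega>' \<in> set_pmf (hstep (s * m + t) \<omega>1)" by auto
  obtain y where "fst \<omega>' = (fst \<omega>1)(Suc (s * m + t) := y)" using hstep_support[OF 1(2)] by auto
  then have "xt_of s (fst \<omega>') = xt_of s (fst \<omega>1)" by (simp only: xt_of_upd le_add1)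
  then show ?case using Suc.IH[OF 1(1)] by simp
qed simp

definition pin :: "nat \<Rightarrow> nat \<Rightarrow> hist \<Rightarrow> istate" where
  "pin s t \<omega> = (case \<omega> of (Y, Z, us) \<Rightarrow> (Y (s * m + t), Z (s * m + t), (\<lambda>j. \<Sum>i<t. Y (s * m + i + 1) j), us))"

definition pout :: "nat \<Rightarrow> hist \<Rightarrow> ostate" where
  "pout s \<omega> = (case \<omega> of (Y, Z, us) \<Rightarrow> (xt_of s Y, Y (s * m), Z (s * m), us))"

lemma istep_pin:
  assumes t: "t < m"
  shows "istep s (xt_of s (fst \<omega>)) (pin s t \<omega>) = map_pmf (pin s (Suc t)) (hstep (s * m + t) \<omega>)"
proof -
  obtain Y Z us where \<omega>: "\<omega> = (Y, Z, us)" by (metis prod_cases3)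
  have div: "(s * m + t) div m = s" using t by simp
  have pin: "pin s (Suc t) (Y(Suc (s * m + t) := y'), Z', us')
      = (y', Z' (Suc (s * m + t)), (\<lambda>j. (\<Sum>i<t. Y (s * m + i + 1) j) + y' j), us')" for y' Z' us'
  proof -
    have "(\<Sum>i<t. (Y(Suc (s * m + t) := y')) (s * m + i + 1) j) = (\<Sum>i<t. Y (s * m + i + 1) j)" for j
      by (rule sum.cong) auto
    then show ?thesis by (simp add: pin_def)
  qed
  show ?thesis
    unfolding \<omega> hstep_eq Let_def div fst_conv pin_def[of s t] prod.case istep_eq map_bind_pmf pmf.map_comp o_def pin
    by simp
qed

text \<open>The inner loop has a fixed snapshot whereas the history recomputes it at every step.
  They agree because the snapshot of epoch \<open>s\<close> depends only on entries up to
  \<open>s * m\<close>.\<close>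

lemma inner_loop_Hn:
  assumes "t \<le> m"
  shows "inner_loop n gr h L d N B lam b t2 s (xt_of s (fst \<omega>)) (gb (xt_of s (fst \<omega>))) t (pin s 0 \<omega>)
    = map_pmf (pin s t) (Hn (s * m) t \<omega>)"
  using assms
proof (induction t)
  case 0
  then show ?case by simp
next
  case (Suc t)
  let ?xt = "xt_of s (fst \<omega>)"
  have "inner_loop n gr h L d N B lam b t2 s ?xt (gb ?xt) (Suc t) (pin s 0 \<omega>)
      = bind_pmf (Hn (s * m) t \<omega>) (\<lambda>\<omega>'. istep s ?xt (pin s t \<omega>'))"
    using Suc by (simp add: bind_map_pmf)
  also have "\<dots> = bind_pmf (Hn (s * m) t \<omega>) (\<lambda>\<omega>'. map_pmf (pin s (Suc t)) (hstep (s * m + t) \<omega>'))"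
  proof (rule bind_pmf_cong[OF refl])
    fix \<omega>' assume "\<omega>' \<in> set_pmf (Hn (s * m) t \<omega>)"
    then show "istep s ?xt (pin s t \<omega>') = map_pmf (pin s (Suc t)) (hstep (s * m + t) \<omega>')"
      using istep_pin[of t s \<omega>'] Hn_xt_of[of \<omega>' s t \<omega>] Suc.prems by simp
  qed
  finally show ?case by (simp add: map_bind_pmf)
qed

lemma epoch_Hn: "epoch n gr h L d N m B lam b t2 s (pout s \<omega>) = map_pmf (pout (Suc s)) (Hn (s * m) m \<omega>)"
proof -
  obtain Y Z us where \<omega>: "\<omega> = (Y, Z, us)" by (metis prod_cases3)
  have pin0: "pin s 0 \<omega> = (Y (s * m), Z (s * m), (\<lambda>_. 0), us)" by (simp add: pin_def \<omega>)
  have "epoch n gr h L d N m B lam b t2 s (pout s \<omega>)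
      = map_pmf (\<lambda>(y', z', ysum, us'). ((\<lambda>j. ysum j / real m), y', z', us'))
         (inner_loop n gr h L d N B lam b t2 s (xt_of s (fst \<omega>)) (gb (xt_of s (fst \<omega>))) m (pin s 0 \<omega>))"
    unfolding pin0 by (simp add: epoch_def pout_def \<omega> gb_def)
  also have "\<dots> = map_pmf (\<lambda>\<omega>. (\<lambda>(y', z', ysum, us'). ((\<lambda>j. ysum j / real m), y', z', us')) (pin s m \<omega>)) (Hn (s * m) m \<omega>)"
    unfolding inner_loop_Hn[OF order_refl] pmf.map_comp o_def ..
  also have "(\<lambda>\<omega>. (\<lambda>(y', z', ysum, us'). ((\<lambda>j. ysum j / real m), y', z', us')) (pin s m \<omega>)) = pout (Suc s)"
    by (rule ext) (auto simp: pin_def pout_def xt_of_def add.commute split: prod.split)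
  finally show ?thesis .
qed

lemma alpc_run_H: "alpc_run n gr h L d N m B lam b t2 x0 s = map_pmf (pout s) (H (s * m))"
proof (induction s)
  case 0
  then show ?case by (simp add: pout_def xt_of_def)
next
  case (Suc s)
  have "alpc_run n gr h L d N m B lam b t2 x0 (Suc s)
      = bind_pmf (H (s * m)) (\<lambda>\<omega>. map_pmf (pout (Suc s)) (Hn (s * m) m \<omega>))"
    by (simp add: Suc bind_map_pmf epoch_Hn)
  also have "\<dots> = map_pmf (pout (Suc s)) (H (s * m + m))" by (simp add: H_Hn map_bind_pmf)
  finally show ?case by (simp add: add.commute)
qed

lemma finite_hstep: "finite (set_pmf (hstep k \<omega>))"
proof -
  obtain Y Z us where \<omega>: "\<omega> = (Y, Z, us)" by (metis prod_cases3)
  show ?thesis unfolding \<omega> hstep_eq Let_def by (auto simp: finite_workers[OF n_ge] finite_samples[OF n_ge])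
qed

lemma finite_H: "finite (set_pmf (H k))"
  by (induction k) (auto simp: finite_hstep)

lemma H_support:
  assumes "\<omega> \<in> set_pmf (H k)"
  shows "fst \<omega> i \<in> dm" "fst (snd \<omega>) i \<in> dm" "fst \<omega> 0 = x0" "fst (snd \<omega>) 0 = x0"
proof -
  have "(\<forall>i. fst \<omega> i \<in> dm \<and> fst (snd \<omega>) i \<in> dm) \<and> fst \<omega> 0 = x0 \<and> fst (snd \<omega>) 0 = x0"
    using assms
  proof (induction k arbitrary: \<omega>)
    case 0
    then show ?case using x0_dm by simp
  next
    case (Suc k)
    then obtain \<omega>1 where 1: "\<omega>1 \<in> set_pmf (H k)" "\<omega> \<in> set_pmf (hstep k \<omega>1)" by auto
    obtain y z us where "y \<in> dm" "z \<in> dm" "\<omega> = ((fst \<omega>1)(Suc k := y), (fst (snd \<omega>1))(Suc k := z), us)"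
      using hstep_support[OF 1(2)] by blast
    then show ?case using Suc.IH[OF 1(1)] by simp
  qed
  then show "fst \<omega> i \<in> dm" "fst (snd \<omega>) i \<in> dm" "fst \<omega> 0 = x0" "fst (snd \<omega>) 0 = x0" by auto
qed

lemma xt_of_jensen:
  assumes F: "conv_fun_on C F" and Y: "\<And>i. Y i \<in> C"
  shows "xt_of s Y \<in> C" "F (xt_of s Y) \<le> prv m s (\<lambda>j. F (Y j))"
proof -
  have "xt_of s Y \<in> C \<and> F (xt_of s Y) \<le> prv m s (\<lambda>j. F (Y j))"
  proof (cases s)
    case 0
    then show ?thesis using Y by (simp add: xt_of_def prv_def)
  next
    case (Suc r)
    have "(\<lambda>j. \<Sum>i<m. 1 / real m * Y (r * m + i + 1) j) \<in> C
        \<and> F (\<lambda>j. \<Sum>i<m. 1 / real m * Y (r * m + i + 1) j) \<le> (\<Sum>i<m. 1 / real m * F (Y (r * m + i + 1)))"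
      by (rule conv_fun_on_jensen[OF F]) (use Y m_ge in auto)
    moreover have "(\<lambda>j. \<Sum>i<m. 1 / real m * Y (r * m + i + 1) j) = xt_of s Y"
      unfolding Suc xt_of_def by (simp add: sum_divide_distrib)
    moreover have "(\<Sum>i<m. 1 / real m * F (Y (r * m + i + 1))) = prv m s (\<lambda>j. F (Y j))"
      unfolding Suc prv_Suc by (simp add: sum_divide_distrib)
    ultimately show ?thesis by simp
  qed
  then show "xt_of s Y \<in> C" "F (xt_of s Y) \<le> prv m s (\<lambda>j. F (Y j))" by auto
qed

lemma H_extend:
  assumes "\<omega> \<in> set_pmf (H k)" "k \<le> k'"
  shows "\<exists>\<omega>'\<in>set_pmf (H k'). set (snd (snd \<omega>)) \<subseteq> set (snd (snd \<omega>'))"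
  using assms(2)
proof (induction k' rule: dec_induct)
  case base
  then show ?case using assms(1) by blast
next
  case (step k')
  then obtain \<omega>1 where 1: "\<omega>1 \<in> set_pmf (H k')" "set (snd (snd \<omega>)) \<subseteq> set (snd (snd \<omega>1))" by blast
  obtain \<omega>2 where 2: "\<omega>2 \<in> set_pmf (hstep k' \<omega>1)" using set_pmf_not_empty[of "hstep k' \<omega>1"] by blast
  have "\<omega>2 \<in> set_pmf (H (Suc k'))" using 1 2 by auto
  moreover have "set (snd (snd \<omega>1)) \<subseteq> set (snd (snd \<omega>2))" using hstep_support[OF 2] by auto
  ultimately show ?case using 1(2) by blast
qed

text \<open>Let a worker draw \<open>I\<close> after the given history and continue to a complete
  run. The vector then stands in the record of that run, to which the assumed bound applies.\<close>

lemma few_H: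
  assumes k: "k < m * S" and \<omega>: "\<omega> \<in> set_pmf (H k)" and I: "I \<in> set_pmf (samples n B)"
  defines "xt \<equiv> xt_of (k div m) (fst \<omega>)"
  defines "x \<equiv> xpt (k div m) xt (fst \<omega> k) (fst (snd \<omega>) k)"
  shows "real (outside_count d lam b (\<lambda>j. (1 / real B) * (\<Sum>a\<leftarrow>I. gr a x j - gr a xt j))) \<le> dl"
proof -
  define u where "u = (\<lambda>j. (1 / real B) * (\<Sum>a\<leftarrow>I. gr a x j - gr a xt j))"
  obtain Y Z us where e: "\<omega> = (Y, Z, us)" by (metis prod_cases3)
  obtain W where W: "W \<in> set_pmf (workers n gr d B lam b x xt N)" "u \<in> fst ` set W"
    using sampled_in_round[OF N_ge I, of gr d lam b x xt] unfolding u_def by blast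
  obtain \<omega>1 where "\<omega>1 \<in> set_pmf (hstep k \<omega>)" "u \<in> set (snd (snd \<omega>1))"
  proof -
    have "(Y(Suc k := newy x xt W), Z(Suc k := newz (step_tau (k div m)) (Z k) x xt I), us @ map fst W) \<in> set_pmf (hstep k \<omega>)"
      using W(1) I unfolding e hstep_eq Let_def x_def xt_def by auto
    then show ?thesis using W(2) by (intro that[of "(Y(Suc k := newy x xt W), Z(Suc k := newz (step_tau (k div m)) (Z k) x xt I), us @ map fst W)"]) auto
  qed
  moreover from this have "\<omega>1 \<in> set_pmf (H (Suc k))" using \<omega> by auto
  then obtain \<omega>2 where "\<omega>2 \<in> set_pmf (H (S * m))" "set (snd (snd \<omega>1)) \<subseteq> set (snd (snd \<omega>2))"
    using H_extend[of \<omega>1 "Suc k" "S * m"] k by (auto simp: mult.commute)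
  ultimately have "pout S \<omega>2 \<in> set_pmf (alpc_run n gr h L d N m B lam b t2 x0 S)" "u \<in> set (snd (snd (snd (pout S \<omega>2))))"
    unfolding alpc_run_H by (auto simp: pout_def split: prod.splits)
  then show ?thesis unfolding u_def[symmetric] by (rule few_final)
qed

text \<open>Takes the place of measurability with respect to the iterates up to \<open>k\<close>, in
  a form that is checked by rewriting.\<close>

definition hinv :: "nat \<Rightarrow> (hist \<Rightarrow> 'a) \<Rightarrow> bool" where
  "hinv k \<phi> \<longleftrightarrow> (\<forall>Y Z us us' j y z. j > k \<longrightarrow> \<phi> (Y(j := y), Z(j := z), us') = \<phi> (Y, Z, us))"

text \<open>Allows all sequences to be defined as expectations under one law, that of the complete
  history.\<close>

lemma E_H_inv:
  fixes \<phi> :: "hist \<Rightarrow> real"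
  assumes inv: "hinv k \<phi>" and k: "k \<le> k'"
  shows "E (H k') \<phi> = E (H k) \<phi>"
  using k
proof (induction k' rule: dec_induct)
  case base
  then show ?case by simp
next
  case (step k')
  have "E (H (Suc k')) \<phi> = E (H k') (\<lambda>\<omega>. E (hstep k' \<omega>) \<phi>)"
    unfolding H.simps by (rule E_bind[OF finite_H finite_hstep])
  also have "\<dots> = E (H k') \<phi>"
  proof (rule E_cong)
    fix \<omega>
    have "E (hstep k' \<omega>) \<phi> = E (hstep k' \<omega>) (\<lambda>_. \<phi> \<omega>)"
    proof (rule E_cong)
      fix \<omega>' assume "\<omega>' \<in> set_pmf (hstep k' \<omega>)"
      then obtain y z us where "\<omega>' = ((fst \<omega>)(Suc k' := y), (fst (snd \<omega>))(Suc k' := z), us)"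
        using hstep_support by blast
      then show "\<phi> \<omega>' = \<phi> \<omega>" using inv step.hyps unfolding hinv_def by (metis le_imp_less_Suc prod.collapse)
    qed
    then show "E (hstep k' \<omega>) \<phi> = \<phi> \<omega>" by simp
  qed
  finally show ?case using step by simp
qed

abbreviation T :: nat where "T \<equiv> m * S"

abbreviation ET :: "(hist \<Rightarrow> real) \<Rightarrow> real" where "ET \<equiv> E (H T)"

definition ybf :: "nat \<Rightarrow> hist \<Rightarrow> rvec" where
  "ybf k \<omega> = (\<lambda>j. step_tau (k div m) * fst (snd \<omega>) (Suc k) j + t2 * xt_of (k div m) (fst \<omega>) j
      + (1 - step_tau (k div m) - t2) * fst \<omega> k j)"

text \<open>Conditioning on the history at \<open>k\<close> turns the random comparison point
  \<open>U\<close> into a fixed one, as \<open>one_step\<close> requires.\<close>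

lemma expected_step:
  assumes k: "k < T" and U: "hinv k U" "\<And>\<omega>. \<omega> \<in> set_pmf (H k) \<Longrightarrow> U \<omega> \<in> dm"
  shows "ET (\<lambda>\<omega>. Pr (fst \<omega> (Suc k)) + 7 / 5 * (L * sqn d (vdiff (fst \<omega> (Suc k)) (ybf k \<omega>)))
        + (step_tau (k div m))\<^sup>2 * (3 * L * sqn d (vdiff (U \<omega>) (fst (snd \<omega>) (Suc k)))))
    \<le> ET (\<lambda>\<omega>. step_tau (k div m) * Pr (U \<omega>) + t2 * Pr (xt_of (k div m) (fst \<omega>))
        + (1 - step_tau (k div m) - t2) * Pr (fst \<omega> k)
        + (step_tau (k div m))\<^sup>2 * (3 * L * sqn d (vdiff (U \<omega>) (fst (snd \<omega>) k))))"
proof -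
  define s where "s = k div m"
  define \<tau> where "\<tau> = step_tau s"
  have sk: "s * m \<le> k" by (simp add: s_def)
  define \<phi> where "\<phi> \<omega> = Pr (fst \<omega> (Suc k)) + 7 / 5 * (L * sqn d (vdiff (fst \<omega> (Suc k)) (ybf k \<omega>)))
        + \<tau>\<^sup>2 * (3 * L * sqn d (vdiff (U \<omega>) (fst (snd \<omega>) (Suc k))))" for \<omega> :: hist
  define \<psi> where "\<psi> \<omega> = \<tau> * Pr (U \<omega>) + t2 * Pr (xt_of s (fst \<omega>)) + (1 - \<tau> - t2) * Pr (fst \<omega> k)
        + \<tau>\<^sup>2 * (3 * L * sqn d (vdiff (U \<omega>) (fst (snd \<omega>) k)))" for \<omega> :: hist
  have Uinv: "U (Y(j := y), Z(j := z), us') = U (Y, Z, us)" if "j > k" for Y Z us us' j y z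
    using U(1) that unfolding hinv_def by blast
  have Uus: "U (Y, Z, us') = U (Y, Z, us)" for Y Z us us'
    using Uinv[of "Suc k" Y "Y (Suc k)" Z "Z (Suc k)" us' us] by simp
  have xtu: "xt_of s (Y(j := y)) = xt_of s Y" if "j > k" for Y y j
    using xt_of_upd[of s "j - 1" Y y] that sk by simp
  have i1: "hinv (Suc k) \<phi>"
    unfolding hinv_def
  proof (intro allI impI)
    fix Y Z :: "nat \<Rightarrow> rvec" and us us' j y z assume j: "Suc k < j"
    then show "\<phi> (Y(j := y), Z(j := z), us') = \<phi> (Y, Z, us)"
      by (simp add: \<phi>_def ybf_def s_def[symmetric] xtu Uinv[of j Y y Z z us' us])
  qed
  have i2: "hinv k \<psi>"
    unfolding hinv_def
  proof (intro allI impI)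
    fix Y Z :: "nat \<Rightarrow> rvec" and us us' j y z assume j: "k < j"
    then show "\<psi> (Y(j := y), Z(j := z), us') = \<psi> (Y, Z, us)"
      by (simp add: \<psi>_def xtu Uinv[of j Y y Z z us' us])
  qed
  have "ET \<phi> = E (H (Suc k)) \<phi>" by (rule E_H_inv[OF i1]) (use k in simp)
  also have "\<dots> = E (H k) (\<lambda>\<omega>. E (hstep k \<omega>) \<phi>)"
    unfolding H.simps by (rule E_bind[OF finite_H finite_hstep])
  also have "\<dots> \<le> E (H k) \<psi>"
  proof (rule E_mono[OF finite_H])
    fix \<omega> assume \<omega>: "\<omega> \<in> set_pmf (H k)"
    obtain Y Z us where e: "\<omega> = (Y, Z, us)" by (metis prod_cases3)
    define xt where "xt = xt_of s Y"
    define x where "x = xpt s xt (Y k) (Z k)"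
    have Ydm: "Y i \<in> dm" and Zdm: "Z i \<in> dm" for i using H_support(1,2)[OF \<omega>, of i] by (auto simp: e)
    have xtdm: "xt \<in> dm" unfolding xt_def by (rule xt_of_jensen(1)[OF hr_conv Ydm])
    have Udm: "U (Y, Z, us) \<in> dm" using U(2)[OF \<omega>] by (simp add: e)
    have "E (hstep k \<omega>) \<phi> = E (workers n gr d B lam b x xt N) (\<lambda>W. E (samples n B) (\<lambda>J.
        \<phi> (Y(Suc k := newy x xt W), Z(Suc k := newz \<tau> (Z k) x xt J), us @ map fst W)))"
      unfolding e hstep_eq Let_def s_def[symmetric] xt_def[symmetric] x_def[symmetric] \<tau>_def[symmetric]
      by (subst E_bind) (auto simp: finite_workers[OF n_ge] finite_samples[OF n_ge])
    also have "\<dots> = E (workers n gr d B lam b x xt N) (\<lambda>W. E (samples n B) (\<lambda>J.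
      Pr (newy x xt W)
      + 7 / 5 * (L * sqn d (vdiff (newy x xt W) (\<lambda>j. \<tau> * newz \<tau> (Z k) x xt J j + t2 * xt j + (1 - \<tau> - t2) * Y k j)))
      + \<tau>\<^sup>2 * (3 * L * sqn d (vdiff (U (Y, Z, us)) (newz \<tau> (Z k) x xt J)))))"
      by (intro E_cong) (simp add: \<phi>_def ybf_def s_def[symmetric] \<tau>_def[symmetric] xtu xt_def[symmetric]
          Uinv[of "Suc k" Y _ Z _ _ us])
    also have "\<dots> \<le> \<tau> * Pr (U (Y, Z, us)) + t2 * Pr xt + (1 - \<tau> - t2) * Pr (Y k) + \<tau>\<^sup>2 * (3 * L * sqn d (vdiff (U (Y, Z, us)) (Z k)))"
      unfolding x_def xpt_def \<tau>_def
    proof (rule one_step[OF step_tau_pos step_tau_le_half Ydm Zdm xtdm Udm])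
      fix I assume "I \<in> set_pmf (samples n B)"
      from few_H[OF k \<omega> this] show "real (outside_count d lam b (\<lambda>j. (1 / real B) * (\<Sum>a\<leftarrow>I.
          gr a (\<lambda>j. step_tau s * Z k j + t2 * xt j + (1 - step_tau s - t2) * Y k j) j - gr a xt j))) \<le> dl"
        by (simp add: e s_def[symmetric] xt_def[symmetric] xpt_def)
    qed
    finally show "E (hstep k \<omega>) \<phi> \<le> \<psi> \<omega>" by (simp add: \<psi>_def e xt_def)
  qed
  also have "\<dots> = ET \<psi>" by (rule E_H_inv[OF i2, symmetric]) (use k in simp)
  finally show ?thesis unfolding \<phi>_def \<psi>_def s_def \<tau>_def .
qed

section \<open>The sequences for the abstract recursion\<close>

definition gap :: "nat \<Rightarrow> real" where "gap k = ET (\<lambda>\<omega>. Pr (fst \<omega> k) - Pr xs)"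
definition RR :: "nat \<Rightarrow> real" where "RR k = ET (\<lambda>\<omega>. 3 * L * sqn d (vdiff xs (fst (snd \<omega>) k)))"
definition YY :: "nat \<Rightarrow> real" where "YY k = ET (\<lambda>\<omega>. 3 * L * sqn d (vdiff (fst \<omega> k) xs))"
definition GG :: "nat \<Rightarrow> nat \<Rightarrow> real" where "GG j k = ET (\<lambda>\<omega>. 3 * L * sqn d (vdiff (fst \<omega> j) (fst (snd \<omega>) k)))"
definition ee :: "nat \<Rightarrow> real" where "ee k = ET (\<lambda>\<omega>. L * sqn d (vdiff (fst \<omega> k) (ybf (k - 1) \<omega>)))"

lemma E_prv: "ET (\<lambda>\<omega>. prv m s (\<lambda>j. F j \<omega>)) = prv m s (\<lambda>j. ET (F j))"
  by (simp add: prv_def E_sum[OF finite_H])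

lemma xt_gap: "ET (\<lambda>\<omega>. Pr (xt_of s (fst \<omega>)) - Pr xs) \<le> prv m s gap"
proof -
  have "ET (\<lambda>\<omega>. Pr (xt_of s (fst \<omega>)) - Pr xs) \<le> ET (\<lambda>\<omega>. prv m s (\<lambda>j. Pr (fst \<omega> j) - Pr xs))"
  proof (rule E_mono[OF finite_H])
    fix \<omega> assume "\<omega> \<in> set_pmf (H T)"
    then have "Pr (xt_of s (fst \<omega>)) \<le> prv m s (\<lambda>j. Pr (fst \<omega> j))"
      by (intro xt_of_jensen(2)[OF Pr_conv] H_support(1))
    moreover have "prv m s (\<lambda>j. Pr (fst \<omega> j)) = prv m s (\<lambda>j. Pr (fst \<omega> j) - Pr xs) + Pr xs"
      using prv_add[of m s "\<lambda>j. Pr (fst \<omega> j) - Pr xs" "\<lambda>_. Pr xs"] prv_const[OF m_ge, of s "Pr xs"] by simp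
    ultimately show "Pr (xt_of s (fst \<omega>)) - Pr xs \<le> prv m s (\<lambda>j. Pr (fst \<omega> j) - Pr xs)" by simp
  qed
  also have "\<dots> = prv m s gap" unfolding gap_def E_prv ..
  finally show ?thesis .
qed

lemma gap_step:
  assumes k: "k < T" and U: "hinv k U" "\<And>k \<omega>. \<omega> \<in> set_pmf (H k) \<Longrightarrow> U \<omega> \<in> dm"
  shows "gap (Suc k) + 7 / 5 * ee (Suc k) + (step_tau (k div m))\<^sup>2 * ET (\<lambda>\<omega>. 3 * L * sqn d (vdiff (U \<omega>) (fst (snd \<omega>) (Suc k))))
    \<le> (1 - step_tau (k div m) - t2) * gap k + step_tau (k div m) * ET (\<lambda>\<omega>. Pr (U \<omega>) - Pr xs)
      + t2 * prv m (k div m) gap + (step_tau (k div m))\<^sup>2 * ET (\<lambda>\<omega>. 3 * L * sqn d (vdiff (U \<omega>) (fst (snd \<omega>) k)))"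
proof -
  define \<tau> where "\<tau> = step_tau (k div m)"
  note lin = E_add[OF finite_H] E_diff[OF finite_H] E_const integral_mult_right_zero
  define a1 a2 a3 a4 a5 a6 a7 where "a1 = ET (\<lambda>\<omega>. Pr (fst \<omega> (Suc k)))"
    and "a2 = ET (\<lambda>\<omega>. L * sqn d (vdiff (fst \<omega> (Suc k)) (ybf k \<omega>)))"
    and "a3 = ET (\<lambda>\<omega>. 3 * L * sqn d (vdiff (U \<omega>) (fst (snd \<omega>) (Suc k))))"
    and "a4 = ET (\<lambda>\<omega>. Pr (U \<omega>))" and "a5 = ET (\<lambda>\<omega>. Pr (xt_of (k div m) (fst \<omega>)))"
    and "a6 = ET (\<lambda>\<omega>. Pr (fst \<omega> k))" and "a7 = ET (\<lambda>\<omega>. 3 * L * sqn d (vdiff (U \<omega>) (fst (snd \<omega>) k)))"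
  have "a1 + 7 / 5 * a2 + \<tau>\<^sup>2 * a3 \<le> \<tau> * a4 + t2 * a5 + (1 - \<tau> - t2) * a6 + \<tau>\<^sup>2 * a7"
    using expected_step[OF k U] unfolding lin a1_def a2_def a3_def a4_def a5_def a6_def a7_def \<tau>_def .
  moreover have "t2 * (a5 - Pr xs) \<le> t2 * prv m (k div m) gap"
    using xt_gap[of "k div m"] t2_nonneg unfolding lin a5_def by (intro mult_left_mono)
  ultimately have "(a1 - Pr xs) + 7 / 5 * a2 + \<tau>\<^sup>2 * a3 \<le> (1 - \<tau> - t2) * (a6 - Pr xs) + \<tau> * (a4 - Pr xs) + t2 * prv m (k div m) gap + \<tau>\<^sup>2 * a7"
    by (simp add: algebra_simps)
  then show ?thesis
    unfolding gap_def ee_def lin a1_def a2_def a3_def a4_def a5_def a6_def a7_def \<tau>_def diff_Suc_1 .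
qed

text \<open>Young's inequality separates y' from yb; then the squared distance to \<open>q\<close>
  is convex along the combination that defines yb and along the average that defines the
  snapshot.\<close>

lemma near_ybf:
  assumes \<beta>: "\<beta> > 0"
  shows "sqn d (vdiff (fst \<omega> (Suc k)) q) \<le> (1 + \<beta>) * (step_tau (k div m) * sqn d (vdiff (fst (snd \<omega>) (Suc k)) q)
      + t2 * prv m (k div m) (\<lambda>j. sqn d (vdiff (fst \<omega> j) q)) + (1 - step_tau (k div m) - t2) * sqn d (vdiff (fst \<omega> k) q))
      + (1 + 1 / \<beta>) * sqn d (vdiff (fst \<omega> (Suc k)) (ybf k \<omega>))"
proof -
  define \<tau> where "\<tau> = step_tau (k div m)"
  have \<tau>: "\<tau> > 0" "\<tau> + t2 \<le> 1" using step_tau_pos step_tau_le_half[of "k div m"] t2_le by (auto simp: \<tau>_def)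
  have "sqn d (vdiff (ybf k \<omega>) q) \<le> \<tau> * sqn d (vdiff (fst (snd \<omega>) (Suc k)) q)
      + t2 * sqn d (vdiff (xt_of (k div m) (fst \<omega>)) q) + (1 - \<tau> - t2) * sqn d (vdiff (fst \<omega> k) q)"
    unfolding ybf_def \<tau>_def[symmetric] using \<tau> t2_nonneg by (intro conv_fun_on_comb3(2)[OF conv_fun_on_sqn]) auto
  also have "\<dots> \<le> \<tau> * sqn d (vdiff (fst (snd \<omega>) (Suc k)) q)
      + t2 * prv m (k div m) (\<lambda>j. sqn d (vdiff (fst \<omega> j) q)) + (1 - \<tau> - t2) * sqn d (vdiff (fst \<omega> k) q)"
    by (intro add_mono mult_left_mono order_refl t2_nonneg xt_of_jensen(2)[OF conv_fun_on_sqn]) simp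
  finally have *: "(1 + \<beta>) * sqn d (vdiff (ybf k \<omega>) q) \<le> (1 + \<beta>) * (\<tau> * sqn d (vdiff (fst (snd \<omega>) (Suc k)) q)
      + t2 * prv m (k div m) (\<lambda>j. sqn d (vdiff (fst \<omega> j) q)) + (1 - \<tau> - t2) * sqn d (vdiff (fst \<omega> k) q))"
    using \<beta> by (intro mult_left_mono) auto
  have "vdiff (fst \<omega> (Suc k)) q = (\<lambda>j. vdiff (ybf k \<omega>) q j + vdiff (fst \<omega> (Suc k)) (ybf k \<omega>) j)" by (simp add: vdiff_def)
  then have "sqn d (vdiff (fst \<omega> (Suc k)) q) \<le> (1 + \<beta>) * sqn d (vdiff (ybf k \<omega>) q) + (1 + 1 / \<beta>) * sqn d (vdiff (fst \<omega> (Suc k)) (ybf k \<omega>))"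
    using sqn_young[OF \<beta>] by metis
  then show ?thesis using * unfolding \<tau>_def by linarith
qed

end

context alpc_process
begin

lemma Lsqn_nonneg: "0 \<le> 3 * L * sqn d v"
  using L_pos sqn_nonneg[of d v] by simp

lemma gap_nonneg: "0 \<le> gap k"
  unfolding gap_def by (rule E_nonneg) (use H_support(1) Pr_min in auto)

lemma sqn_self: "sqn d (vdiff v v) = 0"
  by (simp add: sqn_sum vdiff_def)

lemma gap_0: "gap 0 = Pr x0 - Pr xs"
proof -
  have "gap 0 = ET (\<lambda>_. Pr x0 - Pr xs)" unfolding gap_def by (rule E_cong) (simp add: H_support(3))
  then show ?thesis by simp
qed

lemma RR_0: "RR 0 = 3 * L * sqn d (vdiff x0 xs)"
proof -
  have "RR 0 = ET (\<lambda>_. 3 * L * sqn d (vdiff x0 xs))"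
    unfolding RR_def by (rule E_cong) (simp add: H_support(4) sqn_swap[of d xs x0])
  then show ?thesis by simp
qed

lemma YY_0: "YY 0 = RR 0"
proof -
  have "YY 0 = ET (\<lambda>_. 3 * L * sqn d (vdiff x0 xs))" unfolding YY_def by (rule E_cong) (simp add: H_support(3))
  then show ?thesis by (simp add: RR_0)
qed

lemma near_ybf_expectation:
  assumes \<beta>: "\<beta> > 0"
  shows "ET (\<lambda>\<omega>. 3 * L * sqn d (vdiff (fst \<omega> (Suc k)) (q \<omega>)))
    \<le> (1 + \<beta>) * (step_tau (k div m) * ET (\<lambda>\<omega>. 3 * L * sqn d (vdiff (fst (snd \<omega>) (Suc k)) (q \<omega>)))
        + t2 * prv m (k div m) (\<lambda>j. ET (\<lambda>\<omega>. 3 * L * sqn d (vdiff (fst \<omega> j) (q \<omega>))))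
        + (1 - step_tau (k div m) - t2) * ET (\<lambda>\<omega>. 3 * L * sqn d (vdiff (fst \<omega> k) (q \<omega>))))
      + (1 + 1 / \<beta>) * (3 * ee (Suc k))"
proof -
  define \<tau> where "\<tau> = step_tau (k div m)"
  have path: "3 * L * sqn d (vdiff (fst \<omega> (Suc k)) (q \<omega>))
      \<le> (1 + \<beta>) * (\<tau> * (3 * L * sqn d (vdiff (fst (snd \<omega>) (Suc k)) (q \<omega>)))
        + t2 * prv m (k div m) (\<lambda>j. 3 * L * sqn d (vdiff (fst \<omega> j) (q \<omega>)))
        + (1 - \<tau> - t2) * (3 * L * sqn d (vdiff (fst \<omega> k) (q \<omega>))))
      + (1 + 1 / \<beta>) * (3 * (L * sqn d (vdiff (fst \<omega> (Suc k)) (ybf k \<omega>))))" for \<omega>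
    using mult_left_mono[OF near_ybf[OF \<beta>, of \<omega> k "q \<omega>"], of "3 * L"] L_pos
    unfolding prv_cmult \<tau>_def[symmetric] by (simp add: algebra_simps)
  have "ET (\<lambda>\<omega>. 3 * L * sqn d (vdiff (fst \<omega> (Suc k)) (q \<omega>)))
      \<le> ET (\<lambda>\<omega>. (1 + \<beta>) * (\<tau> * (3 * L * sqn d (vdiff (fst (snd \<omega>) (Suc k)) (q \<omega>)))
        + t2 * prv m (k div m) (\<lambda>j. 3 * L * sqn d (vdiff (fst \<omega> j) (q \<omega>)))
        + (1 - \<tau> - t2) * (3 * L * sqn d (vdiff (fst \<omega> k) (q \<omega>))))
      + (1 + 1 / \<beta>) * (3 * (L * sqn d (vdiff (fst \<omega> (Suc k)) (ybf k \<omega>)))))"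
    by (rule E_mono[OF finite_H path])
  then show ?thesis
    unfolding E_add[OF finite_H] integral_mult_right_zero E_prv ee_def \<tau>_def diff_Suc_1 .
qed

sublocale rates: rate_sequences m S t2 gap RR YY ee GG
proof
  show "1 \<le> m" "1 \<le> S" "0 \<le> t2" "t2 \<le> 1 / 2" by (rule m_ge S_ge t2_nonneg t2_le)+
  show "0 \<le> gap k" for k by (rule gap_nonneg)
  show "0 \<le> RR k" "0 \<le> YY k" for k unfolding RR_def YY_def by (rule E_nonneg, rule Lsqn_nonneg)+
  show "0 \<le> GG j k" for j k unfolding GG_def by (rule E_nonneg, rule Lsqn_nonneg)
  show "0 \<le> ee k" for k unfolding ee_def by (rule E_nonneg) (use L_pos sqn_nonneg in simp)
  show "YY 0 = RR 0" by (rule YY_0)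
  show "gap (Suc k) + 7 / 5 * ee (Suc k) + (step_tau (k div m))\<^sup>2 * RR (Suc k)
      \<le> (1 - step_tau (k div m) - t2) * gap k + t2 * prv m (k div m) gap + (step_tau (k div m))\<^sup>2 * RR k"
    if k: "k < m * S" for k
  proof -
    have "hinv k (\<lambda>_. xs)" by (simp add: hinv_def)
    from gap_step[OF k this] xs_dm show ?thesis unfolding RR_def by simp
  qed
  show "gap (Suc k) + 7 / 5 * ee (Suc k) + (step_tau (k div m))\<^sup>2 * GG j (Suc k)
      \<le> (1 - step_tau (k div m) - t2) * gap k + step_tau (k div m) * gap j
        + t2 * prv m (k div m) gap + (step_tau (k div m))\<^sup>2 * GG j k"
    if k: "k < m * S" and j: "j \<le> k" for k j
  proof -
    have "hinv k (\<lambda>\<omega>. fst \<omega> j)" using j by (simp add: hinv_def)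
    from gap_step[OF k this] H_support(1) show ?thesis unfolding GG_def gap_def by simp
  qed
  show "GG (Suc k) (Suc k) \<le> (1 + \<beta>) * ((1 - step_tau (k div m) - t2) * GG k (Suc k) + t2 * prv m (k div m) (\<lambda>j. GG j (Suc k)))
      + (1 + 1 / \<beta>) * (3 * ee (Suc k))" if "0 < \<beta>" for k \<beta>
    \<comment> \<open>With the new z as reference point, the z-term is the distance of a point to
      itself and vanishes.\<close>
    using near_ybf_expectation[OF that, of k "\<lambda>\<omega>. fst (snd \<omega>) (Suc k)"]
    unfolding GG_def[symmetric] sqn_self by (simp add: add.commute)
  show "YY (Suc k) \<le> (1 + \<beta>) * (step_tau (k div m) * RR (Suc k) + t2 * prv m (k div m) YY + (1 - step_tau (k div m) - t2) * YY k)
      + (1 + 1 / \<beta>) * (3 * ee (Suc k))" if "0 < \<beta>" for k \<beta>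
  proof -
    have R: "ET (\<lambda>\<omega>. 3 * L * sqn d (vdiff (fst (snd \<omega>) (Suc k)) xs)) = RR (Suc k)"
      unfolding RR_def by (rule E_cong) (simp add: sqn_swap[of d xs])
    show ?thesis using near_ybf_expectation[OF that, of k "\<lambda>\<omega>. xs"] unfolding YY_def[symmetric] R .
  qed
  show "GG k k \<le> 2 * YY k + 2 * RR k" for k
  proof -
    have path: "3 * L * sqn d (vdiff (fst \<omega> k) (fst (snd \<omega>) k))
        \<le> 2 * (3 * L * sqn d (vdiff (fst \<omega> k) xs)) + 2 * (3 * L * sqn d (vdiff xs (fst (snd \<omega>) k)))" for \<omega> :: hist
    proof -
      have "sqn d (\<lambda>j. vdiff (fst \<omega> k) xs j + vdiff xs (fst (snd \<omega>) k) j)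
          \<le> (1 + 1) * sqn d (vdiff (fst \<omega> k) xs) + (1 + 1 / 1) * sqn d (vdiff xs (fst (snd \<omega>) k))"
        by (rule sqn_young) simp
      moreover have "(\<lambda>j. vdiff (fst \<omega> k) xs j + vdiff xs (fst (snd \<omega>) k) j) = vdiff (fst \<omega> k) (fst (snd \<omega>) k)"
        by (simp add: vdiff_def)
      ultimately have "sqn d (vdiff (fst \<omega> k) (fst (snd \<omega>) k)) \<le> 2 * sqn d (vdiff (fst \<omega> k) xs) + 2 * sqn d (vdiff xs (fst (snd \<omega>) k))"
        by simp
      from mult_left_mono[OF this, of "3 * L"] show ?thesis using L_pos by (simp add: algebra_simps)
    qed
    have "GG k k \<le> ET (\<lambda>\<omega>. 2 * (3 * L * sqn d (vdiff (fst \<omega> k) xs)) + 2 * (3 * L * sqn d (vdiff xs (fst (snd \<omega>) k))))"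
      unfolding GG_def by (rule E_mono[OF finite_H path])
    then show ?thesis unfolding E_add[OF finite_H] integral_mult_right_zero YY_def RR_def .
  qed
qed

lemma convergence:
  "E (alpc_run n gr h L d N m B lam b t2 x0 S) (\<lambda>\<omega>. real_of_ereal (PP n f h (fst \<omega>) - PP n f h xs))
    \<le> 5000000000000 * (real m * (Pr x0 - Pr xs) + 3 * L * sqn d (vdiff x0 xs)) / (real m * (real S)\<^sup>2)"
proof -
  have "E (alpc_run n gr h L d N m B lam b t2 x0 S) (\<lambda>\<omega>. real_of_ereal (PP n f h (fst \<omega>) - PP n f h xs))
      = ET (\<lambda>\<omega>. real_of_ereal (PP n f h (fst (pout S \<omega>)) - PP n f h xs))"
    unfolding alpc_run_H by (simp add: mult.commute)
  also have "\<dots> = ET (\<lambda>\<omega>. Pr (xt_of S (fst \<omega>)) - Pr xs)"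
  proof (rule E_cong)
    fix \<omega> assume \<omega>: "\<omega> \<in> set_pmf (H T)"
    have "xt_of S (fst \<omega>) \<in> dm" by (intro xt_of_jensen(1)[OF hr_conv] H_support(1)[OF \<omega>])
    moreover have "fst (pout S \<omega>) = xt_of S (fst \<omega>)" by (simp add: pout_def split: prod.splits)
    ultimately show "real_of_ereal (PP n f h (fst (pout S \<omega>)) - PP n f h xs) = Pr (xt_of S (fst \<omega>)) - Pr xs"
      by (simp add: PP_Pr xs_dm)
  qed
  also have "\<dots> \<le> prv m S gap" by (rule xt_gap)
  also have "\<dots> \<le> 5000000000000 * (real m * gap 0 + RR 0) / (real m * (real S)\<^sup>2)" by (rule rates.last_average_rate)
  finally show ?thesis unfolding gap_0 RR_0 .
qed

end

theorem theorem4: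
  shows "\<exists>C>0. \<forall>(n::nat) (d::nat) (N::nat) (S::nat) (m::nat) (B::nat) (b::nat)
      (L::real) (lam::real) (dl::real) (tau2::real)
      (f::nat \<Rightarrow> rvec \<Rightarrow> real) (gr::nat \<Rightarrow> rvec \<Rightarrow> rvec) (h::rvec \<Rightarrow> ereal) (x0::rvec) (xs::rvec).
    n \<ge> 1 \<and> d \<ge> 1 \<and> N \<ge> 1 \<and> S \<ge> 1 \<and> m \<ge> 1 \<and> B \<ge> 1 \<and> b \<ge> 2 \<and>
    L > 0 \<and> 0 < lam \<and> lam \<le> 1 \<and> dl \<ge> 0 \<and>
    (\<forall>i\<in>{1..n}. has_grad d (f i) (gr i) \<and> lipschitz_grad d L (gr i) \<and> convex_Vd d (f i)) \<and>
    proper_convex_lsc d h \<and> x0 \<in> Vd d \<and> is_minimizer d (PP n f h) xs \<and>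
    tau2 = 5 * (real d * lam\<^sup>2 / (4 * ((2::real) ^ (b - 1) - 1)\<^sup>2) + dl * (1 - lam)\<^sup>2
                + 1 / (real N * real B)) / 3 + 1 / (2 * real B) \<and>
    tau2 \<le> 1 / 2 \<and>
    (AE \<omega> in measure_pmf (alpc_run n gr h L d N m B lam b tau2 x0 S).
        \<forall>u\<in>set (snd (snd (snd \<omega>))). real (outside_count d lam b u) \<le> dl)
    \<longrightarrow>
    ereal (measure_pmf.expectation (alpc_run n gr h L d N m B lam b tau2 x0 S)
             (\<lambda>\<omega>. real_of_ereal (PP n f h (fst \<omega>) - PP n f h xs)))
      \<le> ereal (C / (real m * real S ^ 2)) *
         (ereal (real m) * (PP n f h x0 - PP n f h xs) + ereal (L * (nrm d (\<lambda>j. x0 j - xs j))\<^sup>2))"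
proof (intro exI[of _ "15000000000000::real"] conjI allI impI)
  fix n d N S m B b :: nat and L lam dl tau2 :: real and f gr and h :: "rvec \<Rightarrow> ereal" and x0 xs :: rvec
  assume asm: "n \<ge> 1 \<and> d \<ge> 1 \<and> N \<ge> 1 \<and> S \<ge> 1 \<and> m \<ge> 1 \<and> B \<ge> 1 \<and> b \<ge> 2 \<and>
    L > 0 \<and> 0 < lam \<and> lam \<le> 1 \<and> dl \<ge> 0 \<and>
    (\<forall>i\<in>{1..n}. has_grad d (f i) (gr i) \<and> lipschitz_grad d L (gr i) \<and> convex_Vd d (f i)) \<and>
    proper_convex_lsc d h \<and> x0 \<in> Vd d \<and> is_minimizer d (PP n f h) xs \<and>
    tau2 = 5 * (real d * lam\<^sup>2 / (4 * ((2::real) ^ (b - 1) - 1)\<^sup>2) + dl * (1 - lam)\<^sup>2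
                + 1 / (real N * real B)) / 3 + 1 / (2 * real B) \<and>
    tau2 \<le> 1 / 2 \<and>
    (AE \<omega> in measure_pmf (alpc_run n gr h L d N m B lam b tau2 x0 S).
        \<forall>u\<in>set (snd (snd (snd \<omega>))). real (outside_count d lam b u) \<le> dl)"
  interpret step: alpc_step n d L f gr h xs N B b lam dl tau2
    by unfold_locales (use asm in \<open>auto simp: quant_const_def\<close>)
  have mS: "real m > 0" "real S > 0" using asm by auto
  \<comment> \<open>Three times the constant of \<open>last_average_rate\<close>, because
    \<open>RR 0\<close> is \<open>3 * L\<close> times the squared initial distance.\<close>
  let ?C = "15000000000000 :: real"
  let ?K = "?C / (real m * real S ^ 2)"
  have K: "?K > 0" using mS by simp
  show "ereal (measure_pmf.expectation (alpc_run n gr h L d N m B lam b tau2 x0 S)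
             (\<lambda>\<omega>. real_of_ereal (PP n f h (fst \<omega>) - PP n f h xs)))
      \<le> ereal ?K * (ereal (real m) * (PP n f h x0 - PP n f h xs) + ereal (L * (nrm d (\<lambda>j. x0 j - xs j))\<^sup>2))"
  proof (cases "x0 \<in> step.dm")
    case True
    interpret proc: alpc_process n d L f gr h xs N B b lam dl tau2 m S x0
    proof unfold_locales
      show "1 \<le> m" "1 \<le> S" "x0 \<in> step.dm" using asm True by auto
      fix \<omega> u assume "\<omega> \<in> set_pmf (alpc_run n gr h L d N m B lam b tau2 x0 S)" "u \<in> set (snd (snd (snd \<omega>)))"
      then show "real (outside_count d lam b u) \<le> dl" using asm by (auto simp: AE_measure_pmf_iff)
    qed
    define g where "g = step.Pr x0 - step.Pr xs"
    define r where "r = L * sqn d (vdiff x0 xs)"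
    have g: "g \<ge> 0" using step.Pr_min[OF True] by (simp add: g_def)
    have "measure_pmf.expectation (alpc_run n gr h L d N m B lam b tau2 x0 S)
             (\<lambda>\<omega>. real_of_ereal (PP n f h (fst \<omega>) - PP n f h xs))
        \<le> 5000000000000 * (real m * g + 3 * r) / (real m * (real S)\<^sup>2)"
      using proc.convergence by (simp add: g_def r_def mult.assoc)
    also have "\<dots> \<le> 5000000000000 * (3 * (real m * g + r)) / (real m * (real S)\<^sup>2)"
      using g mS by (intro divide_right_mono mult_left_mono) auto
    also have "\<dots> = ?K * (real m * g + r)" by simp
    finally have "measure_pmf.expectation (alpc_run n gr h L d N m B lam b tau2 x0 S)
             (\<lambda>\<omega>. real_of_ereal (PP n f h (fst \<omega>) - PP n f h xs)) \<le> ?K * (real m * g + r)" .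
    moreover have "ereal ?K * (ereal (real m) * (PP n f h x0 - PP n f h xs) + ereal (L * (nrm d (\<lambda>j. x0 j - xs j))\<^sup>2))
        = ereal (?K * (real m * g + r))"
      by (simp add: step.PP_Pr[OF True] step.PP_Pr[OF step.xs_dm] g_def r_def nrm_sq vdiff_def)
    ultimately show ?thesis by (simp only: ereal_less_eq(3))
  next
    \<comment> \<open>An initial point outside the domain of \<open>h\<close> makes the right side
      infinite.\<close>
    case False
    then have "h x0 = \<infinity>" using asm by (simp add: step.dm_def)
    then have "PP n f h x0 - PP n f h xs = \<infinity>" by (simp add: PP_def step.h_hr[OF step.xs_dm])
    then have "ereal (real m) * (PP n f h x0 - PP n f h xs) + ereal (L * (nrm d (\<lambda>j. x0 j - xs j))\<^sup>2) = \<infinity>"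
      using mS by simp
    then show ?thesis using K by simp
  qed
qed simp

end
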